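(* Let $m\ge1$, let $\lambda\in\mathbb{C}^m$ be generic, let $\alpha\in\mathbb{Z}_{\ge0}^m$, and put $\tau=(-\lambda\cdot\alpha,\lambda)$ and $\beta=(1,\alpha)$. Assume $\beta\in\Sigma_\tau$. Then each of the two families of functions $$\{G_k^{i,j}\}=\{\mathrm{Tr}(A^iC_kB^j)\},\qquad \{H_k^{i,j}\}=\{w(A^iC_kB^j)v\}\qquad (i,j\in\mathbb{Z}_{\ge0},\ 0\le k\le m-1)$$ is a generating set of the $\mathbb{C}$-algebra $\mathcal{O}(\mathfrak{M}^\tau(Q_m,\beta))$.
   Context: $Q_m$ is the quiver with vertices $\infty,0,1,\dots,m-1$ (the last $m$ read in $\mathbb{Z}/m\mathbb{Z}$) and arrows $a_i:i+1\to i$ ($i\in\mathbb{Z}/m\mathbb{Z}$), $a_\infty:\infty\to0$; $\tilde A_{m-1}$ is the subquiver on $0,\dots,m-1$ with arrows $a_0,\dots,a_{m-1}$. Vectors are indexed in the order $\infty,0,\dots,m-1$. $\lambda\in\mathbb{C}^m$ is generic if $\lambda\cdot\gamma\ne0$ for every (real or imaginary) root $\gamma$ of $\tilde A_{m-1}$. $\Pi^\tau(Q_m)=\mathbb{C}\bar Q_m/(\sum_a[a,a^*]-\sum_i\tau_ie_i)$ is the deformed preprojective algebra, where $\bar Q_m$ is the double quiver. $\mathfrak{M}^\tau(Q_m,\beta)=\mathrm{Rep}(\Pi^\tau(Q_m),\beta)/\!/G(\beta)$ with $G(\beta)=(\prod_i\mathrm{GL}(\beta_i,\mathbb{C}))/\mathbb{C}^\times$.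 For $\beta=(1,\alpha)$, a point is represented by maps $X_i:\mathbb{C}^{\alpha_{i+1}}\to\mathbb{C}^{\alpha_i}$, $Y_i:\mathbb{C}^{\alpha_i}\to\mathbb{C}^{\alpha_{i+1}}$ ($i\in\mathbb{Z}/m\mathbb{Z}$), $v:\mathbb{C}\to\mathbb{C}^{\alpha_0}$, $w:\mathbb{C}^{\alpha_0}\to\mathbb{C}$ with $X_0Y_0-Y_{m-1}X_{m-1}+vw=\lambda_0\mathrm{Id}$, $X_iY_i-Y_{i-1}X_{i-1}=\lambda_i\mathrm{Id}$ for $i\ne0$, $-wv=-\lambda\cdot\alpha$, modulo the action of $G(\beta)$. Put $A=Y_{m-1}\cdots Y_1Y_0$, $B=X_0X_1\cdots X_{m-1}$, $C_0=\mathrm{Id}_{\alpha_0}$, and $C_k=Y_{m-1}\cdots Y_{m-k}X_{m-k}\cdots X_{m-1}$ for $1\le k\le m-1$; all are endomorphisms of $\mathbb{C}^{\alpha_0}$. With the Ringel form $\langle\alpha,\beta\rangle=\sum_i\alpha_i\beta_i-\sum_{a:i\to j}\alpha_i\beta_j$ of $Q_m$ and $p(\beta)=1-\langle\beta,\beta\rangle$, $\Sigma_\tau$ is the set of positive roots $\beta$ of $Q_m$ with $\tau\cdot\beta=0$ and $p(\beta)>\sum_{t=1}^rp(\beta^{(t)})$ for every decomposition $\beta=\beta^{(1)}+\dots+\beta^{(r)}$ with $r\ge2$ into positive roots $\beta^{(t)}$ with $\tau\cdot\beta^{(t)}=0$. *)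

theory Defs
  imports
    "Jordan_Normal_Form.Matrix"
    "HOL-Algebra.Product_Groups"
    "Graph_Theory.Graph_Theory"
begin

section \<open>Roots of a finite quiver\<close>

text \<open>A quiver is a directed multigraph in the sense of \<^typ>\<open>('v, 'e) pre_digraph\<close>.\<close>

definition ringel_form :: "('v, 'e) pre_digraph \<Rightarrow> ('v \<Rightarrow> int) \<Rightarrow> ('v \<Rightarrow> int) \<Rightarrow> int" where
  "ringel_form Q x y =
     (\<Sum>i\<in>verts Q. x i * y i) - (\<Sum>a\<in>arcs Q. x (tail Q a) * y (head Q a))"

definition sym_form :: "('v, 'e) pre_digraph \<Rightarrow> ('v \<Rightarrow> int) \<Rightarrow> ('v \<Rightarrow> int) \<Rightarrow> int" where
  "sym_form Q x y = ringel_form Q x y + ringel_form Q y x"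

definition p_fun :: "('v, 'e) pre_digraph \<Rightarrow> ('v \<Rightarrow> int) \<Rightarrow> int" where
  "p_fun Q x = 1 - ringel_form Q x x"

definition coord_vec :: "'v \<Rightarrow> 'v \<Rightarrow> int" where
  "coord_vec i = (\<lambda>j. if j = i then 1 else 0)"

definition loopfree_vertices :: "('v, 'e) pre_digraph \<Rightarrow> 'v set" where
  "loopfree_vertices Q = {i \<in> verts Q. \<not> (\<exists>a\<in>arcs Q. tail Q a = i \<and> head Q a = i)}"

definition simple_reflection :: "('v, 'e) pre_digraph \<Rightarrow> 'v \<Rightarrow> ('v \<Rightarrow> int) \<Rightarrow> 'v \<Rightarrow> int" where
  "simple_reflection Q i x = (\<lambda>j. x j - sym_form Q x (coord_vec i) * coord_vec i j)"

text \<open>The roots are those of Kac: the orbits of the coordinate vectors at loopfree vertices and of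
  \<open>\<plusminus>\<close> the fundamental region under the group generated by the reflections at loopfree vertices
  (these are involutions, so closure under them gives the orbits).\<close>

definition fundamental_region :: "('v, 'e) pre_digraph \<Rightarrow> ('v \<Rightarrow> int) set" where
  "fundamental_region Q =
     {x. (\<forall>i. 0 \<le> x i) \<and> (\<forall>i. i \<notin> verts Q \<longrightarrow> x i = 0) \<and> x \<noteq> (\<lambda>_. 0) \<and>
         connected (Q \<restriction> {i. x i \<noteq> 0}) \<and>
         (\<forall>i\<in>verts Q. sym_form Q x (coord_vec i) \<le> 0)}"

inductive_set real_roots :: "('v, 'e) pre_digraph \<Rightarrow> ('v \<Rightarrow> int) set" for Q where
  simple: "i \<in> loopfree_vertices Q \<Longrightarrow> coord_vec i \<in> real_roots Q"
| reflect: "x \<in> real_roots Q \<Longrightarrow> i \<in> loopfree_vertices Q \<Longrightarrow>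
            simple_reflection Q i x \<in> real_roots Q"

inductive_set imaginary_roots :: "('v, 'e) pre_digraph \<Rightarrow> ('v \<Rightarrow> int) set" for Q where
  fund: "x \<in> fundamental_region Q \<Longrightarrow> x \<in> imaginary_roots Q"
| fund_neg: "x \<in> fundamental_region Q \<Longrightarrow> (\<lambda>i. - x i) \<in> imaginary_roots Q"
| reflect: "x \<in> imaginary_roots Q \<Longrightarrow> i \<in> loopfree_vertices Q \<Longrightarrow>
            simple_reflection Q i x \<in> imaginary_roots Q"

definition roots :: "('v, 'e) pre_digraph \<Rightarrow> ('v \<Rightarrow> int) set" where
  "roots Q = real_roots Q \<union> imaginary_roots Q"

definition positive_roots :: "('v, 'e) pre_digraph \<Rightarrow> ('v \<Rightarrow> int) set" where
  "positive_roots Q = {x \<in> roots Q. \<forall>i. 0 \<le> x i}"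

definition weight :: "('v, 'e) pre_digraph \<Rightarrow> ('v \<Rightarrow> complex) \<Rightarrow> ('v \<Rightarrow> int) \<Rightarrow> complex" where
  "weight Q \<tau> x = (\<Sum>i\<in>verts Q. \<tau> i * of_int (x i))"

definition Sigma_set :: "('v, 'e) pre_digraph \<Rightarrow> ('v \<Rightarrow> complex) \<Rightarrow> ('v \<Rightarrow> int) set" where
  "Sigma_set Q \<tau> =
     {x \<in> positive_roots Q. weight Q \<tau> x = 0 \<and>
        (\<forall>bs. length bs \<ge> 2 \<longrightarrow> (\<forall>b\<in>set bs. b \<in> positive_roots Q \<and> weight Q \<tau> b = 0) \<longrightarrow>
              (\<forall>i. x i = (\<Sum>b\<leftarrow>bs. b i)) \<longrightarrow>
              p_fun Q x > (\<Sum>b\<leftarrow>bs. p_fun Q b))}"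


section \<open>Representations of deformed preprojective algebras\<close>

text \<open>In the double quiver, \<^term>\<open>Inl a\<close> is the arrow \<open>a\<close> and \<^term>\<open>Inr a\<close> is \<open>a\<^sup>*\<close>.\<close>

definition double_quiver :: "('v, 'e) pre_digraph \<Rightarrow> ('v, 'e + 'e) pre_digraph" where
  "double_quiver Q =
     \<lparr> verts = verts Q, arcs = arcs Q <+> arcs Q,
       tail = case_sum (tail Q) (head Q), head = case_sum (head Q) (tail Q) \<rparr>"

definition rep_space :: "('v, 'e) pre_digraph \<Rightarrow> ('v \<Rightarrow> nat) \<Rightarrow> ('e \<Rightarrow> complex mat) set" where
  "rep_space Q \<beta> = (\<Pi>\<^sub>E a\<in>arcs Q. carrier_mat (\<beta> (head Q a)) (\<beta> (tail Q a)))"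

text \<open>The component at the vertex \<open>i\<close> of \<open>\<Sum>\<^sub>a [a, a\<^sup>*]\<close>.\<close>

definition commutator_sum ::
    "('v, 'e) pre_digraph \<Rightarrow> ('v \<Rightarrow> nat) \<Rightarrow> ('e + 'e \<Rightarrow> complex mat) \<Rightarrow> 'v \<Rightarrow> complex mat" where
  "commutator_sum Q \<beta> x i =
     mat (\<beta> i) (\<beta> i) (\<lambda>(r, c).
       (\<Sum>a | a \<in> arcs Q \<and> head Q a = i. (x (Inl a) * x (Inr a)) $$ (r, c)) -
       (\<Sum>a | a \<in> arcs Q \<and> tail Q a = i. (x (Inr a) * x (Inl a)) $$ (r, c)))"

definition Rep_Pi ::
    "('v, 'e) pre_digraph \<Rightarrow> ('v \<Rightarrow> complex) \<Rightarrow> ('v \<Rightarrow> nat) \<Rightarrow> ('e + 'e \<Rightarrow> complex mat) set" where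
  "Rep_Pi Q \<tau> \<beta> =
     {x \<in> rep_space (double_quiver Q) \<beta>.
        \<forall>i\<in>verts Q. commutator_sum Q \<beta> x i = \<tau> i \<cdot>\<^sub>m 1\<^sub>m (\<beta> i)}"

abbreviation GL :: "nat \<Rightarrow> complex mat monoid" where
  "GL n \<equiv> units_of (ring_mat TYPE(complex) n ())"

definition GL_prod :: "('v, 'e) pre_digraph \<Rightarrow> ('v \<Rightarrow> nat) \<Rightarrow> ('v \<Rightarrow> complex mat) monoid" where
  "GL_prod Q \<beta> = product_group (verts Q) (\<lambda>i. GL (\<beta> i))"

definition scalars :: "('v, 'e) pre_digraph \<Rightarrow> ('v \<Rightarrow> nat) \<Rightarrow> ('v \<Rightarrow> complex mat) set" where
  "scalars Q \<beta> = {\<lambda>i\<in>verts Q. c \<cdot>\<^sub>m 1\<^sub>m (\<beta> i) | c. c \<noteq> 0}"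

definition G_group :: "('v, 'e) pre_digraph \<Rightarrow> ('v \<Rightarrow> nat) \<Rightarrow> ('v \<Rightarrow> complex mat) set monoid" where
  "G_group Q \<beta> = GL_prod Q \<beta> Mod scalars Q \<beta>"

definition rep_act ::
    "('v, 'e) pre_digraph \<Rightarrow> ('v \<Rightarrow> nat) \<Rightarrow> ('v \<Rightarrow> complex mat) \<Rightarrow> ('e \<Rightarrow> complex mat) \<Rightarrow>
     'e \<Rightarrow> complex mat" where
  "rep_act Q \<beta> g x =
     (\<lambda>a\<in>arcs Q. g (head Q a) * x a * inv\<^bsub>GL (\<beta> (tail Q a))\<^esub> g (tail Q a))"

lemma inv_GL:
  assumes "g \<in> carrier (GL n)"
  shows "g \<in> carrier_mat n n" "inv\<^bsub>GL n\<^esub> g \<in> carrier_mat n n"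
    "g * inv\<^bsub>GL n\<^esub> g = 1\<^sub>m n" "inv\<^bsub>GL n\<^esub> g * g = 1\<^sub>m n"
proof -
  interpret R: ring "ring_mat TYPE(complex) n ()" by (rule ring_mat)
  interpret U: group "GL n" by (rule R.units_group)
  have sub: "carrier (GL n) \<subseteq> carrier_mat n n"
    by (auto simp: units_of_def Units_def ring_mat_def)
  show "g \<in> carrier_mat n n" "inv\<^bsub>GL n\<^esub> g \<in> carrier_mat n n"
    using assms U.inv_closed[OF assms] sub by auto
  show "g * inv\<^bsub>GL n\<^esub> g = 1\<^sub>m n" "inv\<^bsub>GL n\<^esub> g * g = 1\<^sub>m n"
    using U.r_inv[OF assms] U.l_inv[OF assms] by (simp_all add: units_of_def ring_mat_def)
qed

lemma scalar_in_GL: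
  assumes "c \<noteq> 0"
  shows "c \<cdot>\<^sub>m 1\<^sub>m n \<in> carrier (GL n)" "inv\<^bsub>GL n\<^esub> (c \<cdot>\<^sub>m 1\<^sub>m n) = (1 / c) \<cdot>\<^sub>m 1\<^sub>m n"
proof -
  have e: "(c \<cdot>\<^sub>m 1\<^sub>m n) * ((1 / c) \<cdot>\<^sub>m 1\<^sub>m n) = (1\<^sub>m n :: complex mat)"
    "((1 / c) \<cdot>\<^sub>m 1\<^sub>m n) * (c \<cdot>\<^sub>m 1\<^sub>m n) = (1\<^sub>m n :: complex mat)"
    using assms by (auto intro!: eq_matI)
  show g: "c \<cdot>\<^sub>m 1\<^sub>m n \<in> carrier (GL n)"
    using e by (auto simp: units_of_def Units_def ring_mat_def intro!: bexI[of _ "(1 / c) \<cdot>\<^sub>m 1\<^sub>m n"])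
  have h: "(1 / c) \<cdot>\<^sub>m 1\<^sub>m n \<in> carrier (GL n)"
    using e by (auto simp: units_of_def Units_def ring_mat_def intro!: bexI[of _ "c \<cdot>\<^sub>m 1\<^sub>m n"])
  interpret R: ring "ring_mat TYPE(complex) n ()" by (rule ring_mat)
  interpret U: group "GL n" by (rule R.units_group)
  show "inv\<^bsub>GL n\<^esub> (c \<cdot>\<^sub>m 1\<^sub>m n) = (1 / c) \<cdot>\<^sub>m 1\<^sub>m n"
    by (rule U.inv_equality[OF _ g h]) (use e in \<open>simp add: units_of_def ring_mat_def\<close>)
qed

lemma rep_act_scalars:
  assumes "wf_digraph Q" "g \<in> scalars Q \<beta>" "x \<in> rep_space Q \<beta>"
  shows "rep_act Q \<beta> g x = x"
proof -
  obtain c where c: "c \<noteq> 0" "g = (\<lambda>i\<in>verts Q. c \<cdot>\<^sub>m 1\<^sub>m (\<beta> i))"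
    using assms(2) by (auto simp: scalars_def)
  have "rep_act Q \<beta> g x a = x a" if a: "a \<in> arcs Q" for a
  proof -
    have "x a \<in> carrier_mat (\<beta> (head Q a)) (\<beta> (tail Q a))"
      using assms(3) a by (auto simp: rep_space_def)
    moreover have "tail Q a \<in> verts Q" "head Q a \<in> verts Q"
      using assms(1) a by (auto simp: wf_digraph_def)
    moreover have "c \<cdot>\<^sub>m ((1 / c) \<cdot>\<^sub>m M) = M" "(1 / c) \<cdot>\<^sub>m (c \<cdot>\<^sub>m M) = M" for M
      using c(1) by (auto intro!: eq_matI)
    ultimately show ?thesis
      using c a
      by (simp add: rep_act_def scalar_in_GL
          mult_smult_assoc_mat[of _ "\<beta> (head Q a)" "\<beta> (head Q a)" _ "\<beta> (tail Q a)"]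
          mult_smult_distrib[of _ "\<beta> (head Q a)" "\<beta> (tail Q a)" _ "\<beta> (tail Q a)"])
  qed
  then show ?thesis
    using assms(3) by (intro ext) (auto simp: rep_act_def rep_space_def PiE_def extensional_def)
qed



section \<open>Coordinate rings\<close>

text \<open>The unital subalgebra, generated by the restrictions of the members of \<open>F\<close> to \<open>Z\<close>, of the
  algebra of complex functions on \<open>Z\<close>. Functions on \<open>Z\<close> are represented extensionally.\<close>

inductive_set generated_algebra :: "'x set \<Rightarrow> ('x \<Rightarrow> complex) set \<Rightarrow> ('x \<Rightarrow> complex) set"
  for Z F where
  const: "(\<lambda>x\<in>Z. c) \<in> generated_algebra Z F"
| gen: "f \<in> F \<Longrightarrow> (\<lambda>x\<in>Z. f x) \<in> generated_algebra Z F"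
| add: "f \<in> generated_algebra Z F \<Longrightarrow> g \<in> generated_algebra Z F \<Longrightarrow>
        (\<lambda>x\<in>Z. f x + g x) \<in> generated_algebra Z F"
| mult: "f \<in> generated_algebra Z F \<Longrightarrow> g \<in> generated_algebra Z F \<Longrightarrow>
        (\<lambda>x\<in>Z. f x * g x) \<in> generated_algebra Z F"

definition coordinate_functions ::
    "('v, 'e) pre_digraph \<Rightarrow> ('v \<Rightarrow> nat) \<Rightarrow> (('e \<Rightarrow> complex mat) \<Rightarrow> complex) set" where
  "coordinate_functions Q \<beta> =
     {\<lambda>x. x a $$ (r, c) | a r c. a \<in> arcs Q \<and> r < \<beta> (head Q a) \<and> c < \<beta> (tail Q a)}"

text \<open>Regular functions on the closed subvariety \<open>Rep(\<Pi>\<^sup>\<tau>(Q), \<beta>)\<close> of \<open>Rep(double_quiver Q, \<beta>)\<close>: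
  restrictions of polynomials in the matrix entries.\<close>

definition O_Rep_Pi ::
    "('v, 'e) pre_digraph \<Rightarrow> ('v \<Rightarrow> complex) \<Rightarrow> ('v \<Rightarrow> nat) \<Rightarrow>
     (('e + 'e \<Rightarrow> complex mat) \<Rightarrow> complex) set" where
  "O_Rep_Pi Q \<tau> \<beta> =
     generated_algebra (Rep_Pi Q \<tau> \<beta>) (coordinate_functions (double_quiver Q) \<beta>)"

text \<open>The coordinate ring of the affine quotient \<open>Rep(\<Pi>\<^sup>\<tau>(Q), \<beta>) // G(\<beta>)\<close> is the ring of
  \<open>G(\<beta>)\<close>-invariant regular functions. A coset \<open>K\<close> acts through any of its representatives, which is
  well defined by \<open>rep_act_scalars\<close>.\<close>

definition O_M ::
    "('v, 'e) pre_digraph \<Rightarrow> ('v \<Rightarrow> complex) \<Rightarrow> ('v \<Rightarrow> nat) \<Rightarrow>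
     (('e + 'e \<Rightarrow> complex mat) \<Rightarrow> complex) set" where
  "O_M Q \<tau> \<beta> =
     {f \<in> O_Rep_Pi Q \<tau> \<beta>.
        \<forall>K\<in>carrier (G_group Q \<beta>). \<forall>g\<in>K. \<forall>x\<in>Rep_Pi Q \<tau> \<beta>.
          f (rep_act (double_quiver Q) \<beta> g x) = f x}"


section \<open>The framed cyclic quiver\<close>

datatype vertex = Infty | Vert nat

datatype arrow = Arr_infty | Arr nat

fun arrow_tail :: "nat \<Rightarrow> arrow \<Rightarrow> vertex" where
  "arrow_tail m Arr_infty = Infty"
| "arrow_tail m (Arr i) = Vert ((i + 1) mod m)"

fun arrow_head :: "nat \<Rightarrow> arrow \<Rightarrow> vertex" where
  "arrow_head m Arr_infty = Vert 0"
| "arrow_head m (Arr i) = Vert i"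

definition cyclic_quiver :: "nat \<Rightarrow> (vertex, arrow) pre_digraph" where
  "cyclic_quiver m =
     \<lparr> verts = Vert ` {..<m}, arcs = Arr ` {..<m},
       tail = arrow_tail m, head = arrow_head m \<rparr>"

definition framed_quiver :: "nat \<Rightarrow> (vertex, arrow) pre_digraph" where
  "framed_quiver m =
     \<lparr> verts = insert Infty (Vert ` {..<m}), arcs = insert Arr_infty (Arr ` {..<m}),
       tail = arrow_tail m, head = arrow_head m \<rparr>"

text \<open>Elements of \<open>\<complex>\<^sup>m\<close> and \<open>\<nat>\<^sup>m\<close> are given by functions on \<^typ>\<open>nat\<close>, whose values outside
  \<open>{..<m}\<close> are never used.\<close>

definition generic :: "nat \<Rightarrow> (nat \<Rightarrow> complex) \<Rightarrow> bool" where
  "generic m lam \<longleftrightarrow>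
     (\<forall>\<gamma>\<in>roots (cyclic_quiver m). (\<Sum>i<m. lam i * of_int (\<gamma> (Vert i))) \<noteq> 0)"

fun framed_dim :: "nat \<Rightarrow> (nat \<Rightarrow> nat) \<Rightarrow> vertex \<Rightarrow> nat" where
  "framed_dim m \<alpha> Infty = 1"
| "framed_dim m \<alpha> (Vert i) = (if i < m then \<alpha> i else 0)"

fun framed_par :: "nat \<Rightarrow> (nat \<Rightarrow> complex) \<Rightarrow> (nat \<Rightarrow> nat) \<Rightarrow> vertex \<Rightarrow> complex" where
  "framed_par m lam \<alpha> Infty = - (\<Sum>i<m. lam i * of_nat (\<alpha> i))"
| "framed_par m lam \<alpha> (Vert i) = (if i < m then lam i else 0)"

type_synonym point = "arrow + arrow \<Rightarrow> complex mat"

abbreviation X_map :: "point \<Rightarrow> nat \<Rightarrow> complex mat" where "X_map x i \<equiv> x (Inl (Arr i))"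
abbreviation Y_map :: "point \<Rightarrow> nat \<Rightarrow> complex mat" where "Y_map x i \<equiv> x (Inr (Arr i))"
abbreviation v_map :: "point \<Rightarrow> complex mat" where "v_map x \<equiv> x (Inl Arr_infty)"
abbreviation w_map :: "point \<Rightarrow> complex mat" where "w_map x \<equiv> x (Inr Arr_infty)"

text \<open>The defining relations of \<open>Rep(\<Pi>\<^sup>\<tau>(Q\<^sub>m), (1, \<alpha>))\<close> in terms of \<open>X\<^sub>i, Y\<^sub>i, v, w\<close>.\<close>

lemma Rep_Pi_framed_iff:
  assumes m: "m \<ge> 1"
  shows "x \<in> Rep_Pi (framed_quiver m) (framed_par m lam \<alpha>) (framed_dim m \<alpha>) \<longleftrightarrow>
    x \<in> extensional (insert Arr_infty (Arr ` {..<m}) <+> insert Arr_infty (Arr ` {..<m})) \<and>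
    (\<forall>i<m. X_map x i \<in> carrier_mat (\<alpha> i) (\<alpha> ((i + 1) mod m))) \<and>
    (\<forall>i<m. Y_map x i \<in> carrier_mat (\<alpha> ((i + 1) mod m)) (\<alpha> i)) \<and>
    v_map x \<in> carrier_mat (\<alpha> 0) 1 \<and> w_map x \<in> carrier_mat 1 (\<alpha> 0) \<and>
    X_map x 0 * Y_map x 0 - Y_map x (m - 1) * X_map x (m - 1) + v_map x * w_map x
      = lam 0 \<cdot>\<^sub>m 1\<^sub>m (\<alpha> 0) \<and>
    (\<forall>i. 0 < i \<and> i < m \<longrightarrow>
      X_map x i * Y_map x i - Y_map x (i - 1) * X_map x (i - 1) = lam i \<cdot>\<^sub>m 1\<^sub>m (\<alpha> i)) \<and>
    - (w_map x * v_map x) = (- (\<Sum>i<m. lam i * of_nat (\<alpha> i))) \<cdot>\<^sub>m 1\<^sub>m 1"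
    (is "_ \<longleftrightarrow> ?E \<and> ?X \<and> ?Y \<and> ?v \<and> ?w \<and> ?V \<and> ?R \<and> ?I")
proof -
  let ?Q = "framed_quiver m" and ?b = "framed_dim m \<alpha>"
  have space: "x \<in> rep_space (double_quiver ?Q) ?b \<longleftrightarrow> ?E \<and> ?X \<and> ?Y \<and> ?v \<and> ?w"
  proof -
    have *: "(\<forall>a\<in>insert p (f ` {..<m}). P a) \<longleftrightarrow> P p \<and> (\<forall>i<m. P (f i))" for P and p :: "arrow + arrow" and f
      by auto
    have arcs: "arcs (double_quiver ?Q) = insert Arr_infty (Arr ` {..<m}) <+> insert Arr_infty (Arr ` {..<m})"
      by (simp add: double_quiver_def framed_quiver_def)
    show ?thesis
      unfolding rep_space_def PiE_def Pi_iff arcs Int_iff Plus_def ball_Un image_insert image_image *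
      using m by (simp add: double_quiver_def framed_quiver_def) blast
  qed
  have prev0: "{a \<in> arcs ?Q. tail ?Q a = Vert 0} = {Arr (m - 1)}"
  proof -
    have "k = m - 1" if "k < m" "Suc k mod m = 0" for k
      using that m by (cases "Suc k = m") auto
    then show ?thesis using m by (auto simp: framed_quiver_def)
  qed
  have prev: "{a \<in> arcs ?Q. tail ?Q a = Vert i} = {Arr (i - 1)}" if "0 < i" "i < m" for i
  proof -
    have "k = i - 1" if "k < m" "Suc k mod m = i" for k
      using that \<open>0 < i\<close> by (cases "Suc k = m") auto
    then show ?thesis using that by (auto simp: framed_quiver_def)
  qed
  have prevI: "{a \<in> arcs ?Q. tail ?Q a = Infty} = {Arr_infty}"
    by (auto simp: framed_quiver_def)
  have nxt0: "{a \<in> arcs ?Q. head ?Q a = Vert 0} = {Arr 0, Arr_infty}"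
    using m by (auto simp: framed_quiver_def)
  have nxt: "{a \<in> arcs ?Q. head ?Q a = Vert i} = {Arr i}" if "0 < i" "i < m" for i
    using that by (auto simp: framed_quiver_def)
  have nxtI: "{a \<in> arcs ?Q. head ?Q a = Infty} = {}"
    by (auto simp: framed_quiver_def)
  have "(\<forall>i\<in>verts ?Q. commutator_sum ?Q ?b x i = framed_par m lam \<alpha> i \<cdot>\<^sub>m 1\<^sub>m (?b i))
        \<longleftrightarrow> ?V \<and> ?R \<and> ?I"
    if dims: ?X ?Y ?v ?w
  proof -
    have X0: "X_map x 0 \<in> carrier_mat (\<alpha> 0) (\<alpha> (1 mod m))"
      and Y0: "Y_map x 0 \<in> carrier_mat (\<alpha> (1 mod m)) (\<alpha> 0)"
      using dims(1,2)[rule_format, of 0] m by auto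
    have Xm: "X_map x (m - 1) \<in> carrier_mat (\<alpha> (m - 1)) (\<alpha> 0)"
      and Ym: "Y_map x (m - 1) \<in> carrier_mat (\<alpha> 0) (\<alpha> (m - 1))"
      using dims(1,2)[rule_format, of "m - 1"] m by auto
    have c0: "commutator_sum ?Q ?b x (Vert 0) =
        X_map x 0 * Y_map x 0 - Y_map x (m - 1) * X_map x (m - 1) + v_map x * w_map x"
      using X0 Y0 Xm Ym dims(3,4) m
      by (intro eq_matI) (auto simp: commutator_sum_def prev0 nxt0 simp del: index_mult_mat(1)) 
    have c: "commutator_sum ?Q ?b x (Vert i) =
        X_map x i * Y_map x i - Y_map x (i - 1) * X_map x (i - 1)" if i: "0 < i" "i < m" for i
    proof -
      have "X_map x i \<in> carrier_mat (\<alpha> i) (\<alpha> ((i + 1) mod m))"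
        "Y_map x i \<in> carrier_mat (\<alpha> ((i + 1) mod m)) (\<alpha> i)"
        "X_map x (i - 1) \<in> carrier_mat (\<alpha> (i - 1)) (\<alpha> i)"
        "Y_map x (i - 1) \<in> carrier_mat (\<alpha> i) (\<alpha> (i - 1))"
        using dims(1,2)[rule_format, of i] dims(1,2)[rule_format, of "i - 1"] i by auto
      then show ?thesis
        using i by (intro eq_matI) (auto simp: commutator_sum_def prev nxt simp del: index_mult_mat(1))
    qed
    have cI: "commutator_sum ?Q ?b x Infty = - (w_map x * v_map x)"
      using dims(3,4) by (intro eq_matI) (auto simp: commutator_sum_def prevI nxtI simp del: index_mult_mat(1))
    have "verts ?Q = insert Infty (insert (Vert 0) (Vert ` {0<..<m}))"
      using m by (force simp: framed_quiver_def)
    then show ?thesis using m by (auto simp: c0 c cI)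
  qed
  then show ?thesis unfolding Rep_Pi_def using space by blast
qed

definition mat_product :: "nat \<Rightarrow> complex mat list \<Rightarrow> complex mat" where
  "mat_product n Ms = foldr (*) Ms (1\<^sub>m n)"

text \<open>\<open>Y\<^sub>m\<^sub>-\<^sub>1 \<cdots> Y\<^sub>0\<close>, \<open>X\<^sub>0 \<cdots> X\<^sub>m\<^sub>-\<^sub>1\<close> and
  \<open>Y\<^sub>m\<^sub>-\<^sub>1 \<cdots> Y\<^sub>m\<^sub>-\<^sub>k X\<^sub>m\<^sub>-\<^sub>k \<cdots> X\<^sub>m\<^sub>-\<^sub>1\<close>; the last is the identity for \<open>k = 0\<close>.\<close>

definition A_mat :: "nat \<Rightarrow> (nat \<Rightarrow> nat) \<Rightarrow> point \<Rightarrow> complex mat" where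
  "A_mat m \<alpha> x = mat_product (\<alpha> 0) (map (Y_map x) (rev [0..<m]))"

definition B_mat :: "nat \<Rightarrow> (nat \<Rightarrow> nat) \<Rightarrow> point \<Rightarrow> complex mat" where
  "B_mat m \<alpha> x = mat_product (\<alpha> 0) (map (X_map x) [0..<m])"

definition C_mat :: "nat \<Rightarrow> (nat \<Rightarrow> nat) \<Rightarrow> nat \<Rightarrow> point \<Rightarrow> complex mat" where
  "C_mat m \<alpha> k x =
     mat_product (\<alpha> 0) (map (Y_map x) (rev [m - k..<m]) @ map (X_map x) [m - k..<m])"

definition mat_trace :: "complex mat \<Rightarrow> complex" where
  "mat_trace M = (\<Sum>r<dim_row M. M $$ (r, r))"

definition G_fun :: "nat \<Rightarrow> (nat \<Rightarrow> nat) \<Rightarrow> nat \<Rightarrow> nat \<Rightarrow> nat \<Rightarrow> point \<Rightarrow> complex" where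
  "G_fun m \<alpha> k i j x = mat_trace (A_mat m \<alpha> x ^\<^sub>m i * C_mat m \<alpha> k x * B_mat m \<alpha> x ^\<^sub>m j)"

definition H_fun :: "nat \<Rightarrow> (nat \<Rightarrow> nat) \<Rightarrow> nat \<Rightarrow> nat \<Rightarrow> nat \<Rightarrow> point \<Rightarrow> complex" where
  "H_fun m \<alpha> k i j x =
     (w_map x * (A_mat m \<alpha> x ^\<^sub>m i * C_mat m \<alpha> k x * B_mat m \<alpha> x ^\<^sub>m j) * v_map x) $$ (0, 0)"


end

theory Submission
  imports Defs "Jordan_Normal_Form.Determinant"
begin

text \<open>Invariant regular functions on \<open>Rep(\<Pi>\<^sup>\<tau>(Q), \<beta>)\<close> are generated by traces of cycles (Le Bruyn and
  Procesi). Because the functions live on a closed subvariety only, this is shown by eliminating one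
  vertex at a time: if \<open>f\<close> is invariant under \<open>GL\<^sub>n\<close>, then \<open>det g ^ D * f x\<close> is a polynomial in \<open>g\<close>
  built from the entries of \<open>g M(x) adj(g)\<close>, and applying Cayley's Omega process in \<open>g\<close> to both sides
  gives a nonzero multiple of \<open>f x\<close> on the left and index contractions, that is traces, on the right.

  In the framed cyclic quiver the relations allow one to replace \<open>XY\<close> by \<open>YX\<close> in a word at the cost of
  terms of lower degree, so every cycle reduces to the words \<open>Y\<^sup>q X\<^sup>p\<close>, that is \<open>A\<^sup>i C\<^sub>k B\<^sup>j\<close>. Rotating
  \<open>Y\<^sup>q\<^sup>+\<^sup>1 X\<^sup>p\<^sup>+\<^sup>1\<close> once around the quiver shows that \<open>(\<lambda> \<cdot> \<delta>) Tr(Y\<^sup>q X\<^sup>p)\<close> and \<open>w Y\<^sup>q X\<^sup>p v\<close> agree up to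
  lower degree, where \<open>\<delta> = (1, \<dots>, 1)\<close>. As \<open>\<lambda> \<cdot> \<delta> \<noteq> 0\<close>, each family generates the other.\<close>

section \<open>Algebras of functions\<close>

text \<open>The coordinate ring consists of invariant restrictions to the solution set. An invariant
  function on \<open>Z\<close> does not come with an invariant polynomial extension to all
  representations; producing one is what reductivity is usually invoked for. The Omega process
  avoids the lift: \<open>x\<close> stays a fixed point of \<open>Z\<close>, and only the group
  variable \<open>g\<close> is treated as an indeterminate matrix. Polynomiality in \<open>g\<close>
  is why the adjugate replaces the inverse. Vertices have to be treated one by one because entries
  of rectangular matrices are not functions of square matrices conjugated at a vertex. The grading
  by scalars at that vertex makes them pair up into such. For words, the exchange of
  \<open>X Y\<close> loses one letter of each kind in its correction terms, so everything is an
  induction on length. The comparison of traces with framed values in degree \<open>q + p\<close>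
  has to be read off from words two letters longer: there the leading terms cancel identically, and
  the corrections become the leading terms.\<close>

locale function_algebra =
  fixes Z :: "'x set" and S :: "('x \<Rightarrow> complex) set"
  assumes const_mem: "(\<lambda>x\<in>Z. c) \<in> S"
    and add_mem': "f \<in> S \<Longrightarrow> g \<in> S \<Longrightarrow> (\<lambda>x\<in>Z. f x + g x) \<in> S"
    and mult_mem': "f \<in> S \<Longrightarrow> g \<in> S \<Longrightarrow> (\<lambda>x\<in>Z. f x * g x) \<in> S"
begin

lemma mem_cong: "(\<And>x. x \<in> Z \<Longrightarrow> f x = g x) \<Longrightarrow> restrict f Z \<in> S \<longleftrightarrow> restrict g Z \<in> S"
  by (metis restrict_ext)

lemma add_mem: "restrict f Z \<in> S \<Longrightarrow> restrict g Z \<in> S \<Longrightarrow> (\<lambda>x\<in>Z. f x + g x) \<in> S"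
  using add_mem'[of "restrict f Z" "restrict g Z"] by (simp cong: restrict_cong)

lemma restrict_mem: "f \<in> S \<Longrightarrow> restrict f Z \<in> S"
  using add_mem'[of f "\<lambda>x\<in>Z. 0"] const_mem[of 0] by (simp cong: restrict_cong)

lemma mult_mem: "restrict f Z \<in> S \<Longrightarrow> restrict g Z \<in> S \<Longrightarrow> (\<lambda>x\<in>Z. f x * g x) \<in> S"
  using mult_mem'[of "restrict f Z" "restrict g Z"] by (simp cong: restrict_cong)

lemma cmult_mem: "restrict f Z \<in> S \<Longrightarrow> (\<lambda>x\<in>Z. c * f x) \<in> S"
  using mult_mem[OF const_mem] .

lemma diff_mem: "restrict f Z \<in> S \<Longrightarrow> restrict g Z \<in> S \<Longrightarrow> (\<lambda>x\<in>Z. f x - g x) \<in> S"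
  using add_mem[OF _ cmult_mem[of g "-1"], of f] by simp

lemma sum_mem: "(\<And>i. i \<in> I \<Longrightarrow> restrict (f i) Z \<in> S) \<Longrightarrow> (\<lambda>x\<in>Z. \<Sum>i\<in>I. f i x) \<in> S"
  by (induction I rule: infinite_finite_induct) (simp_all add: const_mem add_mem)

lemma sum_list_mem:
  "(\<And>i. i \<in> set is \<Longrightarrow> restrict (f i) Z \<in> S) \<Longrightarrow> (\<lambda>x\<in>Z. \<Sum>i\<leftarrow>is. f i x) \<in> S"
  by (induction "is") (simp_all add: const_mem add_mem)

lemma generated_subset:
  assumes "\<And>f. f \<in> F \<Longrightarrow> restrict f Z \<in> S"
  shows "generated_algebra Z F \<subseteq> S"
proof
  fix f assume "f \<in> generated_algebra Z F"
  then show "f \<in> S"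
    by induction (blast intro: const_mem assms add_mem' mult_mem')+
qed

end

lemma function_algebra_generated: "function_algebra Z (generated_algebra Z F)"
  by unfold_locales (auto intro: generated_algebra.intros)

lemma generated_restrict: "f \<in> generated_algebra Z F \<Longrightarrow> restrict f Z = f"
  by (induction rule: generated_algebra.induct) auto

text \<open>Elements are polynomials in the \<open>ev e\<close> with coefficients in
  \<open>S\<close>. Exponents are kept as lists with repetition, so that the degree of a monomial is
  a list length. Labels \<open>e\<close> are kept apart from the functions \<open>ev e\<close>, so
  that a label can carry matrix indices or a weight that the function alone does not
  determine.\<close>

lemma (in function_algebra) generated_monomials:
  assumes "f \<in> generated_algebra Z (S \<union> ev ` E)"
  shows "\<exists>js. (\<forall>(h, es)\<in>set js. h \<in> S \<and> set es \<subseteq> E) \<and>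
           (\<forall>x\<in>Z. f x = (\<Sum>(h, es)\<leftarrow>js. h x * (\<Prod>e\<leftarrow>es. ev e x)))"
  using assms
proof induction
  case (const c)
  show ?case using const_mem[of c] by (intro exI[of _ "[(\<lambda>x\<in>Z. c, [])]"]) simp
next
  case (gen f)
  then consider "f \<in> S" | e where "e \<in> E" "f = ev e" by auto
  then show ?case
  proof cases
    case 1
    then show ?thesis by (intro exI[of _ "[(f, [])]"]) simp
  next
    case 2
    then show ?thesis using const_mem[of 1] by (intro exI[of _ "[(\<lambda>x\<in>Z. 1, [e])]"]) simp
  qed
next
  case (add f g)
  then obtain js js' where
    "\<forall>(h, es)\<in>set js. h \<in> S \<and> set es \<subseteq> E" "\<forall>x\<in>Z. f x = (\<Sum>(h, es)\<leftarrow>js. h x * (\<Prod>e\<leftarrow>es. ev e x))"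
    "\<forall>(h, es)\<in>set js'. h \<in> S \<and> set es \<subseteq> E" "\<forall>x\<in>Z. g x = (\<Sum>(h, es)\<leftarrow>js'. h x * (\<Prod>e\<leftarrow>es. ev e x))"
    by blast
  then show ?case by (intro exI[of _ "js @ js'"]) auto
next
  case (mult f g)
  then obtain js js' where
    1: "\<forall>(h, es)\<in>set js. h \<in> S \<and> set es \<subseteq> E" "\<forall>x\<in>Z. f x = (\<Sum>(h, es)\<leftarrow>js. h x * (\<Prod>e\<leftarrow>es. ev e x))"
    and 2: "\<forall>(h, es)\<in>set js'. h \<in> S \<and> set es \<subseteq> E" "\<forall>x\<in>Z. g x = (\<Sum>(h, es)\<leftarrow>js'. h x * (\<Prod>e\<leftarrow>es. ev e x))"
    by blast
  let ?m = "\<lambda>a b. (\<lambda>x\<in>Z. fst a x * fst b x, snd a @ snd b)"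
  let ?T = "\<lambda>js x. \<Sum>(h, es)\<leftarrow>js. h x * (\<Prod>e\<leftarrow>es. ev e x)"
  have single: "?T (map (?m a) bs) x = fst a x * (\<Prod>e\<leftarrow>snd a. ev e x) * ?T bs x"
    if "x \<in> Z" for a bs x
    using that by (induction bs) (auto simp: algebra_simps)
  have "?T (concat (map (\<lambda>a. map (?m a) bs) as)) x = ?T as x * ?T bs x" if "x \<in> Z" for as bs x
    using that single[OF that] by (induction as) (auto simp: algebra_simps)
  moreover have "\<forall>(h, es)\<in>set (concat (map (\<lambda>a. map (?m a) js') js)). h \<in> S \<and> set es \<subseteq> E"
    using 1(1) 2(1) mult_mem' by fastforce
  ultimately show ?case
    using 1(2) 2(2) by (intro exI[of _ "concat (map (\<lambda>a. map (?m a) js') js)"]) simp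
qed

section \<open>Index contractions and squarefree coefficients\<close>

lemma sum_PiE_insert:
  assumes "finite V" "w \<notin> V"
  shows "(\<Sum>K\<in>insert w V \<rightarrow>\<^sub>E B. F K) = (\<Sum>K\<in>V \<rightarrow>\<^sub>E B. \<Sum>b\<in>B. F (K(w := b)))"
proof -
  have "(\<Sum>K\<in>insert w V \<rightarrow>\<^sub>E B. F K) = (\<Sum>(b, K)\<in>B \<times> (V \<rightarrow>\<^sub>E B). F (K(w := b)))"
    unfolding PiE_insert_eq
    by (subst sum.reindex[OF inj_combinator[OF assms(2)]]) (simp add: case_prod_unfold)
  also have "\<dots> = (\<Sum>b\<in>B. \<Sum>K\<in>V \<rightarrow>\<^sub>E B. F (K(w := b)))"
    by (simp add: sum.cartesian_product)
  finally show ?thesis by (simp add: sum.swap[of _ B])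
qed

lemma index_mult_mat_sum:
  assumes "M \<in> carrier_mat a b" "N \<in> carrier_mat b c" "i < a" "j < c"
  shows "(M * N) $$ (i, j) = (\<Sum>k<b. M $$ (i, k) * N $$ (k, j))"
  using assms by (auto simp: scalar_prod_def lessThan_atLeast0 intro!: sum.cong)

text \<open>The sum over \<open>K\<close> factors into traces, one for each cycle of \<open>\<tau>\<close>.\<close>

lemma (in function_algebra) contraction_mem:
  fixes V :: "'v set"
  assumes Mat: "\<And>M x. M \<in> Mat \<Longrightarrow> x \<in> Z \<Longrightarrow> M x \<in> carrier_mat n n"
    and mult: "\<And>M N. M \<in> Mat \<Longrightarrow> N \<in> Mat \<Longrightarrow> (\<lambda>x. M x * N x) \<in> Mat"
    and trace: "\<And>M. M \<in> Mat \<Longrightarrow> (\<lambda>x\<in>Z. mat_trace (M x)) \<in> S"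
    and "finite V" "\<And>v. v \<in> V \<Longrightarrow> N v \<in> Mat" "\<tau> permutes V"
  shows "(\<lambda>x\<in>Z. \<Sum>K\<in>V \<rightarrow>\<^sub>E {..<n}. \<Prod>v\<in>V. N v x $$ (K (\<tau> v), K v)) \<in> S"
  using assms(4-)
proof (induction V arbitrary: N \<tau> rule: finite_induct)
  case empty
  then show ?case using const_mem[of 1] by (subst mem_cong[of _ "\<lambda>_. 1"]) simp_all
next
  case (insert w V)
  \<comment> \<open>\<open>v\<close> is the predecessor of the new slot \<open>w\<close> in its
    cycle. If \<open>v = w\<close>, the slot splits off as a trace; otherwise the sum over the index
    at \<open>w\<close> is a matrix product, and \<open>w\<close> is absorbed into
    \<open>v\<close>.\<close>
  define v where "v = inv_into UNIV \<tau> w"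
  have \<tau>v: "\<tau> v = w" using insert.prems(2) by (simp add: v_def permutes_inverses)
  show ?case
  proof (cases "v = w")
    case True
    have \<tau>V: "\<tau> permutes V"
      using insert.prems(2) by (rule permutes_superset) (use True \<tau>v in auto)
    have *: "(\<Sum>K\<in>insert w V \<rightarrow>\<^sub>E {..<n}. \<Prod>v\<in>insert w V. N v x $$ (K (\<tau> v), K v)) =
        mat_trace (N w x) * (\<Sum>K\<in>V \<rightarrow>\<^sub>E {..<n}. \<Prod>v\<in>V. N v x $$ (K (\<tau> v), K v))"
      if x: "x \<in> Z" for x
    proof -
      have "(\<Prod>v\<in>insert w V. N v x $$ ((K(w := b)) (\<tau> v), (K(w := b)) v)) =
          N w x $$ (b, b) * (\<Prod>v\<in>V. N v x $$ (K (\<tau> v), K v))" for K b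
      proof -
        have "\<tau> u \<in> V" if "u \<in> V" for u using that \<tau>V by (simp add: permutes_in_image)
        then have "\<tau> u \<noteq> w" "u \<noteq> w" if "u \<in> V" for u using that insert.hyps(2) by auto
        then show ?thesis using insert.hyps True \<tau>v by (simp cong: prod.cong)
      qed
      moreover have "mat_trace (N w x) = (\<Sum>b<n. N w x $$ (b, b))"
        using Mat[OF insert.prems(1)[of w] x] by (auto simp: mat_trace_def)
      ultimately show ?thesis
        by (simp add: sum_PiE_insert[OF insert.hyps] sum_distrib_left sum_distrib_right)
    qed
    have "(\<lambda>x\<in>Z. mat_trace (N w x) * (\<Sum>K\<in>V \<rightarrow>\<^sub>E {..<n}. \<Prod>v\<in>V. N v x $$ (K (\<tau> v), K v))) \<in> S"
      using insert.prems(1) \<tau>V by (intro mult_mem trace insert.IH) auto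
    then show ?thesis by (subst mem_cong[OF *])
  next
    case False
    have vV: "v \<in> V"
      using False \<tau>v insert.prems(2) by (metis insertE permutes_not_in insertI1)
    \<comment> \<open>The transposition cuts \<open>w\<close> out of its cycle: \<open>v\<close>
      goes straight to \<open>\<tau> w\<close>, \<open>w\<close> becomes fixed, and every other slot
      keeps its image.\<close>
    define \<tau>' where "\<tau>' = Transposition.transpose w (\<tau> w) \<circ> \<tau>"
    define N' where "N' u = (if u = v then \<lambda>x. N w x * N v x else N u)" for u
    have \<tau>': "\<tau>' permutes V"
    proof (rule permutes_superset)
      show "\<tau>' permutes insert w V"
        unfolding \<tau>'_def using insert.prems(2)
        by (intro permutes_compose permutes_swap_id) (simp_all only: permutes_in_image insertI1)
    qed (use insert.hyps in \<open>auto simp: \<tau>'_def\<close>)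
    have \<tau>'v: "\<tau>' v = \<tau> w" by (simp add: \<tau>'_def \<tau>v)
    have inj: "\<tau> a = \<tau> b \<longleftrightarrow> a = b" for a b
      using insert.prems(2) by (meson injD permutes_inj)
    have \<tau>'u: "\<tau>' u = \<tau> u" "\<tau> u \<noteq> w" if "u \<in> V" "u \<noteq> v" for u
    proof -
      show "\<tau> u \<noteq> w" using that \<tau>v inj by metis
      moreover have "\<tau> u \<noteq> \<tau> w" using that inj insert.hyps by auto
      ultimately show "\<tau>' u = \<tau> u" by (simp add: \<tau>'_def)
    qed
    have w: "\<tau> w \<noteq> w" using False \<tau>v inj by metis
    have *: "(\<Sum>K\<in>insert w V \<rightarrow>\<^sub>E {..<n}. \<Prod>u\<in>insert w V. N u x $$ (K (\<tau> u), K u)) =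
        (\<Sum>K\<in>V \<rightarrow>\<^sub>E {..<n}. \<Prod>u\<in>V. N' u x $$ (K (\<tau>' u), K u))" if x: "x \<in> Z" for x
      unfolding sum_PiE_insert[OF insert.hyps]
    proof (rule sum.cong[OF refl])
      fix K assume K: "K \<in> V \<rightarrow>\<^sub>E {..<n}"
      have \<tau>wV: "\<tau> w \<in> V" using w insert.prems(2) by (metis insertE insertI1 permutes_in_image)
      have bd: "K (\<tau> w) < n" "K v < n" using K vV \<tau>wV by auto
      let ?R = "\<Prod>u\<in>V - {v}. N u x $$ (K (\<tau> u), K u)"
      have split: "(\<Prod>u\<in>V. g u) = g v * (\<Prod>u\<in>V - {v}. g u)" for g :: "'v \<Rightarrow> complex"
        using insert.hyps vV by (simp add: prod.remove)
      have "(\<Prod>u\<in>insert w V. N u x $$ ((K(w := b)) (\<tau> u), (K(w := b)) u)) =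
          N w x $$ (K (\<tau> w), b) * N v x $$ (b, K v) * ?R" for b
      proof -
        have "(\<Prod>u\<in>V - {v}. N u x $$ ((K(w := b)) (\<tau> u), (K(w := b)) u)) = ?R"
          using insert.hyps \<tau>'u(2) by (intro prod.cong) auto
        then show ?thesis using insert.hyps w False by (simp add: split \<tau>v)
      qed
      moreover have "(N w x * N v x) $$ (K (\<tau> w), K v) =
          (\<Sum>b<n. N w x $$ (K (\<tau> w), b) * N v x $$ (b, K v))"
        using Mat[OF insert.prems(1) x] vV bd by (intro index_mult_mat_sum) auto
      moreover have "(\<Prod>u\<in>V. N' u x $$ (K (\<tau>' u), K u)) =
          (N w x * N v x) $$ (K (\<tau> w), K v) * ?R"
      proof -
        have "(\<Prod>u\<in>V - {v}. N' u x $$ (K (\<tau>' u), K u)) = ?R"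
          using \<tau>'u(1) by (intro prod.cong) (auto simp: N'_def)
        then show ?thesis by (simp add: split \<tau>'v N'_def)
      qed
      ultimately show "(\<Sum>b<n. \<Prod>u\<in>insert w V. N u x $$ ((K(w := b)) (\<tau> u), (K(w := b)) u)) =
          (\<Prod>u\<in>V. N' u x $$ (K (\<tau>' u), K u))"
        by (simp add: sum_distrib_right)
    qed
    have "(\<lambda>x\<in>Z. \<Sum>K\<in>V \<rightarrow>\<^sub>E {..<n}. \<Prod>u\<in>V. N' u x $$ (K (\<tau>' u), K u)) \<in> S"
      using insert.prems(1) vV \<tau>' by (intro insert.IH) (auto simp: N'_def intro: mult)
    then show ?thesis by (subst mem_cong[OF *])
  qed
qed

text \<open>The coefficient of a squarefree monomial, extracted by inclusion and exclusion.\<close>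

lemma polarization:
  fixes c :: "'u \<Rightarrow> 'u \<Rightarrow> complex"
  assumes U: "finite U"
  shows "(\<Sum>T\<in>Pow U. (-1) ^ (card U - card T) * (\<Prod>u\<in>U. \<Sum>s\<in>T. c u s)) =
    (\<Sum>\<pi> | \<pi> permutes U. \<Prod>u\<in>U. c u (\<pi> u))"
proof -
  \<comment> \<open>\<open>f T\<close> sums over the maps with image exactly \<open>T\<close>. The
    product over all maps into \<open>T\<close> is the sum of \<open>f\<close> over the subsets of
    \<open>T\<close>, so Moebius inversion on the subset lattice isolates \<open>f U\<close>, the
    sum over bijections.\<close>
  define f where "f T = (\<Sum>\<phi> | \<phi> \<in> U \<rightarrow>\<^sub>E T \<and> \<phi> ` U = T. \<Prod>u\<in>U. c u (\<phi> u))" for T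
  have "(\<Prod>u\<in>U. \<Sum>s\<in>T. c u s) = sum f (Pow T)" if T: "finite T" for T
  proof -
    have "(\<Prod>u\<in>U. \<Sum>s\<in>T. c u s) = (\<Sum>\<phi>\<in>U \<rightarrow>\<^sub>E T. \<Prod>u\<in>U. c u (\<phi> u))"
      using U T by (simp add: prod_sum_PiE)
    also have "\<dots> = (\<Sum>T'\<in>Pow T. \<Sum>\<phi> | \<phi> \<in> U \<rightarrow>\<^sub>E T \<and> \<phi> ` U = T'. \<Prod>u\<in>U. c u (\<phi> u))"
      using U T by (intro sum.group[symmetric]) (auto intro: finite_PiE)
    also have "\<dots> = sum f (Pow T)"
    proof (intro sum.cong[OF refl])
      fix T' assume "T' \<in> Pow T"
      then have "{\<phi>. \<phi> \<in> U \<rightarrow>\<^sub>E T \<and> \<phi> ` U = T'} = {\<phi>. \<phi> \<in> U \<rightarrow>\<^sub>E T' \<and> \<phi> ` U = T'}"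
        by (auto simp: PiE_iff)
      then show "(\<Sum>\<phi> | \<phi> \<in> U \<rightarrow>\<^sub>E T \<and> \<phi> ` U = T'. \<Prod>u\<in>U. c u (\<phi> u)) = f T'"
        by (simp add: f_def)
    qed
    finally show ?thesis .
  qed
  from inclusion_exclusion_mobius[of "\<lambda>T. \<Prod>u\<in>U. \<Sum>s\<in>T. c u s" f, OF this U]
  have "(\<Sum>T\<in>Pow U. (-1) ^ (card U - card T) * (\<Prod>u\<in>U. \<Sum>s\<in>T. c u s)) = f U" by simp
  also have "f U = (\<Sum>\<pi> | \<pi> permutes U. \<Prod>u\<in>U. c u (\<pi> u))"
    unfolding f_def
  proof (rule sum.reindex_bij_witness[of _ "\<lambda>\<pi>. restrict \<pi> U" "\<lambda>\<phi> u. if u \<in> U then \<phi> u else u"])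
    fix \<phi> assume \<phi>: "\<phi> \<in> {\<phi>. \<phi> \<in> U \<rightarrow>\<^sub>E U \<and> \<phi> ` U = U}"
    then have "bij_betw \<phi> U U"
      using U by (auto simp: bij_betw_def eq_card_imp_inj_on)
    then have "bij_betw (\<lambda>u. if u \<in> U then \<phi> u else u) U U"
      by (simp cong: bij_betw_cong)
    then show "(\<lambda>u. if u \<in> U then \<phi> u else u) \<in> {\<pi>. \<pi> permutes U}"
      by (auto intro: bij_imp_permutes)
    show "restrict (\<lambda>u. if u \<in> U then \<phi> u else u) U = \<phi>"
      using \<phi> by (auto simp: PiE_iff extensional_def)
  next
    fix \<pi> assume "\<pi> \<in> {\<pi>. \<pi> permutes U}"
    then have \<pi>: "\<pi> permutes U" by simp
    show "restrict \<pi> U \<in> {\<phi>. \<phi> \<in> U \<rightarrow>\<^sub>E U \<and> \<phi> ` U = U}"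
      using \<pi> by (auto simp: permutes_in_image permutes_image)
    show "(\<lambda>u. if u \<in> U then restrict \<pi> U u else u) = \<pi>"
      using \<pi> by (auto simp: permutes_not_in)
  qed auto
  finally show ?thesis .
qed

section \<open>Cayley's Omega process\<close>

text \<open>The Levi-Civita symbol: the sign of \<open>k\<close> if it restricts to a permutation of
  the indices below \<open>n\<close>, and 0 otherwise. With a determinant of a 0-1 matrix as
  definition, its product formula becomes multiplicativity of \<open>det\<close>.\<close>

definition eps :: "nat \<Rightarrow> (nat \<Rightarrow> nat) \<Rightarrow> complex" where
  "eps n k = det (mat n n (\<lambda>(a, b). if k a = b then 1 else 0))"

lemma eps_eq:
  "eps n k = (\<Sum>p | p permutes {..<n}. signof p * (\<Prod>i<n. if k i = p i then 1 else 0))"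
proof -
  have "p i < n" if "p permutes {..<n}" "i < n" for p i
    using that permutes_in_image[of p "{..<n}" i] by simp
  then show ?thesis
    unfolding eps_def
    by (subst det_def'[of _ n]) (auto simp: atLeast0LessThan intro!: sum.cong prod.cong)
qed

lemma eps_cong: "(\<And>r. r < n \<Longrightarrow> k r = k' r) \<Longrightarrow> eps n k = eps n k'"
  unfolding eps_eq by (intro sum.cong arg_cong2[of _ _ _ _ "(*)"] prod.cong refl) auto

text \<open>Reality makes the squares nonnegative in the argument that the Omega constant does not
  vanish.\<close>

lemma eps_real: "eps n k \<in> \<real>"
  unfolding eps_eq by (auto intro!: sum_in_Reals prod_in_Reals simp: sign_def)

lemma eps_id: "eps n (\<lambda>r. r) = 1"
proof -
  have "mat n n (\<lambda>(a, b). if a = b then 1 else 0) = (1\<^sub>m n :: complex mat)" by auto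
  then show ?thesis by (simp add: eps_def)
qed

text \<open>The Leibniz formula spread over all index maps instead of permutations, so that the sum
  over \<open>k\<close> combines freely with sums over other matrix indices.\<close>

lemma det_eps:
  assumes A: "A \<in> carrier_mat n n"
  shows "det A = (\<Sum>k\<in>{..<n} \<rightarrow>\<^sub>E {..<n}. eps n k * (\<Prod>r<n. A $$ (r, k r)))"
proof -
  have "(\<Sum>k\<in>{..<n} \<rightarrow>\<^sub>E {..<n}. eps n k * (\<Prod>r<n. A $$ (r, k r))) =
      (\<Sum>k\<in>{..<n} \<rightarrow>\<^sub>E {..<n}. \<Sum>p | p permutes {..<n}.
         signof p * (\<Prod>r<n. (if k r = p r then A $$ (r, k r) else 0)))"
  proof -
    have *: "(if b then 1 else 0) * a = (if b then a else 0)" for b and a :: complex by simp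
    show ?thesis
      unfolding eps_eq sum_distrib_right
      by (intro sum.cong refl) (simp only: mult.assoc prod.distrib[symmetric] *)
  qed
  also have "\<dots> = (\<Sum>p | p permutes {..<n}. signof p *
      (\<Sum>k\<in>{..<n} \<rightarrow>\<^sub>E {..<n}. \<Prod>r<n. (if k r = p r then A $$ (r, k r) else 0)))"
    by (subst sum.swap) (simp add: sum_distrib_left)
  also have "\<dots> = (\<Sum>p | p permutes {..<n}. signof p * (\<Prod>r<n. A $$ (r, p r)))"
  proof (intro sum.cong refl arg_cong2[of _ _ _ _ "(*)"])
    fix p assume "p \<in> {p. p permutes {..<n}}"
    then have p: "p r < n" if "r < n" for r
      using that permutes_in_image[of p "{..<n}" r] by simp
    have "(\<Sum>k\<in>{..<n} \<rightarrow>\<^sub>E {..<n}. \<Prod>r<n. (if k r = p r then A $$ (r, k r) else 0)) =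
        (\<Prod>r<n. \<Sum>b<n. if b = p r then A $$ (r, b) else 0)"
      by (subst prod_sum_PiE) auto
    then show "(\<Sum>k\<in>{..<n} \<rightarrow>\<^sub>E {..<n}. \<Prod>r<n. (if k r = p r then A $$ (r, k r) else 0)) =
        (\<Prod>r<n. A $$ (r, p r))"
      using p by (simp add: sum.delta)
  qed
  also have "\<dots> = det A"
    using A by (simp add: det_def' atLeast0LessThan)
  finally show ?thesis by simp
qed

text \<open>The generalized Kronecker delta. The product of one 0-1 matrix with the transpose of the
  other has the entries \<open>k' a = k b\<close>, and its determinant is expanded. The bound on
  \<open>k\<close> makes each inner product collapse to such a delta.\<close>

lemma eps_mult:
  assumes "\<And>r. r < n \<Longrightarrow> k r < n"
  shows "eps n k' * eps n k =
    (\<Sum>\<sigma> | \<sigma> permutes {..<n}. signof \<sigma> * (\<Prod>r<n. if k' r = k (\<sigma> r) then 1 else 0))"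
proof -
  let ?M = "\<lambda>k. mat n n (\<lambda>(a, b). if k a = b then 1 else 0) :: complex mat"
  have "eps n k' * eps n k = det (?M k' * transpose_mat (?M k))"
    by (subst det_mult[of _ n]) (auto simp: eps_def det_transpose[of _ n])
  also have "?M k' * transpose_mat (?M k) = mat n n (\<lambda>(a, b). if k' a = k b then 1 else 0)"
    using assms by (intro eq_matI) (auto simp: scalar_prod_def if_distrib[of "\<lambda>x. x * _"] cong: if_cong)
  also have "det \<dots> = (\<Sum>\<sigma> | \<sigma> permutes {..<n}.
      signof \<sigma> * (\<Prod>r<n. if k' r = k (\<sigma> r) then 1 else 0))"
  proof -
    have "p i < n" if "p permutes {..<n}" "i < n" for p i
      using that permutes_in_image[of p "{..<n}" i] by simp
    then show ?thesis
      by (subst det_def'[of _ n]) (auto simp: atLeast0LessThan intro!: sum.cong prod.cong)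
  qed
  finally show ?thesis .
qed

text \<open>A slot \<open>(t, r)\<close> is row \<open>r\<close> of the \<open>t\<close>-th of
  \<open>D\<close> determinants; a map on slots picks a column for every row of every determinant at
  once.\<close>

abbreviation slots :: "nat \<Rightarrow> nat \<Rightarrow> (nat \<times> nat) set" where
  "slots D n \<equiv> {..<D} \<times> {..<n}"

definition epsU :: "nat \<Rightarrow> nat \<Rightarrow> (nat \<times> nat \<Rightarrow> nat) \<Rightarrow> complex" where
  "epsU D n K = (\<Prod>t<D. eps n (\<lambda>r. K (t, r)))"

lemma epsU_cong: "(\<And>u. u \<in> slots D n \<Longrightarrow> K u = K' u) \<Longrightarrow> epsU D n K = epsU D n K'"
  unfolding epsU_def by (intro prod.cong refl eps_cong) auto

lemma epsU_real: "epsU D n K \<in> \<real>"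
  unfolding epsU_def by (intro prod_in_Reals eps_real)

lemma sum_PiE_curry:
  "(\<Sum>\<kappa>\<in>A \<rightarrow>\<^sub>E (B \<rightarrow>\<^sub>E C). h \<kappa>) = (\<Sum>K\<in>A \<times> B \<rightarrow>\<^sub>E C. h (\<lambda>a\<in>A. \<lambda>b\<in>B. K (a, b)))"
proof (rule sum.reindex_bij_witness[of _ "\<lambda>K. \<lambda>a\<in>A. \<lambda>b\<in>B. K (a, b)"
      "\<lambda>\<kappa>. \<lambda>(a, b)\<in>A \<times> B. \<kappa> a b"])
  fix \<kappa> assume "\<kappa> \<in> A \<rightarrow>\<^sub>E (B \<rightarrow>\<^sub>E C)"
  then show eq: "(\<lambda>a\<in>A. \<lambda>b\<in>B. (\<lambda>(a, b)\<in>A \<times> B. \<kappa> a b) (a, b)) = \<kappa>"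
    by (intro ext) (force simp: PiE_iff extensional_def restrict_def)
  then show "h (\<lambda>a\<in>A. \<lambda>b\<in>B. (\<lambda>(a, b)\<in>A \<times> B. \<kappa> a b) (a, b)) = h \<kappa>" by simp
qed (auto simp: PiE_iff extensional_def restrict_def fun_eq_iff)

lemma prod_det_epsU:
  assumes "\<And>t. t < D \<Longrightarrow> A t \<in> carrier_mat n n"
  shows "(\<Prod>t<D. det (A t)) =
    (\<Sum>K\<in>slots D n \<rightarrow>\<^sub>E {..<n}. epsU D n K * (\<Prod>(t, r)\<in>slots D n. A t $$ (r, K (t, r))))"
proof -
  have "(\<Prod>t<D. det (A t)) =
      (\<Prod>t<D. \<Sum>k\<in>{..<n} \<rightarrow>\<^sub>E {..<n}. eps n k * (\<Prod>r<n. A t $$ (r, k r)))"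
    using assms by (intro prod.cong) (auto intro: det_eps)
  also have "\<dots> = (\<Sum>\<kappa>\<in>{..<D} \<rightarrow>\<^sub>E ({..<n} \<rightarrow>\<^sub>E {..<n}).
      \<Prod>t<D. eps n (\<kappa> t) * (\<Prod>r<n. A t $$ (r, \<kappa> t r)))"
    by (subst prod_sum_PiE) (auto intro!: finite_PiE)
  also have "\<dots> = (\<Sum>K\<in>slots D n \<rightarrow>\<^sub>E {..<n}.
      \<Prod>t<D. eps n (\<lambda>r. K (t, r)) * (\<Prod>r<n. A t $$ (r, K (t, r))))"
    unfolding sum_PiE_curry
    by (intro sum.cong prod.cong refl arg_cong2[of _ _ _ _ "(*)"] eps_cong) auto
  finally show ?thesis
    by (simp add: prod.distrib epsU_def prod.cartesian_product)
qed

lemma epsU_mult: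
  assumes "\<And>u. u \<in> slots D n \<Longrightarrow> K u < n"
  shows "epsU D n K' * epsU D n K =
    (\<Sum>\<sigma>\<in>{..<D} \<rightarrow>\<^sub>E {\<sigma>. \<sigma> permutes {..<n}}. (\<Prod>t<D. signof (\<sigma> t)) *
      (\<Prod>(t, r)\<in>slots D n. if K' (t, r) = K (t, \<sigma> t r) then 1 else 0))"
proof -
  have "epsU D n K' * epsU D n K = (\<Prod>t<D. \<Sum>\<sigma> | \<sigma> permutes {..<n}.
      signof \<sigma> * (\<Prod>r<n. if K' (t, r) = K (t, \<sigma> r) then 1 else 0))"
    unfolding epsU_def prod.distrib[symmetric]
    using assms by (intro prod.cong refl eps_mult) auto
  also have "\<dots> = (\<Sum>\<sigma>\<in>{..<D} \<rightarrow>\<^sub>E {\<sigma>. \<sigma> permutes {..<n}}. \<Prod>t<D.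
      signof (\<sigma> t) * (\<Prod>r<n. if K' (t, r) = K (t, \<sigma> t r) then 1 else 0))"
    by (subst prod_sum_PiE) (auto simp: finite_permutations)
  finally show ?thesis by (simp add: prod.distrib prod.cartesian_product)
qed

text \<open>The \<open>D\<close>-th power of Cayley's operator \<open>det (\<partial>/\<partial>g\<^sub>r\<^sub>c)\<close>, applied to a form \<open>F\<close> of degree \<open>n D\<close> in
  the entries of an \<open>n \<times> n\<close> matrix. The partial derivatives are extracted by polarization, so \<open>F\<close> may be
  an arbitrary function.\<close>

definition Omega :: "nat \<Rightarrow> nat \<Rightarrow> (complex mat \<Rightarrow> complex) \<Rightarrow> complex" where
  "Omega D n F = (\<Sum>\<kappa>\<in>slots D n \<rightarrow>\<^sub>E {..<n}. epsU D n \<kappa> *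
     (\<Sum>T\<in>Pow (slots D n). (-1) ^ (card (slots D n) - card T) *
       F (mat n n (\<lambda>(a, b). \<Sum>u\<in>T. if snd u = a \<and> \<kappa> u = b then 1 else 0))))"

lemma Omega_cong: "(\<And>g. g \<in> carrier_mat n n \<Longrightarrow> F g = F' g) \<Longrightarrow> Omega D n F = Omega D n F'"
  unfolding Omega_def by (intro sum.cong refl arg_cong2[of _ _ _ _ "(*)"]) auto

lemma Omega_add: "Omega D n (\<lambda>g. F g + F' g) = Omega D n F + Omega D n F'"
  by (simp add: Omega_def algebra_simps sum.distrib sum_distrib_left)

lemma Omega_cmult: "Omega D n (\<lambda>g. c * F g) = c * Omega D n F"
  by (simp add: Omega_def sum_distrib_left mult.left_commute)

lemma Omega_zero: "Omega D n (\<lambda>g. 0) = 0"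
  by (simp add: Omega_def)

lemma Omega_sum: "Omega D n (\<lambda>g. \<Sum>i\<in>I. F i g) = (\<Sum>i\<in>I. Omega D n (F i))"
  by (induction I rule: infinite_finite_induct) (simp_all add: Omega_zero Omega_add)

lemma Omega_sum_list: "Omega D n (\<lambda>g. \<Sum>i\<leftarrow>is. F i g) = (\<Sum>i\<leftarrow>is. Omega D n (F i))"
  by (induction "is") (simp_all add: Omega_zero Omega_add)

text \<open>Derivatives with rows \<open>snd s\<close> and columns \<open>\<kappa> s\<close>,
  applied to a monomial, are matched with its factors by a permutation \<open>\<pi>\<close>. A
  matching counts only if the rows agree, \<open>snd (\<pi> u) = R u\<close>, and equality of the
  columns then determines \<open>\<kappa>\<close> as \<open>a\<close> composed with the inverse of
  \<open>\<pi>\<close>.\<close>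

lemma Omega_prod:
  assumes R: "\<And>u. u \<in> slots D n \<Longrightarrow> R u < n" and a: "\<And>u. u \<in> slots D n \<Longrightarrow> a u < n"
  shows "Omega D n (\<lambda>g. \<Prod>u\<in>slots D n. g $$ (R u, a u)) =
    (\<Sum>\<pi> | \<pi> permutes slots D n \<and> (\<forall>u\<in>slots D n. snd (\<pi> u) = R u).
       epsU D n (a \<circ> inv_into UNIV \<pi>))"
proof -
  define U where "U = slots D n"
  have finU: "finite U" by (simp add: U_def)
  note R = R[folded U_def] and a = a[folded U_def]
  let ?c = "\<lambda>\<kappa> u s. if snd s = R u \<and> \<kappa> s = a u then 1 else (0 :: complex)"
  have "Omega D n (\<lambda>g. \<Prod>u\<in>U. g $$ (R u, a u)) =
      (\<Sum>\<kappa>\<in>U \<rightarrow>\<^sub>E {..<n}. epsU D n \<kappa> *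
        (\<Sum>T\<in>Pow U. (-1) ^ (card U - card T) * (\<Prod>u\<in>U. \<Sum>s\<in>T. ?c \<kappa> u s)))"
    unfolding Omega_def U_def[symmetric] using R a
    by (intro sum.cong refl arg_cong2[of _ _ _ _ "(*)"] prod.cong) auto
  also have "\<dots> = (\<Sum>\<kappa>\<in>U \<rightarrow>\<^sub>E {..<n}. epsU D n \<kappa> * (\<Sum>\<pi> | \<pi> permutes U. \<Prod>u\<in>U. ?c \<kappa> u (\<pi> u)))"
    by (simp only: polarization[OF finU])
  also have "\<dots> = (\<Sum>\<pi> | \<pi> permutes U. \<Sum>\<kappa>\<in>U \<rightarrow>\<^sub>E {..<n}. epsU D n \<kappa> * (\<Prod>u\<in>U. ?c \<kappa> u (\<pi> u)))"
    unfolding sum_distrib_left by (rule sum.swap)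
  also have "\<dots> = (\<Sum>\<pi> | \<pi> permutes U. if \<forall>u\<in>U. snd (\<pi> u) = R u
      then epsU D n (a \<circ> inv_into UNIV \<pi>) else 0)"
  proof (intro sum.cong refl)
    fix \<pi> assume "\<pi> \<in> {\<pi>. \<pi> permutes U}"
    then have \<pi>: "\<pi> permutes U" by simp
    show "(\<Sum>\<kappa>\<in>U \<rightarrow>\<^sub>E {..<n}. epsU D n \<kappa> * (\<Prod>u\<in>U. ?c \<kappa> u (\<pi> u))) =
        (if \<forall>u\<in>U. snd (\<pi> u) = R u then epsU D n (a \<circ> inv_into UNIV \<pi>) else 0)"
    proof (cases "\<forall>u\<in>U. snd (\<pi> u) = R u")
      case True
      define \<kappa>0 where "\<kappa>0 = restrict (a \<circ> inv_into UNIV \<pi>) U"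
      have im: "inv_into UNIV \<pi> u \<in> U" if "u \<in> U" for u
        using that permutes_inv[OF \<pi>] permutes_in_image by metis
      have \<kappa>0: "\<kappa>0 \<in> U \<rightarrow>\<^sub>E {..<n}"
        using a im by (auto simp: \<kappa>0_def)
      have "(\<Prod>u\<in>U. ?c \<kappa> u (\<pi> u)) = (if \<kappa> = \<kappa>0 then 1 else 0)" if \<kappa>: "\<kappa> \<in> U \<rightarrow>\<^sub>E {..<n}" for \<kappa>
      proof (cases "\<forall>u\<in>U. \<kappa> (\<pi> u) = a u")
        case eq: True
        have "\<kappa> u = \<kappa>0 u" for u
        proof (cases "u \<in> U")
          case u: True
          then have "\<kappa> (\<pi> (inv_into UNIV \<pi> u)) = a (inv_into UNIV \<pi> u)" using eq im by blast
          then show ?thesis using u \<pi> by (simp add: \<kappa>0_def permutes_inverses)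
        qed (use PiE_arb[OF \<kappa>] in \<open>simp add: \<kappa>0_def\<close>)
        then have "\<kappa> = \<kappa>0" by blast
        then show ?thesis using True eq by simp
      next
        case False
        then obtain u where u: "u \<in> U" "\<kappa> (\<pi> u) \<noteq> a u" by blast
        then have "(\<Prod>u\<in>U. ?c \<kappa> u (\<pi> u)) = 0" using finU by (intro prod_zero) auto
        moreover have "\<kappa>0 (\<pi> u) = a u"
          using u permutes_in_image[OF \<pi>, of u] by (simp add: \<kappa>0_def permutes_inverses[OF \<pi>])
        then have "\<kappa> \<noteq> \<kappa>0" using u by blast
        ultimately show ?thesis by simp
      qed
      then have "(\<Sum>\<kappa>\<in>U \<rightarrow>\<^sub>E {..<n}. epsU D n \<kappa> * (\<Prod>u\<in>U. ?c \<kappa> u (\<pi> u))) =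
          (\<Sum>\<kappa>\<in>U \<rightarrow>\<^sub>E {..<n}. if \<kappa> = \<kappa>0 then epsU D n \<kappa> else 0)"
        by (intro sum.cong) auto
      also have "\<dots> = epsU D n \<kappa>0" using \<kappa>0 by (simp add: finite_PiE finU)
      also have "\<dots> = epsU D n (a \<circ> inv_into UNIV \<pi>)"
        by (rule epsU_cong) (simp add: \<kappa>0_def U_def)
      finally show ?thesis using True by simp
    next
      case False
      have "(\<Prod>u\<in>U. ?c \<kappa> u (\<pi> u)) = 0" for \<kappa> using finU False by (intro prod_zero) auto
      then show ?thesis using False by auto
    qed
  qed
  also have "\<dots> = (\<Sum>\<pi> | \<pi> permutes U \<and> (\<forall>u\<in>U. snd (\<pi> u) = R u).
      epsU D n (a \<circ> inv_into UNIV \<pi>))"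
    by (simp add: sum.If_cases finite_permutations finU Int_def)
  finally show ?thesis unfolding U_def .
qed

text \<open>Cayley's identity gives this constant explicitly; nonvanishing follows from positivity
  alone. The constant is the sum of \<open>epsU\<close> times its symmetrization \<open>s\<close>
  over the group \<open>G\<close> of slot permutations that preserve rows. Since \<open>s\<close> is
  \<open>G\<close>-invariant, \<open>card G\<close> times the constant is the sum of the squares of
  the real numbers \<open>s K\<close>.\<close>

lemma Omega_det_power: "Omega D n (\<lambda>g. det g ^ D) \<noteq> 0"
proof -
  define U where "U = slots D n"
  define G where "G = {\<pi>. \<pi> permutes U \<and> (\<forall>u\<in>U. snd (\<pi> u) = snd u)}"
  let ?W = "U \<rightarrow>\<^sub>E {..<n}" and ?E = "epsU D n"
  define s where "s K = (\<Sum>\<pi>\<in>G. ?E (K \<circ> \<pi>))" for K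
  have finU: "finite U" by (simp add: U_def)
  have fin: "finite G" "finite ?W"
    by (auto simp: G_def finU intro: finite_subset[OF _ finite_permutations[OF finU]] finite_PiE)
  have G: "\<pi> permutes U" "\<And>u. u \<in> U \<Longrightarrow> snd (\<pi> u) = snd u" if "\<pi> \<in> G" for \<pi>
    using that by (auto simp: G_def)
  have im: "\<pi> u \<in> U \<longleftrightarrow> u \<in> U" if "\<pi> \<in> G" for \<pi> u
    by (rule permutes_in_image[OF G(1)[OF that]])
  have inv: "inv_into UNIV \<pi> \<in> G" if "\<pi> \<in> G" for \<pi>
  proof -
    have "snd (inv_into UNIV \<pi> u) = snd u" if "u \<in> U" for u
      using G(2)[OF \<open>\<pi> \<in> G\<close>, of "inv_into UNIV \<pi> u"] that permutes_inverses(1)[OF G(1)[OF \<open>\<pi> \<in> G\<close>], of u]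
        permutes_in_image[OF permutes_inv[OF G(1)[OF \<open>\<pi> \<in> G\<close>]], of u] by simp
    then show ?thesis using permutes_inv[OF G(1)[OF that]] by (simp add: G_def)
  qed
  have comp: "\<pi> \<circ> \<rho> \<in> G" if "\<pi> \<in> G" "\<rho> \<in> G" for \<pi> \<rho>
    using permutes_compose[OF G(1) G(1), OF that(2,1)] G(2)[OF that(1)] G(2)[OF that(2)] im[OF that(2)]
    by (simp add: G_def)
  have cancel: "inv_into UNIV \<pi> \<circ> \<pi> = id" "\<pi> \<circ> inv_into UNIV \<pi> = id"
    "inv_into UNIV (inv_into UNIV \<pi>) = \<pi>" if "\<pi> \<in> G" for \<pi>
    using permutes_inv_o[OF G(1)[OF that]] permutes_inv_inv[OF G(1)[OF that]] by auto
  have s_inv: "s (K \<circ> \<pi>) = s K" if "\<pi> \<in> G" for K \<pi>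
    unfolding s_def
    by (rule sum.reindex_bij_witness[of _ "\<lambda>\<rho>. inv_into UNIV \<pi> \<circ> \<rho>" "\<lambda>\<rho>. \<pi> \<circ> \<rho>"])
      (simp_all add: comp[OF that] comp[OF inv[OF that]] o_assoc cancel[OF that])
  have W: "K \<circ> \<pi> \<in> ?W" if "\<pi> \<in> G" "K \<in> ?W" for \<pi> K
  proof (rule PiE_I)
    fix u assume "u \<in> U"
    then show "(K \<circ> \<pi>) u \<in> {..<n}" using that(2) im[OF that(1), of u] by auto
  next
    fix u assume "u \<notin> U"
    then show "(K \<circ> \<pi>) u = undefined" using PiE_arb[OF that(2)] im[OF that(1), of u] by simp
  qed
  have "Omega D n (\<lambda>g. det g ^ D) = Omega D n (\<lambda>g. \<Sum>K\<in>?W. ?E K * (\<Prod>u\<in>U. g $$ (snd u, K u)))"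
  proof (rule Omega_cong)
    fix g :: "complex mat" assume "g \<in> carrier_mat n n"
    then have "(\<Prod>t<D. det g) = (\<Sum>K\<in>?W. ?E K * (\<Prod>(t, r)\<in>U. g $$ (r, K (t, r))))"
      unfolding U_def by (rule prod_det_epsU)
    then show "det g ^ D = (\<Sum>K\<in>?W. ?E K * (\<Prod>u\<in>U. g $$ (snd u, K u)))"
      by (simp add: case_prod_unfold)
  qed
  also have "\<dots> = (\<Sum>K\<in>?W. ?E K * (\<Sum>\<pi>\<in>G. ?E (K \<circ> inv_into UNIV \<pi>)))"
    unfolding Omega_sum Omega_cmult G_def U_def
    by (intro sum.cong refl arg_cong2[of _ _ _ _ "(*)"] Omega_prod) (auto simp: PiE_iff)
  also have "\<dots> = (\<Sum>K\<in>?W. ?E K * s K)"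
    unfolding s_def
    by (intro sum.cong refl arg_cong2[of _ _ _ _ "(*)"]
        sum.reindex_bij_witness[of _ "\<lambda>\<pi>. inv_into UNIV \<pi>" "\<lambda>\<pi>. inv_into UNIV \<pi>"])
      (simp_all add: cancel inv)
  finally have c: "Omega D n (\<lambda>g. det g ^ D) = (\<Sum>K\<in>?W. ?E K * s K)" .
  have "(\<Sum>K\<in>?W. s K * s K) = (\<Sum>K\<in>?W. \<Sum>\<pi>\<in>G. ?E (K \<circ> \<pi>) * s (K \<circ> \<pi>))"
  proof (rule sum.cong[OF refl])
    fix K
    have "s K * s K = (\<Sum>\<pi>\<in>G. ?E (K \<circ> \<pi>)) * s K" by (simp only: s_def)
    then show "s K * s K = (\<Sum>\<pi>\<in>G. ?E (K \<circ> \<pi>) * s (K \<circ> \<pi>))"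
      by (simp add: sum_distrib_right s_inv)
  qed
  also have "\<dots> = (\<Sum>\<pi>\<in>G. \<Sum>K\<in>?W. ?E (K \<circ> \<pi>) * s (K \<circ> \<pi>))" by (rule sum.swap)
  also have "\<dots> = (\<Sum>\<pi>\<in>G. \<Sum>K\<in>?W. ?E K * s K)"
  proof (rule sum.cong[OF refl])
    fix \<pi> assume \<pi>: "\<pi> \<in> G"
    show "(\<Sum>K\<in>?W. ?E (K \<circ> \<pi>) * s (K \<circ> \<pi>)) = (\<Sum>K\<in>?W. ?E K * s K)"
      by (rule sum.reindex_bij_witness[of _ "\<lambda>K. K \<circ> inv_into UNIV \<pi>" "\<lambda>K. K \<circ> \<pi>"])
        (simp_all add: W[OF \<pi>] W[OF inv[OF \<pi>]] comp_assoc cancel[OF \<pi>])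
  qed
  finally have sq: "(\<Sum>K\<in>?W. s K * s K) = of_nat (card G) * Omega D n (\<lambda>g. det g ^ D)"
    using c by simp
  \<comment> \<open>A point where \<open>s\<close> is visibly nonzero: every slot takes its own row
    as column, row-preserving permutations do not change that, and every determinant contributes the
    sign of the identity.\<close>
  define K0 where "K0 = restrict snd U"
  have K0: "K0 \<in> ?W" by (auto simp: K0_def U_def)
  have "?E (K0 \<circ> \<pi>) = 1" if "\<pi> \<in> G" for \<pi>
  proof -
    have "?E (K0 \<circ> \<pi>) = ?E snd"
    proof (rule epsU_cong)
      fix u assume "u \<in> slots D n"
      then show "(K0 \<circ> \<pi>) u = snd u"
        using im[OF that, of u] G(2)[OF that, of u] by (simp add: K0_def U_def[symmetric])
    qed
    then show ?thesis by (simp add: epsU_def eps_id)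
  qed
  then have sK0: "s K0 = of_nat (card G)" by (simp add: s_def)
  have "id \<in> G" by (simp add: G_def permutes_id)
  then have pos: "card G > 0" using fin card_gt_0_iff by blast
  have "s K \<in> \<real>" for K unfolding s_def by (intro sum_in_Reals epsU_real)
  then have re: "Re (s K * s K) = (Re (s K))\<^sup>2" for K
    by (simp add: complex_is_Real_iff power2_eq_square)
  have "0 < (Re (s K0))\<^sup>2" using pos by (simp add: sK0)
  also have "\<dots> \<le> (\<Sum>K\<in>?W. (Re (s K))\<^sup>2)"
    using K0 fin by (intro member_le_sum) auto
  also have "\<dots> = Re (\<Sum>K\<in>?W. s K * s K)" by (simp only: re Re_sum)
  finally show ?thesis unfolding sq by auto
qed

text \<open>\<open>\<sigma> t\<close> acts on the rows of the \<open>t\<close>-th determinant. For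
  \<open>t \<ge> D\<close> an extensional \<open>\<sigma>\<close> is \<open>undefined\<close>, while
  a permutation of the slots must fix everything outside them; hence the second branch.\<close>

definition slot_perm :: "nat \<Rightarrow> (nat \<Rightarrow> nat \<Rightarrow> nat) \<Rightarrow> nat \<times> nat \<Rightarrow> nat \<times> nat" where
  "slot_perm D \<sigma> = (\<lambda>(t, r). if t < D then (t, \<sigma> t r) else (t, r))"

lemma slot_permutes:
  assumes \<sigma>: "\<sigma> \<in> {..<D} \<rightarrow>\<^sub>E {\<sigma>. \<sigma> permutes {..<n}}"
  shows "slot_perm D \<sigma> permutes slots D n"
  unfolding slot_perm_def
proof (rule bij_imp_permutes)
  have p: "\<sigma> t permutes {..<n}" if "t < D" for t using \<sigma> that by auto
  have im: "\<sigma> t r < n" "inv_into UNIV (\<sigma> t) r < n" if "t < D" "r < n" for t r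
    using permutes_in_image[OF p[OF that(1)], of r] permutes_in_image[OF permutes_inv[OF p[OF that(1)]], of r] that(2)
    by auto
  show "bij_betw (\<lambda>(t, r). if t < D then (t, \<sigma> t r) else (t, r)) (slots D n) (slots D n)"
    by (rule bij_betw_byWitness[of _ "\<lambda>(t, r). (t, inv_into UNIV (\<sigma> t) r)"])
      (auto simp: permutes_inverses[OF p] im)
  fix u assume "u \<notin> slots D n"
  then show "(case u of (t, r) \<Rightarrow> if t < D then (t, \<sigma> t r) else (t, r)) = u"
    using permutes_not_in[OF p] by (cases u) auto
qed

text \<open>Conjugation by the adjugate has polynomial entries: by Cramer's rule such an entry is the
  determinant of \<open>g\<close> with one row exchanged.\<close>

lemma conj_adj_mat_index:
  assumes g: "g \<in> carrier_mat n n" and M: "M \<in> carrier_mat n n" and P: "P < n" and Q: "Q < n"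
  shows "(g * M * adj_mat g) $$ (P, Q) =
    det (mat n n (\<lambda>(r, c). (g * (if r = Q then M else 1\<^sub>m n)) $$ (if r = Q then P else r, c)))"
    (is "_ = det ?A")
proof -
  note adj = adj_mat(1)[OF g]
  have gM: "g * M \<in> carrier_mat n n" using g M by simp
  \<comment> \<open>Deleting row \<open>Q\<close> removes the only row in which \<open>?A\<close>
    and \<open>g\<close> differ, so the Laplace expansion along it has the cofactors of
    \<open>g\<close>.\<close>
  have "mat_delete ?A Q j = mat_delete g Q j" if "j < n" for j
    using g Q that by (intro eq_matI) (auto simp: mat_delete_def)
  then have cof: "cofactor ?A Q j = cofactor g Q j" if "j < n" for j
    using that by (simp add: cofactor_def)
  have "det ?A = (\<Sum>j<n. ?A $$ (Q, j) * cofactor ?A Q j)"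
    by (rule laplace_expansion_row) (use Q in auto)
  also have "\<dots> = (\<Sum>j<n. (g * M) $$ (P, j) * adj_mat g $$ (j, Q))"
    using g Q by (intro sum.cong) (auto simp: cof adj_mat_def)
  also have "\<dots> = (g * M * adj_mat g) $$ (P, Q)"
    using index_mult_mat_sum[OF gM adj P Q] by simp
  finally show ?thesis by simp
qed

text \<open>Expanding the determinants gives column indices \<open>K\<close>, expanding the rows of
  \<open>g * N\<close> gives indices \<open>a\<close>, and Omega returns a second symbol in
  \<open>a\<close>. The product of the two symbols is a signed sum of Kronecker deltas, which
  eliminates \<open>a\<close>. The group variable has disappeared, and index contractions of the
  \<open>M t\<close> with identity matrices are left.\<close>

lemma Omega_conj_adj_mat:
  assumes M: "\<And>t. t < D \<Longrightarrow> M t \<in> carrier_mat n n"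
    and P: "\<And>t. t < D \<Longrightarrow> P t < n" and Q: "\<And>t. t < D \<Longrightarrow> Q t < n"
  shows "Omega D n (\<lambda>g. \<Prod>t<D. (g * M t * adj_mat g) $$ (P t, Q t)) =
    (\<Sum>\<pi> | \<pi> permutes slots D n \<and> (\<forall>u\<in>slots D n. snd (\<pi> u) = (if snd u = Q (fst u) then P (fst u) else snd u)).
     \<Sum>\<sigma>\<in>{..<D} \<rightarrow>\<^sub>E {\<sigma>. \<sigma> permutes {..<n}}. (\<Prod>t<D. signof (\<sigma> t)) *
      (\<Sum>K\<in>slots D n \<rightarrow>\<^sub>E {..<n}. \<Prod>u\<in>slots D n. (if snd u = Q (fst u) then M (fst u) else 1\<^sub>m n) $$
         (K ((slot_perm D \<sigma> \<circ> \<pi>) u), K u)))"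
proof -
  define sg :: "(nat \<Rightarrow> nat \<Rightarrow> nat) \<Rightarrow> complex" where "sg \<sigma> = (\<Prod>t<D. signof (\<sigma> t))" for \<sigma>
  define U where "U = slots D n"
  define R where "R u = (if snd u = Q (fst u) then P (fst u) else snd u)" for u :: "nat \<times> nat"
  define N where "N u = (if snd u = Q (fst u) then M (fst u) else 1\<^sub>m n)" for u :: "nat \<times> nat"
  let ?W = "U \<rightarrow>\<^sub>E {..<n}" and ?E = "epsU D n" and ?\<Sigma> = "{..<D} \<rightarrow>\<^sub>E {\<sigma>. \<sigma> permutes {..<n}}"
  let ?\<Pi> = "{\<pi>. \<pi> permutes U \<and> (\<forall>u\<in>U. snd (\<pi> u) = R u)}"
  have finU: "finite U" by (simp add: U_def)
  have fin: "finite ?W" using finU by (simp add: finite_PiE)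
  have R: "R u < n" and N: "N u \<in> carrier_mat n n" if "u \<in> U" for u
    using that M P by (auto simp: R_def N_def U_def)
  have "(\<Prod>t<D. (g * M t * adj_mat g) $$ (P t, Q t)) =
      (\<Sum>K\<in>?W. \<Sum>a\<in>?W. (?E K * (\<Prod>u\<in>U. N u $$ (a u, K u))) * (\<Prod>u\<in>U. g $$ (R u, a u)))"
    if g: "g \<in> carrier_mat n n" for g
  proof -
    have "(\<Prod>t<D. (g * M t * adj_mat g) $$ (P t, Q t)) =
        (\<Prod>t<D. det (mat n n (\<lambda>(r, c). (g * N (t, r)) $$ (R (t, r), c))))"
      using M P Q by (intro prod.cong refl) (simp add: conj_adj_mat_index[OF g] N_def R_def cong: if_cong)
    also have "\<dots> = (\<Sum>K\<in>?W. ?E K * (\<Prod>(t, r)\<in>U. mat n n (\<lambda>(r, c). (g * N (t, r)) $$ (R (t, r), c)) $$ (r, K (t, r))))"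
      unfolding U_def by (rule prod_det_epsU) simp
    also have "\<dots> = (\<Sum>K\<in>?W. ?E K * (\<Prod>u\<in>U. \<Sum>b<n. g $$ (R u, b) * N u $$ (b, K u)))"
    proof (intro sum.cong prod.cong refl arg_cong2[of _ _ _ _ "(*)"])
      fix K u assume K: "K \<in> ?W" and u: "u \<in> U"
      obtain t r where tr: "u = (t, r)" by (cases u)
      have "K u < n" using K u by auto
      then show "(case u of (t, r) \<Rightarrow> mat n n (\<lambda>(r, c). (g * N (t, r)) $$ (R (t, r), c)) $$ (r, K (t, r))) =
          (\<Sum>b<n. g $$ (R u, b) * N u $$ (b, K u))"
        using index_mult_mat_sum[OF g N[OF u] R[OF u]] u by (simp add: tr U_def)
    qed
    also have "\<dots> = (\<Sum>K\<in>?W. ?E K * (\<Sum>a\<in>?W. \<Prod>u\<in>U. g $$ (R u, a u) * N u $$ (a u, K u)))"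
      by (simp add: prod_sum_PiE[OF finU])
    finally show ?thesis
      by (simp add: sum_distrib_left prod.distrib mult_ac)
  qed
  then have "Omega D n (\<lambda>g. \<Prod>t<D. (g * M t * adj_mat g) $$ (P t, Q t)) =
      Omega D n (\<lambda>g. \<Sum>K\<in>?W. \<Sum>a\<in>?W. (?E K * (\<Prod>u\<in>U. N u $$ (a u, K u))) * (\<Prod>u\<in>U. g $$ (R u, a u)))"
    by (rule Omega_cong)
  also have "\<dots> = (\<Sum>K\<in>?W. \<Sum>a\<in>?W. (?E K * (\<Prod>u\<in>U. N u $$ (a u, K u))) *
      (\<Sum>\<pi>\<in>?\<Pi>. ?E (a \<circ> inv_into UNIV \<pi>)))"
    unfolding Omega_sum Omega_cmult U_def
    by (intro sum.cong refl arg_cong2[of _ _ _ _ "(*)"] Omega_prod) (use R in \<open>auto simp: U_def PiE_iff\<close>)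
  also have "\<dots> = (\<Sum>K\<in>?W. \<Sum>a\<in>?W. \<Sum>\<pi>\<in>?\<Pi>.
      ?E (a \<circ> inv_into UNIV \<pi>) * ?E K * (\<Prod>u\<in>U. N u $$ (a u, K u)))"
    by (simp add: sum_distrib_left mult_ac)
  also have "\<dots> = (\<Sum>K\<in>?W. \<Sum>\<pi>\<in>?\<Pi>. \<Sum>a\<in>?W.
      ?E (a \<circ> inv_into UNIV \<pi>) * ?E K * (\<Prod>u\<in>U. N u $$ (a u, K u)))"
    by (intro sum.cong refl sum.swap)
  also have "\<dots> = (\<Sum>K\<in>?W. \<Sum>\<pi>\<in>?\<Pi>. \<Sum>\<sigma>\<in>?\<Sigma>. sg \<sigma> *
      (\<Prod>u\<in>U. N u $$ (K ((slot_perm D \<sigma> \<circ> \<pi>) u), K u)))"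
  proof (intro sum.cong refl)
    fix K \<pi> assume K: "K \<in> ?W" and "\<pi> \<in> ?\<Pi>"
    then have \<pi>: "\<pi> permutes U" by simp
    \<comment> \<open>The deltas prescribe the value of \<open>a\<close> at the preimage under
      \<open>\<pi>\<close> of each slot. Reindexed along \<open>\<pi>\<close> they fix
      \<open>a\<close> completely, so the sum over \<open>a\<close> has a single term.\<close>
    have collapse: "(\<Sum>a\<in>?W. (\<Prod>(t, r)\<in>U. if (a \<circ> inv_into UNIV \<pi>) (t, r) = K (t, \<sigma> t r) then 1 else 0) *
        (\<Prod>u\<in>U. N u $$ (a u, K u))) = (\<Prod>u\<in>U. N u $$ (K ((slot_perm D \<sigma> \<circ> \<pi>) u), K u))"
      if \<sigma>: "\<sigma> \<in> ?\<Sigma>" for \<sigma>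
    proof -
      have slot: "slot_perm D \<sigma> permutes U" using slot_permutes[OF \<sigma>] by (simp add: U_def)
      have "(\<Prod>(t, r)\<in>U. if (a \<circ> inv_into UNIV \<pi>) (t, r) = K (t, \<sigma> t r) then 1 else 0) =
          (\<Prod>u\<in>U. if a u = K (slot_perm D \<sigma> (\<pi> u)) then 1 else (0 :: complex))" for a
      proof -
        have "(\<Prod>(t, r)\<in>U. if (a \<circ> inv_into UNIV \<pi>) (t, r) = K (t, \<sigma> t r) then 1 else 0) =
            (\<Prod>u\<in>U. if (a \<circ> inv_into UNIV \<pi>) u = K (slot_perm D \<sigma> u) then 1 else (0 :: complex))"
          by (intro prod.cong) (auto simp: U_def slot_perm_def)
        also have "\<dots> = (\<Prod>u\<in>U. if (a \<circ> inv_into UNIV \<pi>) (\<pi> u) = K (slot_perm D \<sigma> (\<pi> u)) then 1 else (0 :: complex))"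
          by (subst prod.permute[OF \<pi>]) (simp add: o_def)
        finally show ?thesis using permutes_inverses(2)[OF \<pi>] by simp
      qed
      then have "(\<Sum>a\<in>?W. (\<Prod>(t, r)\<in>U. if (a \<circ> inv_into UNIV \<pi>) (t, r) = K (t, \<sigma> t r) then 1 else 0) *
          (\<Prod>u\<in>U. N u $$ (a u, K u))) =
          (\<Sum>a\<in>?W. \<Prod>u\<in>U. (if a u = K (slot_perm D \<sigma> (\<pi> u)) then 1 else 0) * N u $$ (a u, K u))"
        by (simp only: prod.distrib)
      also have "\<dots> = (\<Prod>u\<in>U. \<Sum>b<n. (if b = K (slot_perm D \<sigma> (\<pi> u)) then 1 else 0) * N u $$ (b, K u))"
        by (subst prod_sum_PiE[OF finU]) auto
      also have "\<dots> = (\<Prod>u\<in>U. N u $$ (K ((slot_perm D \<sigma> \<circ> \<pi>) u), K u))"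
      proof (intro prod.cong refl)
        fix u assume "u \<in> U"
        then have "slot_perm D \<sigma> (\<pi> u) \<in> U" using permutes_in_image[OF slot] permutes_in_image[OF \<pi>] by simp
        then have "K (slot_perm D \<sigma> (\<pi> u)) < n" using K by auto
        then show "(\<Sum>b<n. (if b = K (slot_perm D \<sigma> (\<pi> u)) then 1 else 0) * N u $$ (b, K u)) =
            N u $$ (K ((slot_perm D \<sigma> \<circ> \<pi>) u), K u)"
          by (simp add: if_distrib[of "\<lambda>x. x * _"] cong: if_cong)
      qed
      finally show ?thesis .
    qed
    have "(\<Sum>a\<in>?W. ?E (a \<circ> inv_into UNIV \<pi>) * ?E K * (\<Prod>u\<in>U. N u $$ (a u, K u))) =
        (\<Sum>a\<in>?W. \<Sum>\<sigma>\<in>?\<Sigma>. sg \<sigma> *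
          ((\<Prod>(t, r)\<in>U. if (a \<circ> inv_into UNIV \<pi>) (t, r) = K (t, \<sigma> t r) then 1 else 0) *
           (\<Prod>u\<in>U. N u $$ (a u, K u))))"
    proof (rule sum.cong[OF refl])
      fix a
      have "?E (a \<circ> inv_into UNIV \<pi>) * ?E K = (\<Sum>\<sigma>\<in>?\<Sigma>. sg \<sigma> *
          (\<Prod>(t, r)\<in>U. if (a \<circ> inv_into UNIV \<pi>) (t, r) = K (t, \<sigma> t r) then 1 else 0))"
        unfolding U_def sg_def using K by (intro epsU_mult) (auto simp: U_def PiE_iff)
      then show "?E (a \<circ> inv_into UNIV \<pi>) * ?E K * (\<Prod>u\<in>U. N u $$ (a u, K u)) =
          (\<Sum>\<sigma>\<in>?\<Sigma>. sg \<sigma> *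
          ((\<Prod>(t, r)\<in>U. if (a \<circ> inv_into UNIV \<pi>) (t, r) = K (t, \<sigma> t r) then 1 else 0) *
           (\<Prod>u\<in>U. N u $$ (a u, K u))))"
        by (simp only: sum_distrib_right mult.assoc)
    qed
    also have "\<dots> = (\<Sum>\<sigma>\<in>?\<Sigma>. \<Sum>a\<in>?W. sg \<sigma> *
          ((\<Prod>(t, r)\<in>U. if (a \<circ> inv_into UNIV \<pi>) (t, r) = K (t, \<sigma> t r) then 1 else 0) *
           (\<Prod>u\<in>U. N u $$ (a u, K u))))"
      by (rule sum.swap)
    also have "\<dots> = (\<Sum>\<sigma>\<in>?\<Sigma>. sg \<sigma> * (\<Prod>u\<in>U. N u $$ (K ((slot_perm D \<sigma> \<circ> \<pi>) u), K u)))"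
      unfolding sum_distrib_left[symmetric]
      by (intro sum.cong refl arg_cong2[of _ _ _ _ "(*)"] collapse)
    finally show "(\<Sum>a\<in>?W. ?E (a \<circ> inv_into UNIV \<pi>) * ?E K * (\<Prod>u\<in>U. N u $$ (a u, K u))) =
      (\<Sum>\<sigma>\<in>?\<Sigma>. sg \<sigma> * (\<Prod>u\<in>U. N u $$ (K ((slot_perm D \<sigma> \<circ> \<pi>) u), K u)))" .
  qed
  also have "\<dots> = (\<Sum>\<pi>\<in>?\<Pi>. \<Sum>K\<in>?W. \<Sum>\<sigma>\<in>?\<Sigma>. sg \<sigma> *
      (\<Prod>u\<in>U. N u $$ (K ((slot_perm D \<sigma> \<circ> \<pi>) u), K u)))"
    by (rule sum.swap)
  also have "\<dots> = (\<Sum>\<pi>\<in>?\<Pi>. \<Sum>\<sigma>\<in>?\<Sigma>. sg \<sigma> *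
      (\<Sum>K\<in>?W. \<Prod>u\<in>U. N u $$ (K ((slot_perm D \<sigma> \<circ> \<pi>) u), K u)))"
    unfolding sum_distrib_left by (intro sum.cong refl sum.swap)
  finally show ?thesis unfolding U_def N_def R_def sg_def .
qed

text \<open>The first fundamental theorem for conjugation of matrices, relative to a stable set \<open>Z\<close>: the
  identity \<open>det g ^ D * f x = f (g \<cdot> x) * det g ^ D\<close> is polynomial in \<open>g\<close>, and Cayley's Omega process
  turns its right-hand side into contractions.\<close>

lemma (in function_algebra) matrix_invariants:
  assumes n: "n > 0"
    and Mat: "\<And>M x. M \<in> Mat \<Longrightarrow> x \<in> Z \<Longrightarrow> M x \<in> carrier_mat n n"
    and one: "(\<lambda>x. 1\<^sub>m n) \<in> Mat"
    and mult: "\<And>M N. M \<in> Mat \<Longrightarrow> N \<in> Mat \<Longrightarrow> (\<lambda>x. M x * N x) \<in> Mat"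
    and trace: "\<And>M. M \<in> Mat \<Longrightarrow> (\<lambda>x\<in>Z. mat_trace (M x)) \<in> S"
    and act: "\<And>g x. g \<in> carrier_mat n n \<Longrightarrow> det g \<noteq> 0 \<Longrightarrow> x \<in> Z \<Longrightarrow> act g x \<in> Z"
    and equivariant: "\<And>M g x. M \<in> Mat \<Longrightarrow> g \<in> carrier_mat n n \<Longrightarrow> det g \<noteq> 0 \<Longrightarrow> x \<in> Z \<Longrightarrow>
        M (act g x) * g = g * M x"
    and S_inv: "\<And>h g x. h \<in> S \<Longrightarrow> g \<in> carrier_mat n n \<Longrightarrow> det g \<noteq> 0 \<Longrightarrow> x \<in> Z \<Longrightarrow> h (act g x) = h x"
    and f: "f \<in> generated_algebra Z (S \<union> {\<lambda>x. M x $$ (r, c) | M r c. M \<in> Mat \<and> r < n \<and> c < n})"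
    and f_inv: "\<And>g x. g \<in> carrier_mat n n \<Longrightarrow> det g \<noteq> 0 \<Longrightarrow> x \<in> Z \<Longrightarrow> f (act g x) = f x"
  shows "f \<in> S"
proof -
  define E where "E = Mat \<times> {..<n} \<times> {..<n}"
  define ev where "ev = (\<lambda>(M, r, c) (x :: 'x). M x $$ (r, c) :: complex)"
  have "{\<lambda>x. M x $$ (r, c) | M r c. M \<in> Mat \<and> r < n \<and> c < n} = ev ` E"
    by (force simp: E_def ev_def image_def)
  from generated_monomials[OF f[unfolded this]] obtain js where
    js: "\<And>h es. (h, es) \<in> set js \<Longrightarrow> h \<in> S \<and> set es \<subseteq> E"
    and f_eq: "\<And>x. x \<in> Z \<Longrightarrow> f x = (\<Sum>(h, es)\<leftarrow>js. h x * (\<Prod>e\<leftarrow>es. ev e x))"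
    by (force simp: case_prod_unfold)
  \<comment> \<open>\<open>Suc\<close> makes \<open>D\<close> exceed the length of every monomial,
    so that padding to length \<open>D\<close> always adds at least one factor.\<close>
  define D where "D = Suc (\<Sum>(h, es)\<leftarrow>js. length es)"
  \<comment> \<open>The entry at (0, 0) of the identity matrix is the constant 1, so padding does
    not change values. Conjugated with the adjugate it becomes \<open>det g\<close>, a factor that
    vanishes on singular \<open>g\<close>.\<close>
  define e0 where "e0 = ((\<lambda>x :: 'x. 1\<^sub>m n :: complex mat), 0 :: nat, 0 :: nat)"
  define pad where "pad es = es @ replicate (D - length es) e0" for es
  have len: "length es < D" if "(h, es) \<in> set js" for h es
  proof -
    have "length es \<le> (\<Sum>(h, es)\<leftarrow>js. length es)"
      using that member_le_sum_list[of "length es" "map (\<lambda>(h, es). length es) js"] by force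
    then show ?thesis by (simp add: D_def)
  qed
  have pad: "length (pad es) = D" "set (pad es) \<subseteq> E" "e0 \<in> set (pad es)" if "(h, es) \<in> set js" for h es
    using len[OF that] js[OF that] one n by (auto simp: pad_def E_def e0_def)
  have pad_prod: "(\<Prod>e\<leftarrow>pad es. ev e x) = (\<Prod>e\<leftarrow>es. ev e x)" for es x
    using n by (simp add: pad_def e0_def ev_def map_replicate_const)
  define T where "T es x g = (\<Prod>t<D. (g * fst (pad es ! t) x * adj_mat g) $$ snd (pad es ! t))" for es x g
  \<comment> \<open>Omega evaluates its argument at singular matrices too, where nothing is known
    about \<open>act\<close>, so the identity has to hold for all \<open>g\<close>. For
    \<open>det g = 0\<close> both sides are 0, the right one thanks to the padding.\<close>
  have key: "f x * det g ^ D = (\<Sum>(h, es)\<leftarrow>js. h x * T es x g)"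
    if x: "x \<in> Z" and g: "g \<in> carrier_mat n n" for x g
  proof (cases "det g = 0")
    case True
    have "T es x g = 0" if hes: "(h, es) \<in> set js" for h es
    proof -
      obtain t where t: "t < D" "pad es ! t = e0"
        using pad[OF hes] by (metis in_set_conv_nth)
      have "(g * fst e0 x * adj_mat g) $$ snd e0 = 0"
        using adj_mat[OF g] g n True by (simp add: e0_def)
      then show ?thesis unfolding T_def using t by (intro prod_zero bexI[of _ t]) auto
    qed
    then have "(\<Sum>(h, es)\<leftarrow>js. h x * T es x g) = (\<Sum>(h, es)\<leftarrow>js. 0)"
      by (intro arg_cong[of _ _ sum_list] map_cong) auto
    then show ?thesis using True by (simp add: D_def case_prod_unfold)
  next
    case False
    note adj = adj_mat[OF g]
    have conj: "det g * ev e (act g x) = (g * fst e x * adj_mat g) $$ snd e" if eE: "e \<in> E" for e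
    proof -
      obtain M r c where e: "e = (M, r, c)" "M \<in> Mat" "r < n" "c < n"
        using eE by (auto simp: E_def)
      have M: "M x \<in> carrier_mat n n" "M (act g x) \<in> carrier_mat n n"
        using Mat[OF e(2)] act[OF g False x] x by auto
      have "g * M x * adj_mat g = M (act g x) * g * adj_mat g"
        using equivariant[OF e(2) g False x] by simp
      also have "\<dots> = det g \<cdot>\<^sub>m M (act g x)"
        using M g adj by (simp add: assoc_mult_mat[of _ n n _ n _ n] mult_smult_distrib[of _ n n _ n])
      finally show ?thesis using e M by (simp add: ev_def)
    qed
    have T: "T es x g = det g ^ D * (\<Prod>e\<leftarrow>es. ev e (act g x))" if "(h, es) \<in> set js" for h es
    proof -
      have "T es x g = (\<Prod>t<D. det g * ev (pad es ! t) (act g x))"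
        unfolding T_def
      proof (intro prod.cong refl)
        fix t assume "t \<in> {..<D}"
        then have "pad es ! t \<in> E" using pad[OF that] by (metis lessThan_iff nth_mem subsetD)
        then show "(g * fst (pad es ! t) x * adj_mat g) $$ snd (pad es ! t) = det g * ev (pad es ! t) (act g x)"
          by (rule conj[symmetric])
      qed
      also have "\<dots> = det g ^ D * (\<Prod>e\<leftarrow>pad es. ev e (act g x))"
        using pad(1)[OF that] by (simp add: prod.distrib prod.list_conv_set_nth atLeast0LessThan)
      finally show ?thesis by (simp add: pad_prod)
    qed
    have "(\<Sum>(h, es)\<leftarrow>js. h x * T es x g) =
        (\<Sum>(h, es)\<leftarrow>js. det g ^ D * (h (act g x) * (\<Prod>e\<leftarrow>es. ev e (act g x))))"
    proof (intro arg_cong[of _ _ sum_list] map_cong refl)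
      fix p assume p: "p \<in> set js"
      obtain h es where hes: "p = (h, es)" by (cases p)
      have "T es x g = det g ^ D * (\<Prod>e\<leftarrow>es. ev e (act g x))" "h (act g x) = h x"
        using T p hes js S_inv[OF _ g False x] by blast+
      then show "(case p of (h, es) \<Rightarrow> h x * T es x g) =
          (case p of (h, es) \<Rightarrow> det g ^ D * (h (act g x) * (\<Prod>e\<leftarrow>es. ev e (act g x))))"
        by (simp add: hes)
    qed
    also have "\<dots> = det g ^ D * f (act g x)"
      using f_eq[OF act[OF g False x]] by (simp add: sum_list_const_mult case_prod_unfold)
    finally show ?thesis using f_inv[OF g False x] by simp
  qed
  define c where "c = Omega D n (\<lambda>g. det g ^ D)"
  \<comment> \<open>By \<open>Omega_conj_adj_mat\<close> this is a signed sum of contractions of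
    matrices from \<open>Mat\<close>, and a contraction is a polynomial in traces of their
    products.\<close>
  have T_mem: "(\<lambda>x\<in>Z. Omega D n (T es x)) \<in> S" if hes: "(h, es) \<in> set js" for h es
  proof -
    let ?N = "\<lambda>u. if snd u = snd (snd (pad es ! fst u)) then fst (pad es ! fst u) else (\<lambda>x. 1\<^sub>m n)"
    let ?P = "{\<pi>. \<pi> permutes slots D n \<and> (\<forall>u\<in>slots D n. snd (\<pi> u) =
          (if snd u = snd (snd (pad es ! fst u)) then fst (snd (pad es ! fst u)) else snd u))}"
    have E: "fst (pad es ! t) \<in> Mat" "fst (snd (pad es ! t)) < n" "snd (snd (pad es ! t)) < n"
      if "t < D" for t
    proof -
      have "pad es ! t \<in> E" using pad[OF hes] that by (metis nth_mem subset_iff)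
      then show "fst (pad es ! t) \<in> Mat" "fst (snd (pad es ! t)) < n" "snd (snd (pad es ! t)) < n"
        by (auto simp: E_def)
    qed
    have eq: "Omega D n (T es x) = (\<Sum>\<pi>\<in>?P. \<Sum>\<sigma>\<in>{..<D} \<rightarrow>\<^sub>E {\<sigma>. \<sigma> permutes {..<n}}. (\<Prod>t<D. signof (\<sigma> t)) *
        (\<Sum>K\<in>slots D n \<rightarrow>\<^sub>E {..<n}. \<Prod>u\<in>slots D n. ?N u x $$ (K ((slot_perm D \<sigma> \<circ> \<pi>) u), K u)))"
      if x: "x \<in> Z" for x
      using Omega_conj_adj_mat[of D "\<lambda>t. fst (pad es ! t) x" n "\<lambda>t. fst (snd (pad es ! t))" "\<lambda>t. snd (snd (pad es ! t))"]
        E Mat x by (simp add: T_def[abs_def] if_distrib[of "\<lambda>f. f x"] cong: if_cong)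
    have mem: "(\<lambda>x\<in>Z. \<Sum>\<pi>\<in>?P. \<Sum>\<sigma>\<in>{..<D} \<rightarrow>\<^sub>E {\<sigma>. \<sigma> permutes {..<n}}. (\<Prod>t<D. signof (\<sigma> t)) *
        (\<Sum>K\<in>slots D n \<rightarrow>\<^sub>E {..<n}. \<Prod>u\<in>slots D n. ?N u x $$ (K ((slot_perm D \<sigma> \<circ> \<pi>) u), K u))) \<in> S"
    proof (rule sum_mem, rule sum_mem, rule cmult_mem, rule contraction_mem[of Mat])
      fix \<pi> \<sigma> assume "\<pi> \<in> ?P"
        and "\<sigma> \<in> {..<D} \<rightarrow>\<^sub>E {\<sigma>. \<sigma> permutes {..<n}}"
      then show "slot_perm D \<sigma> \<circ> \<pi> permutes slots D n"
        by (intro permutes_compose slot_permutes) auto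
    qed (use Mat mult trace E one in auto)
    show ?thesis by (rule iffD2[OF mem_cong mem]) (rule eq)
  qed
  have "c * f x = (\<Sum>(h, es)\<leftarrow>js. h x * Omega D n (T es x))" if x: "x \<in> Z" for x
  proof -
    have "c * f x = Omega D n (\<lambda>g. f x * det g ^ D)"
      by (simp add: c_def Omega_cmult)
    also have "\<dots> = Omega D n (\<lambda>g. \<Sum>(h, es)\<leftarrow>js. h x * T es x g)"
      using key[OF x] by (intro Omega_cong)
    finally show ?thesis by (simp add: Omega_sum_list Omega_cmult case_prod_unfold)
  qed
  then have eq: "f x = (1 / c) * (\<Sum>(h, es)\<leftarrow>js. h x * Omega D n (T es x))" if "x \<in> Z" for x
    using Omega_det_power[of D n] that by (simp add: c_def field_simps)
  have mem: "(\<lambda>x\<in>Z. (1 / c) * (\<Sum>(h, es)\<leftarrow>js. h x * Omega D n (T es x))) \<in> S"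
  proof (rule cmult_mem, rule sum_list_mem)
    fix p assume p: "p \<in> set js"
    obtain h es where hes: "p = (h, es)" by (cases p)
    then have "restrict h Z \<in> S" "(\<lambda>x\<in>Z. Omega D n (T es x)) \<in> S"
      using p js T_mem restrict_mem by blast+
    then have "(\<lambda>x\<in>Z. h x * Omega D n (T es x)) \<in> S" by (rule mult_mem)
    then show "(\<lambda>x\<in>Z. case p of (h, es) \<Rightarrow> h x * Omega D n (T es x)) \<in> S"
      by (simp add: hes)
  qed
  have "restrict f Z \<in> S" by (rule iffD2[OF mem_cong mem]) (rule eq)
  then show ?thesis using generated_restrict[OF f] by simp
qed

section \<open>Invariants of quiver representations\<close>

text \<open>Multiplication by \<open>t ^ K\<close> clears the negative exponents and leaves a
  polynomial with infinitely many zeros. This is what discards the monomials of nonzero weight under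
  scalar matrices.\<close>

lemma laurent_constant_term:
  fixes c :: complex
  assumes "\<And>t. t \<noteq> 0 \<Longrightarrow> (\<Sum>p\<leftarrow>ps. a p * t powi w p) = c"
  shows "(\<Sum>p\<leftarrow>filter (\<lambda>p. w p = 0) ps. a p) = c"
proof -
  define K where "K = (\<Sum>p\<leftarrow>ps. nat \<bar>w p\<bar>)"
  have nonneg: "0 \<le> w p + int K" if "p \<in> set ps" for p
  proof -
    have "nat \<bar>w p\<bar> \<le> K"
      unfolding K_def using that by (intro member_le_sum_list) auto
    then show ?thesis by linarith
  qed
  define P where "P = (\<Sum>p\<leftarrow>ps. monom (a p) (nat (w p + int K))) - monom c K"
  have "poly P t = 0" if t: "t \<noteq> 0" for t
  proof -
    have "(\<Sum>p\<leftarrow>ps. poly (monom (a p) (nat (w p + int K))) t) = (\<Sum>p\<leftarrow>ps. t ^ K * (a p * t powi w p))"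
    proof (intro arg_cong[of _ _ sum_list] map_cong refl)
      fix p assume "p \<in> set ps"
      then have "t ^ nat (w p + int K) = t powi (w p + int K)"
        using nonneg by (simp add: power_int_def)
      then show "poly (monom (a p) (nat (w p + int K))) t = t ^ K * (a p * t powi w p)"
        using t by (simp add: poly_monom power_int_add)
    qed
    also have "\<dots> = t ^ K * c"
      using assms[OF t] by (simp add: sum_list_const_mult)
    finally have "(\<Sum>p\<leftarrow>ps. poly (monom (a p) (nat (w p + int K))) t) = t ^ K * c" .
    then show ?thesis
      using poly_sum_list[of "map (\<lambda>p. monom (a p) (nat (w p + int K))) ps" t]
      by (simp add: P_def poly_monom o_def mult.commute)
  qed
  then have "- {0} \<subseteq> {t. poly P t = 0}" by auto
  moreover have "infinite (- {0 :: complex})"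
    using infinite_UNIV_char_0[where 'a = complex] by (simp add: Compl_eq_Diff_UNIV)
  ultimately have "P = 0" using poly_roots_finite finite_subset by metis
  then have "coeff (\<Sum>p\<leftarrow>ps. monom (a p) (nat (w p + int K))) K = c"
    by (simp add: P_def)
  moreover have "coeff (\<Sum>p\<leftarrow>ps. monom (a p) (nat (w p + int K))) K = (\<Sum>p\<leftarrow>filter (\<lambda>p. w p = 0) ps. a p)"
    using nonneg by (induction ps) (auto simp: nat_eq_iff)
  ultimately show ?thesis by simp
qed

lemma mat_trace_mult_commute:
  assumes "A \<in> carrier_mat a b" "B \<in> carrier_mat b a"
  shows "mat_trace (A * B) = mat_trace (B * A)"
proof -
  have "mat_trace (A * B) = (\<Sum>i<a. \<Sum>k<b. A $$ (i, k) * B $$ (k, i))"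
    using assms by (simp add: mat_trace_def index_mult_mat_sum[OF assms] del: index_mult_mat(1))
  also have "\<dots> = (\<Sum>k<b. \<Sum>i<a. B $$ (k, i) * A $$ (i, k))"
    by (subst sum.swap) (simp add: mult.commute)
  also have "\<dots> = mat_trace (B * A)"
    using assms by (simp add: mat_trace_def index_mult_mat_sum[OF assms(2,1)] del: index_mult_mat(1))
  finally show ?thesis .
qed

definition (in function_algebra) entries_mem :: "nat \<Rightarrow> nat \<Rightarrow> ('x \<Rightarrow> complex mat) \<Rightarrow> bool" where
  "entries_mem a b A \<longleftrightarrow> (\<forall>x\<in>Z. A x \<in> carrier_mat a b) \<and>
     (\<forall>r<a. \<forall>c<b. (\<lambda>x\<in>Z. A x $$ (r, c)) \<in> S)"

lemma (in function_algebra) entries_mult: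
  assumes A: "entries_mem a b A" and B: "entries_mem b c B"
  shows "entries_mem a c (\<lambda>x. A x * B x)"
  unfolding entries_mem_def
proof (intro conjI ballI allI impI)
  fix x assume "x \<in> Z"
  then show "A x * B x \<in> carrier_mat a c" using A B by (auto simp: entries_mem_def)
next
  fix r s assume rs: "r < a" "s < c"
  have eq: "(A x * B x) $$ (r, s) = (\<Sum>k<b. A x $$ (r, k) * B x $$ (k, s))" if "x \<in> Z" for x
    using A B that rs by (intro index_mult_mat_sum) (auto simp: entries_mem_def)
  have mem: "(\<lambda>x\<in>Z. \<Sum>k<b. A x $$ (r, k) * B x $$ (k, s)) \<in> S"
    using A B rs by (intro sum_mem mult_mem) (auto simp: entries_mem_def)
  show "(\<lambda>x\<in>Z. (A x * B x) $$ (r, s)) \<in> S" by (rule iffD2[OF mem_cong mem]) (rule eq)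
qed

lemma (in function_algebra) entries_trace:
  assumes A: "entries_mem a a A"
  shows "(\<lambda>x\<in>Z. mat_trace (A x)) \<in> S"
proof -
  have eq: "mat_trace (A x) = (\<Sum>r<a. A x $$ (r, r))" if "x \<in> Z" for x
    using A that by (auto simp: entries_mem_def mat_trace_def)
  have mem: "(\<lambda>x\<in>Z. \<Sum>r<a. A x $$ (r, r)) \<in> S"
    using A by (intro sum_mem) (auto simp: entries_mem_def)
  show ?thesis by (rule iffD2[OF mem_cong mem]) (rule eq)
qed

text \<open>\<open>path_fun Q \<beta> i j p\<close> describes a path from \<open>j\<close> to
  \<open>i\<close>, in the order of matrix multiplication. Only its evaluation is recorded, and the
  rule \<open>comp\<close> makes closure under products immediate.\<close>

inductive path_fun ::
    "('v, 'e) pre_digraph \<Rightarrow> ('v \<Rightarrow> nat) \<Rightarrow> 'v \<Rightarrow> 'v \<Rightarrow> (('e \<Rightarrow> complex mat) \<Rightarrow> complex mat) \<Rightarrow> bool"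
  for Q \<beta> where
  empty: "i \<in> verts Q \<Longrightarrow> path_fun Q \<beta> i i (\<lambda>x. 1\<^sub>m (\<beta> i))"
| arrow: "a \<in> arcs Q \<Longrightarrow> path_fun Q \<beta> (head Q a) (tail Q a) (\<lambda>x. x a)"
| comp: "path_fun Q \<beta> i j p \<Longrightarrow> path_fun Q \<beta> j k q \<Longrightarrow> path_fun Q \<beta> i k (\<lambda>x. p x * q x)"

lemma path_fun_carrier:
  assumes "path_fun Q \<beta> i j p" "x \<in> rep_space Q \<beta>"
  shows "p x \<in> carrier_mat (\<beta> i) (\<beta> j)"
  using assms by induction (auto simp: rep_space_def)

lemma path_fun_verts:
  assumes "path_fun Q \<beta> i j p" "wf_digraph Q"
  shows "i \<in> verts Q" "j \<in> verts Q"
  using assms by (induction) (auto simp: wf_digraph_def)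

lemma GL_prod_component: "g \<in> carrier (GL_prod Q \<beta>) \<Longrightarrow> i \<in> verts Q \<Longrightarrow> g i \<in> carrier (GL (\<beta> i))"
  by (auto simp: GL_prod_def PiE_iff)

text \<open>As an intertwining relation free of inverses it composes directly: the group element at
  the middle vertex passes from one factor to the other.\<close>

lemma path_fun_equivariant:
  assumes "path_fun Q \<beta> i j p" and wf: "wf_digraph Q" and g: "g \<in> carrier (GL_prod Q \<beta>)"
    and x: "x \<in> rep_space Q \<beta>" and x': "rep_act Q \<beta> g x \<in> rep_space Q \<beta>"
  shows "p (rep_act Q \<beta> g x) * g j = g i * p x"
  using assms(1)
proof induction
  case (empty i)
  then show ?case using inv_GL(1)[OF GL_prod_component[OF g empty]] by simp
next
  case (arrow a)
  then have v: "tail Q a \<in> verts Q" "head Q a \<in> verts Q" using wf by (auto simp: wf_digraph_def)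
  note t = inv_GL[OF GL_prod_component[OF g v(1)]] and h = inv_GL(1)[OF GL_prod_component[OF g v(2)]]
  have xa: "x a \<in> carrier_mat (\<beta> (head Q a)) (\<beta> (tail Q a))"
    using x arrow by (auto simp: rep_space_def)
  show ?case
    using arrow t h xa
      assoc_mult_mat[of "g (head Q a) * x a" "\<beta> (head Q a)" "\<beta> (tail Q a)" _ "\<beta> (tail Q a)" "g (tail Q a)" "\<beta> (tail Q a)"]
    by (simp add: rep_act_def)
next
  case (comp i j p k q)
  note v = path_fun_verts[OF comp(1) wf] path_fun_verts[OF comp(2) wf]
  note [simp] = inv_GL(1)[OF GL_prod_component[OF g v(1)]] inv_GL(1)[OF GL_prod_component[OF g v(2)]]
    inv_GL(1)[OF GL_prod_component[OF g v(4)]]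
    path_fun_carrier[OF comp(1) x] path_fun_carrier[OF comp(1) x']
    path_fun_carrier[OF comp(2) x] path_fun_carrier[OF comp(2) x']
  let ?x = "rep_act Q \<beta> g x"
  have "p ?x * q ?x * g k = p ?x * (q ?x * g k)"
    by (rule assoc_mult_mat[of _ "\<beta> i" "\<beta> j" _ "\<beta> k" _ "\<beta> k"]) simp_all
  also have "\<dots> = p ?x * g j * q x"
    unfolding comp.IH(2) by (rule assoc_mult_mat[symmetric, of _ "\<beta> i" "\<beta> j" _ "\<beta> j" _ "\<beta> k"]) simp_all
  also have "\<dots> = g i * (p x * q x)"
    unfolding comp.IH(1) by (rule assoc_mult_mat[of _ "\<beta> i" "\<beta> i" _ "\<beta> j" _ "\<beta> k"]) simp_all
  finally show ?case .
qed

lemma path_fun_trace_invariant: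
  assumes p: "path_fun Q \<beta> i i p" and wf: "wf_digraph Q" and g: "g \<in> carrier (GL_prod Q \<beta>)"
    and x: "x \<in> rep_space Q \<beta>" and x': "rep_act Q \<beta> g x \<in> rep_space Q \<beta>"
  shows "mat_trace (p (rep_act Q \<beta> g x)) = mat_trace (p x)"
proof -
  let ?p' = "p (rep_act Q \<beta> g x)" and ?h = "inv\<^bsub>GL (\<beta> i)\<^esub> g i"
  note c = path_fun_carrier[OF p x] path_fun_carrier[OF p x']
    inv_GL[OF GL_prod_component[OF g path_fun_verts(1)[OF p wf]]]
  have "?p' = ?p' * g i * ?h"
    using c by (simp add: assoc_mult_mat[of _ "\<beta> i" "\<beta> i" _ "\<beta> i" _ "\<beta> i"])
  also have "\<dots> = (g i * p x) * ?h" using path_fun_equivariant[OF assms] by simp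
  also have "mat_trace \<dots> = mat_trace (?h * (g i * p x))"
    using c by (intro mat_trace_mult_commute[of _ "\<beta> i" "\<beta> i"]) auto
  also have "?h * (g i * p x) = p x"
    using c by (simp add: assoc_mult_mat[of _ "\<beta> i" "\<beta> i" _ "\<beta> i" _ "\<beta> i", symmetric])
  finally show ?thesis .
qed

text \<open>Stability is what allows an identity on \<open>Z\<close> to be evaluated at the
  translates of a point of \<open>Z\<close>.\<close>

locale stable_rep =
  fixes Q :: "('v, 'e) pre_digraph" and \<beta> :: "'v \<Rightarrow> nat" and Z :: "('e \<Rightarrow> complex mat) set"
  assumes wf: "wf_digraph Q" and finite_verts: "finite (verts Q)"
    and Z_rep: "Z \<subseteq> rep_space Q \<beta>"
    and Z_stable: "g \<in> carrier (GL_prod Q \<beta>) \<Longrightarrow> x \<in> Z \<Longrightarrow> rep_act Q \<beta> g x \<in> Z"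
begin

definition vertex_act :: "'v \<Rightarrow> complex mat \<Rightarrow> ('e \<Rightarrow> complex mat) \<Rightarrow> 'e \<Rightarrow> complex mat" where
  "vertex_act i h = rep_act Q \<beta> (\<lambda>j\<in>verts Q. if j = i then h else 1\<^sub>m (\<beta> j))"

lemma vertex_GL_prod:
  assumes "h \<in> carrier_mat (\<beta> i) (\<beta> i)" "det h \<noteq> 0"
  shows "(\<lambda>j\<in>verts Q. if j = i then h else 1\<^sub>m (\<beta> j)) \<in> carrier (GL_prod Q \<beta>)"
proof -
  have "h \<in> carrier (GL (\<beta> i))"
    using det_non_zero_imp_unit[OF assms] by (simp add: units_of_def)
  moreover have "1\<^sub>m (\<beta> j) \<in> carrier (GL (\<beta> j))" for j
    using det_non_zero_imp_unit[of "1\<^sub>m (\<beta> j) :: complex mat" "\<beta> j"] by (simp add: units_of_def)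
  ultimately show ?thesis by (auto simp: GL_prod_def)
qed

lemma path_carrier:
  assumes "path_fun Q \<beta> j k p" "x \<in> Z"
  shows "p x \<in> carrier_mat (\<beta> j) (\<beta> k)"
  by (rule path_fun_carrier[OF assms(1) subsetD[OF Z_rep assms(2)]])

lemma vertex_act_mem:
  assumes "h \<in> carrier_mat (\<beta> i) (\<beta> i)" "det h \<noteq> 0" "x \<in> Z"
  shows "vertex_act i h x \<in> Z"
  unfolding vertex_act_def by (rule Z_stable[OF vertex_GL_prod[OF assms(1,2)] assms(3)])

lemma vertex_act_path:
  assumes p: "path_fun Q \<beta> j k p" and h: "h \<in> carrier_mat (\<beta> i) (\<beta> i)" "det h \<noteq> 0" and x: "x \<in> Z"
  shows "p (vertex_act i h x) * (if k = i then h else 1\<^sub>m (\<beta> k)) = (if j = i then h else 1\<^sub>m (\<beta> j)) * p x"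
  using path_fun_equivariant[OF p wf vertex_GL_prod[OF h] subsetD[OF Z_rep x]
      subsetD[OF Z_rep vertex_act_mem[OF h x, unfolded vertex_act_def]]] path_fun_verts[OF p wf]
  by (simp add: vertex_act_def)

definition vertex_gens :: "'v set \<Rightarrow> (('e \<Rightarrow> complex mat) \<Rightarrow> complex) set" where
  "vertex_gens R = {\<lambda>x. p x $$ (r, c) | p j k r c.
      j \<in> R \<and> k \<in> R \<and> path_fun Q \<beta> j k p \<and> r < \<beta> j \<and> c < \<beta> k} \<union>
    {\<lambda>x. mat_trace (p x) | p i. path_fun Q \<beta> i i p}"

lemma vertex_gens_entry:
  "j \<in> R \<Longrightarrow> k \<in> R \<Longrightarrow> path_fun Q \<beta> j k p \<Longrightarrow> r < \<beta> j \<Longrightarrow> c < \<beta> k \<Longrightarrow>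
    (\<lambda>x. p x $$ (r, c)) \<in> vertex_gens R"
  unfolding vertex_gens_def by blast

lemma vertex_gens_trace: "path_fun Q \<beta> i i p \<Longrightarrow> (\<lambda>x. mat_trace (p x)) \<in> vertex_gens R"
  unfolding vertex_gens_def by blast

lemma vertex_act_gens:
  assumes "f \<in> generated_algebra Z (vertex_gens R)" "i \<notin> R"
    "h \<in> carrier_mat (\<beta> i) (\<beta> i)" "det h \<noteq> 0" "x \<in> Z"
  shows "f (vertex_act i h x) = f x"
  using assms(1)
proof induction
  case (gen f)
  note mem = vertex_act_mem[OF assms(3-5)]
  from gen consider p j k r c where "f = (\<lambda>x. p x $$ (r, c))" "j \<in> R" "k \<in> R" "path_fun Q \<beta> j k p"
    | p j where "f = (\<lambda>x. mat_trace (p x))" "path_fun Q \<beta> j j p"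
    by (auto simp: vertex_gens_def)
  then show ?case
  proof cases
    case 1
    then have "j \<noteq> i" "k \<noteq> i" using assms(2) by auto
    then have "p (vertex_act i h x) = p x"
      using vertex_act_path[OF 1(4) assms(3-5)] path_carrier[OF 1(4) assms(5)] path_carrier[OF 1(4) mem]
      by simp
    then show ?thesis using 1(1) mem assms(5) by simp
  next
    case 2
    then show ?thesis
      using path_fun_trace_invariant[OF 2(2) wf vertex_GL_prod[OF assms(3,4)], of x] mem assms(5) Z_rep
      by (auto simp: vertex_act_def)
  qed
qed (use vertex_act_mem[OF assms(3-5)] assms(5) in simp_all)

text \<open>Invariance under the scalars at \<open>i\<close> forces each monomial to contain as many entries of paths
  ending at \<open>i\<close> as of paths starting there. Paired up, these become entries of the matrices \<open>p C q\<close>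
  at \<open>i\<close>, and invariance under all of \<open>GL\<close> applies to the latter.\<close>

lemma eliminate_vertex:
  assumes f: "f \<in> generated_algebra Z (vertex_gens (insert i R))" and i: "i \<notin> R" "i \<in> verts Q"
    and f_inv: "\<And>h x. h \<in> carrier_mat (\<beta> i) (\<beta> i) \<Longrightarrow> det h \<noteq> 0 \<Longrightarrow> x \<in> Z \<Longrightarrow> f (vertex_act i h x) = f x"
  shows "f \<in> generated_algebra Z (vertex_gens R)"
proof (cases "\<beta> i = 0")
  \<comment> \<open>No index is below 0, so a vertex of dimension 0 has no entries to
    eliminate.\<close>
  case True
  then have "vertex_gens (insert i R) = vertex_gens R"
    unfolding vertex_gens_def by (intro arg_cong2[of _ _ _ _ "(\<union>)"] refl Collect_cong) fastforce
  then show ?thesis using f by simp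
next
  case False
  define n where "n = \<beta> i"
  define S where "S = generated_algebra Z (vertex_gens R)"
  interpret S: function_algebra Z S unfolding S_def by (rule function_algebra_generated)
  have gen_S: "restrict g Z \<in> S" if "g \<in> vertex_gens R" for g
    unfolding S_def using that by (rule generated_algebra.gen)
  have S_inv: "g (vertex_act i h x) = g x"
    if "g \<in> S" "h \<in> carrier_mat n n" "det h \<noteq> 0" "x \<in> Z" for g h x
    using vertex_act_gens that i by (simp add: S_def n_def)
  \<comment> \<open>Cycles at \<open>i\<close>, together with products \<open>p C q\<close> through
    the remaining vertices. In a product of two of the latter, \<open>q p'\<close> is a path between
    vertices of \<open>R\<close> and has entries in \<open>S\<close>, so it can be absorbed into the
    middle factor. Admitting any \<open>C\<close> with entries in \<open>S\<close> is what closes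
    the set under multiplication.\<close>
  define Mat where "Mat = {M. (\<exists>p. path_fun Q \<beta> i i p \<and> (\<forall>x\<in>Z. M x = p x)) \<or>
    (\<exists>j k p q C. j \<in> R \<and> k \<in> R \<and> path_fun Q \<beta> i j p \<and> path_fun Q \<beta> k i q \<and>
       S.entries_mem (\<beta> j) (\<beta> k) C \<and> (\<forall>x\<in>Z. M x = p x * C x * q x))}"
  have Mat_cases: thesis if "M \<in> Mat"
    and "\<And>p. path_fun Q \<beta> i i p \<Longrightarrow> (\<And>x. x \<in> Z \<Longrightarrow> M x = p x) \<Longrightarrow> thesis"
    and "\<And>j k p q C. j \<in> R \<Longrightarrow> k \<in> R \<Longrightarrow> path_fun Q \<beta> i j p \<Longrightarrow> path_fun Q \<beta> k i q \<Longrightarrow>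
       S.entries_mem (\<beta> j) (\<beta> k) C \<Longrightarrow> (\<And>x. x \<in> Z \<Longrightarrow> M x = p x * C x * q x) \<Longrightarrow> thesis"
  for M thesis using that unfolding Mat_def by blast
  have path_entries: "S.entries_mem (\<beta> j) (\<beta> k) p" if "path_fun Q \<beta> j k p" "j \<in> R" "k \<in> R" for j k p
    unfolding S.entries_mem_def
    using that path_carrier[OF that(1)] by (auto intro!: gen_S vertex_gens_entry[OF that(2,3,1)])
  have Mat_carrier: "M x \<in> carrier_mat n n" if "M \<in> Mat" "x \<in> Z" for M x
    using that(1)
    by (rule Mat_cases)
      (use path_carrier[OF _ that(2)] that(2) in \<open>auto simp: n_def S.entries_mem_def intro!: mult_carrier_mat\<close>)
  have one: "(\<lambda>x. 1\<^sub>m n) \<in> Mat"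
    unfolding Mat_def n_def using path_fun.empty[OF i(2)] by blast
  have mult: "(\<lambda>x. M x * N x) \<in> Mat" if M: "M \<in> Mat" and N: "N \<in> Mat" for M N
    using M
  proof (rule Mat_cases)
    fix p assume p: "path_fun Q \<beta> i i p" and M_eq: "\<And>x. x \<in> Z \<Longrightarrow> M x = p x"
    show ?thesis
      using N
    proof (rule Mat_cases)
      fix p' assume "path_fun Q \<beta> i i p'" and "\<And>x. x \<in> Z \<Longrightarrow> N x = p' x"
      then show ?thesis unfolding Mat_def using path_fun.comp[OF p, of i p'] M_eq by auto
    next
      fix j k p' q C
      assume N': "j \<in> R" "k \<in> R" "path_fun Q \<beta> i j p'" "path_fun Q \<beta> k i q"
        "S.entries_mem (\<beta> j) (\<beta> k) C" and N_eq: "\<And>x. x \<in> Z \<Longrightarrow> N x = p' x * C x * q x"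
      have "M x * N x = (p x * p' x) * C x * q x" if x: "x \<in> Z" for x
      proof -
        note c = path_carrier[OF p x] path_carrier[OF N'(3) x] path_carrier[OF N'(4) x]
        have C: "C x \<in> carrier_mat (\<beta> j) (\<beta> k)" using N'(5) x by (simp add: S.entries_mem_def)
        show ?thesis
          using c C by (simp add: M_eq[OF x] N_eq[OF x] assoc_mult_mat[of _ n n _ "\<beta> j" _ "\<beta> k"]
              assoc_mult_mat[of _ n n _ "\<beta> k" _ n] n_def)
      qed
      then show ?thesis unfolding Mat_def using path_fun.comp[OF p N'(3)] N' by blast
    qed
  next
    fix j k p q C
    assume M': "j \<in> R" "k \<in> R" "path_fun Q \<beta> i j p" "path_fun Q \<beta> k i q"
      "S.entries_mem (\<beta> j) (\<beta> k) C" and M_eq: "\<And>x. x \<in> Z \<Longrightarrow> M x = p x * C x * q x"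
    have C: "C x \<in> carrier_mat (\<beta> j) (\<beta> k)" if "x \<in> Z" for x using M'(5) that by (simp add: S.entries_mem_def)
    show ?thesis
      using N
    proof (rule Mat_cases)
      fix p' assume p': "path_fun Q \<beta> i i p'" and N_eq: "\<And>x. x \<in> Z \<Longrightarrow> N x = p' x"
      have "M x * N x = p x * C x * (q x * p' x)" if x: "x \<in> Z" for x
        unfolding M_eq[OF x] N_eq[OF x]
        using path_carrier[OF p' x] path_carrier[OF M'(3) x] path_carrier[OF M'(4) x] C[OF x]
        by (intro assoc_mult_mat[of _ n "\<beta> k" _ n _ n]) (auto simp: n_def)
      then show ?thesis unfolding Mat_def using path_fun.comp[OF M'(4) p'] M' by blast
    next
      fix j' k' p' q' C'
      assume N': "j' \<in> R" "k' \<in> R" "path_fun Q \<beta> i j' p'" "path_fun Q \<beta> k' i q'"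
        "S.entries_mem (\<beta> j') (\<beta> k') C'" and N_eq: "\<And>x. x \<in> Z \<Longrightarrow> N x = p' x * C' x * q' x"
      have "M x * N x = p x * (C x * (q x * p' x) * C' x) * q' x" if x: "x \<in> Z" for x
      proof -
        have C': "C' x \<in> carrier_mat (\<beta> j') (\<beta> k')" using N'(5) x by (simp add: S.entries_mem_def)
        note c = path_carrier[OF N'(3) x] path_carrier[OF N'(4) x]
          path_carrier[OF M'(3) x] path_carrier[OF M'(4) x] C[OF x] C'
        have "M x * N x = (p x * C x * q x) * (p' x * (C' x * q' x))"
          using c by (simp add: M_eq[OF x] N_eq[OF x] assoc_mult_mat[of _ n "\<beta> j'" _ "\<beta> k'" _ n] n_def)
        also have "\<dots> = (p x * C x) * (q x * (p' x * (C' x * q' x)))"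
          using c by (intro assoc_mult_mat[of _ n "\<beta> k" _ n _ n]) (auto simp: n_def)
        also have "q x * (p' x * (C' x * q' x)) = (q x * p' x) * (C' x * q' x)"
          using c by (intro assoc_mult_mat[symmetric, of _ "\<beta> k" n _ "\<beta> j'" _ n]) (auto simp: n_def)
        also have "p x * C x * (q x * p' x * (C' x * q' x)) = p x * (C x * (q x * p' x * (C' x * q' x)))"
          using c by (intro assoc_mult_mat[of _ n "\<beta> j" _ "\<beta> k" _ n]) (auto simp: n_def)
        also have "C x * (q x * p' x * (C' x * q' x)) = (C x * (q x * p' x)) * (C' x * q' x)"
          using c by (intro assoc_mult_mat[symmetric, of _ "\<beta> j" "\<beta> k" _ "\<beta> j'" _ n]) (auto simp: n_def)
        also have "\<dots> = (C x * (q x * p' x)) * C' x * q' x"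
          using c by (intro assoc_mult_mat[symmetric, of _ "\<beta> j" "\<beta> j'" _ "\<beta> k'" _ n]) (auto simp: n_def)
        also have "p x * \<dots> = p x * (C x * (q x * p' x) * C' x) * q' x"
          using c by (intro assoc_mult_mat[symmetric, of _ n "\<beta> j" _ "\<beta> k'" _ n]) (auto simp: n_def)
        finally show ?thesis .
      qed
      moreover have "S.entries_mem (\<beta> j) (\<beta> k') (\<lambda>x. C x * (q x * p' x) * C' x)"
        by (intro S.entries_mult[OF S.entries_mult[OF M'(5) path_entries[OF path_fun.comp[OF M'(4) N'(3)]]] N'(5)]
            M' N')
      ultimately show ?thesis unfolding Mat_def using M' N' by blast
    qed
  qed
  have trace: "(\<lambda>x\<in>Z. mat_trace (M x)) \<in> S" if M: "M \<in> Mat" for M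
    using M
  proof (rule Mat_cases)
    fix p assume p: "path_fun Q \<beta> i i p" and eq: "\<And>x. x \<in> Z \<Longrightarrow> M x = p x"
    have "(\<lambda>x\<in>Z. mat_trace (p x)) \<in> S" by (rule gen_S[OF vertex_gens_trace[OF p]])
    then show ?thesis using eq by (simp cong: restrict_cong)
  next
    fix j k p q C
    assume M': "j \<in> R" "k \<in> R" "path_fun Q \<beta> i j p" "path_fun Q \<beta> k i q"
      "S.entries_mem (\<beta> j) (\<beta> k) C" and M_eq: "\<And>x. x \<in> Z \<Longrightarrow> M x = p x * C x * q x"
    have eq: "mat_trace (M x) = mat_trace (C x * (q x * p x))" if x: "x \<in> Z" for x
    proof -
      have C: "C x \<in> carrier_mat (\<beta> j) (\<beta> k)" using M'(5) x by (simp add: S.entries_mem_def)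
      note c = path_carrier[OF M'(3) x] path_carrier[OF M'(4) x] C
      have "M x = p x * (C x * q x)"
        using c by (simp add: M_eq[OF x] assoc_mult_mat[of _ n "\<beta> j" _ "\<beta> k" _ n] n_def)
      also have "mat_trace \<dots> = mat_trace (C x * q x * p x)"
        using c by (intro mat_trace_mult_commute[of _ "\<beta> i" "\<beta> j"]) auto
      also have "C x * q x * p x = C x * (q x * p x)"
        using c by (intro assoc_mult_mat) auto
      finally show ?thesis .
    qed
    have mem: "(\<lambda>x\<in>Z. mat_trace (C x * (q x * p x))) \<in> S"
      by (intro S.entries_trace[OF S.entries_mult[OF M'(5) path_entries[OF path_fun.comp[OF M'(4,3)] M'(2,1)]]])
    show ?thesis by (rule iffD2[OF S.mem_cong mem]) (rule eq)
  qed
  have equivariant: "M (vertex_act i h x) * h = h * M x"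
    if M: "M \<in> Mat" and h: "h \<in> carrier_mat n n" "det h \<noteq> 0" and x: "x \<in> Z" for M h x
    using M
  proof (rule Mat_cases)
    note mem = vertex_act_mem[OF h[unfolded n_def] x]
    fix p assume p: "path_fun Q \<beta> i i p" and eq: "\<And>x. x \<in> Z \<Longrightarrow> M x = p x"
    then show ?thesis using vertex_act_path[OF p h[unfolded n_def] x] mem x by simp
  next
    note mem = vertex_act_mem[OF h[unfolded n_def] x]
    fix j k p q C
    assume M': "j \<in> R" "k \<in> R" "path_fun Q \<beta> i j p" "path_fun Q \<beta> k i q"
      "S.entries_mem (\<beta> j) (\<beta> k) C" and M_eq: "\<And>x. x \<in> Z \<Longrightarrow> M x = p x * C x * q x"
    let ?x = "vertex_act i h x"
    have C: "C y \<in> carrier_mat (\<beta> j) (\<beta> k)" if "y \<in> Z" for y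
      using M'(5) that by (simp add: S.entries_mem_def)
    note c = path_carrier[OF M'(3) x] path_carrier[OF M'(4) x] C[OF x]
      path_carrier[OF M'(3) mem] path_carrier[OF M'(4) mem] C[OF mem]
    have "i \<noteq> j" "i \<noteq> k" using i M' by auto
    then have p: "p ?x = h * p x" and q: "q ?x * h = q x"
      using vertex_act_path[OF M'(3) h[unfolded n_def] x] vertex_act_path[OF M'(4) h[unfolded n_def] x] c
      by simp_all
    have "C ?x = C x"
    proof (rule eq_matI)
      fix r s assume "r < dim_row (C x)" "s < dim_col (C x)"
      then have "(\<lambda>x\<in>Z. C x $$ (r, s)) \<in> S" using M'(5) c by (auto simp: S.entries_mem_def)
      from S_inv[OF this h x] show "C ?x $$ (r, s) = C x $$ (r, s)" using mem x by simp
    qed (use c in auto)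
    then have "M ?x * h = (h * p x) * C x * q ?x * h" by (simp add: M_eq[OF mem] p)
    also have "\<dots> = (h * p x) * C x * (q ?x * h)"
      using c h by (intro assoc_mult_mat[of _ n "\<beta> k" _ n _ n]) (auto simp: n_def)
    also have "\<dots> = h * (p x * C x * q x)"
      using c h by (simp add: q assoc_mult_mat[of _ n n _ "\<beta> j" _ "\<beta> k"]
              assoc_mult_mat[of _ n n _ "\<beta> k" _ n] n_def)
    finally show ?thesis by (simp add: M_eq[OF x])
  qed
  define EM where "EM = {\<lambda>x. M x $$ (r, c) | M r c. M \<in> Mat \<and> r < n \<and> c < n}"
  define B where "B = generated_algebra Z (S \<union> EM)"
  interpret B: function_algebra Z B unfolding B_def by (rule function_algebra_generated)
  have SB: "g \<in> S \<Longrightarrow> g \<in> B" for g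
    using generated_algebra.gen[of g "S \<union> EM" Z] generated_restrict[of g] by (simp add: B_def S_def)
  have EMB: "(\<lambda>x\<in>Z. M x $$ (r, c)) \<in> B" if "M \<in> Mat" "r < n" "c < n" for M r c
    unfolding B_def by (rule generated_algebra.gen) (use that in \<open>auto simp: EM_def\<close>)
  \<comment> \<open>The integer tag is the weight under a scalar \<open>t\<close> at
    \<open>i\<close>: a path ending at \<open>i\<close> is multiplied by \<open>t\<close>, one
    starting at \<open>i\<close> by the inverse of \<open>t\<close>.\<close>
  define V where "V = {(1 :: int, \<lambda>x. p x $$ (r, c)) | p k r c.
    k \<in> R \<and> path_fun Q \<beta> i k p \<and> r < n \<and> c < \<beta> k}"
  define W where "W = {(- 1 :: int, \<lambda>x. p x $$ (r, c)) | p k r c.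
    k \<in> R \<and> path_fun Q \<beta> k i p \<and> r < \<beta> k \<and> c < n}"
  have "f \<in> generated_algebra Z (B \<union> snd ` (V \<union> W))"
  proof -
    let ?BVW = "generated_algebra Z (B \<union> snd ` (V \<union> W))"
    interpret G: function_algebra Z "?BVW"
      by (rule function_algebra_generated)
    have BG: "restrict g Z \<in> ?BVW" if "restrict g Z \<in> B" for g
      using generated_algebra.gen[of "restrict g Z" "B \<union> snd ` (V \<union> W)" Z] that by simp
    have "restrict g Z \<in> ?BVW" if g: "g \<in> vertex_gens (insert i R)" for g
    proof -
      consider "g \<in> vertex_gens R" | p r c where "g = (\<lambda>x. p x $$ (r, c))" "path_fun Q \<beta> i i p" "r < n" "c < n"
        | "g \<in> snd ` (V \<union> W)"
      proof -
        consider (entry) p j k r c where "g = (\<lambda>x. p x $$ (r, c))" "j \<in> insert i R" "k \<in> insert i R"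
            "path_fun Q \<beta> j k p" "r < \<beta> j" "c < \<beta> k"
          | (trace) p j where "g = (\<lambda>x. mat_trace (p x))" "path_fun Q \<beta> j j p"
          using g unfolding vertex_gens_def by blast
        then show thesis
        proof cases
          case entry
          show ?thesis
          proof (cases "j = i"; cases "k = i")
            assume "j = i" "k = i"
            then show ?thesis using entry that(2) by (simp add: n_def)
          next
            assume "j = i" "k \<noteq> i"
            then have "(1, g) \<in> V" using entry unfolding V_def n_def by blast
            then show ?thesis by (intro that(3)) force
          next
            assume "j \<noteq> i" "k = i"
            then have "(- 1, g) \<in> W" using entry unfolding W_def n_def by blast
            then show ?thesis by (intro that(3)) force
          next
            assume "j \<noteq> i" "k \<noteq> i"
            then show ?thesis using entry by (intro that(1)) (auto intro: vertex_gens_entry)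
          qed
        next
          case trace
          then show ?thesis using vertex_gens_trace that(1) by blast
        qed
      qed
      then show ?thesis
      proof cases
        case 1
        then show ?thesis using gen_S SB BG by blast
      next
        case 2
        then have "p \<in> Mat" by (auto simp: Mat_def)
        then show ?thesis using EMB[of p r c] 2 BG by blast
      next
        case 3
        then show ?thesis by (intro generated_algebra.gen) auto
      qed
    qed
    then show ?thesis using G.generated_subset f by blast
  qed
  from B.generated_monomials[OF this] obtain js where
    js: "\<And>h es. (h, es) \<in> set js \<Longrightarrow> h \<in> B \<and> set es \<subseteq> V \<union> W"
    and f_eq: "\<And>x. x \<in> Z \<Longrightarrow> f x = (\<Sum>(h, es)\<leftarrow>js. h x * (\<Prod>e\<leftarrow>es. snd e x))"
    by (force simp: case_prod_unfold)
  define tor where "tor t = t \<cdot>\<^sub>m 1\<^sub>m n" for t :: complex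
  have tor: "tor t \<in> carrier_mat n n" "det (tor t) \<noteq> 0" if "t \<noteq> 0" for t
    using that by (simp_all add: tor_def)
  have tor_mem: "vertex_act i (tor t) x \<in> Z" if "t \<noteq> 0" "x \<in> Z" for t x
    using vertex_act_mem[of "tor t" i x] tor[OF that(1)] that(2) by (simp add: n_def)
  have B_inv: "g (vertex_act i (tor t) x) = g x" if "g \<in> B" and t: "t \<noteq> 0" and x: "x \<in> Z" for g t x
    using that(1) unfolding B_def
  proof induction
    case (gen g)
    then consider "g \<in> S" | M r c where "g = (\<lambda>x. M x $$ (r, c))" "M \<in> Mat" "r < n" "c < n"
      by (auto simp: EM_def)
    then show ?case
    proof cases
      case 1
      then show ?thesis using S_inv[OF 1 tor[OF t] x] tor_mem[OF t x] x by simp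
    next
      case 2
      have "t \<cdot>\<^sub>m M (vertex_act i (tor t) x) = t \<cdot>\<^sub>m M x"
        using equivariant[OF 2(2) tor[OF t] x] Mat_carrier[OF 2(2) x] Mat_carrier[OF 2(2) tor_mem[OF t x]]
        by (simp add: tor_def mult_smult_distrib[of _ n n _ n] mult_smult_assoc_mat[of _ n n _ n])
      then have "(t \<cdot>\<^sub>m M (vertex_act i (tor t) x)) $$ (r, c) = (t \<cdot>\<^sub>m M x) $$ (r, c)" by simp
      then show ?thesis
        using Mat_carrier[OF 2(2) x] Mat_carrier[OF 2(2) tor_mem[OF t x]] 2 t x tor_mem[OF t x] by simp
    qed
  qed (use x tor_mem[OF t x] in simp_all)
  have VW_weight: "snd e (vertex_act i (tor t) x) = t powi fst e * snd e x"
    if e: "e \<in> V \<union> W" and t: "t \<noteq> 0" and x: "x \<in> Z" for e t x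
    using e
  proof
    assume "e \<in> V"
    then obtain p k r c where p: "e = (1, \<lambda>x. p x $$ (r, c))" "k \<in> R" "path_fun Q \<beta> i k p" "r < n" "c < \<beta> k"
      by (auto simp: V_def)
    have "p (vertex_act i (tor t) x) = t \<cdot>\<^sub>m p x"
    proof -
      have "k \<noteq> i" using p(2) i(1) by auto
      then have "p (vertex_act i (tor t) x) = tor t * p x"
        using vertex_act_path[OF p(3) tor[OF t, unfolded n_def] x] path_carrier[OF p(3) tor_mem[OF t x]]
        by simp
      then show ?thesis
        using path_carrier[OF p(3) x] by (simp add: tor_def n_def mult_smult_assoc_mat[of _ n n _ "\<beta> k"])
    qed
    then show ?thesis using p path_carrier[OF p(3) x] by (simp add: n_def)
  next
    assume "e \<in> W"
    then obtain p k r c where p: "e = (- 1, \<lambda>x. p x $$ (r, c))" "k \<in> R" "path_fun Q \<beta> k i p" "r < \<beta> k" "c < n"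
      by (auto simp: W_def)
    have "t \<cdot>\<^sub>m p (vertex_act i (tor t) x) = p x"
    proof -
      have "k \<noteq> i" using p(2) i(1) by auto
      then have "p (vertex_act i (tor t) x) * tor t = p x"
        using vertex_act_path[OF p(3) tor[OF t, unfolded n_def] x] path_carrier[OF p(3) x]
        by simp
      then show ?thesis
        using path_carrier[OF p(3) tor_mem[OF t x]] by (simp add: tor_def n_def mult_smult_distrib[of _ "\<beta> k" n _ n])
    qed
    from arg_cong[OF this, of "\<lambda>A. A $$ (r, c)"]
    have "p x $$ (r, c) = t * p (vertex_act i (tor t) x) $$ (r, c)"
      using p path_carrier[OF p(3) tor_mem[OF t x]] by (simp add: n_def)
    then show ?thesis using p t by (simp add: power_int_minus field_simps)
  qed
  define wt where "wt = (\<lambda>p :: (('e \<Rightarrow> complex mat) \<Rightarrow> complex) \<times> (int \<times> (('e \<Rightarrow> complex mat) \<Rightarrow> complex)) list. \<Sum>e\<leftarrow>snd p. fst e)"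
  \<comment> \<open>Elements of \<open>B\<close> are invariant under scalars at \<open>i\<close>, so
    \<open>f\<close> along such an orbit is a Laurent polynomial in \<open>t\<close>. By invariance
    of \<open>f\<close> it is constant, hence equal to its part of weight 0.\<close>
  have f_eq0: "f x = (\<Sum>p\<leftarrow>filter (\<lambda>p. wt p = 0) js. fst p x * (\<Prod>e\<leftarrow>snd p. snd e x))" if x: "x \<in> Z" for x
  proof (rule laurent_constant_term[symmetric])
    fix t :: complex assume t: "t \<noteq> 0"
    have es: "(\<Prod>e\<leftarrow>es. snd e (vertex_act i (tor t) x)) = (\<Prod>e\<leftarrow>es. snd e x) * t powi (\<Sum>e\<leftarrow>es. fst e)"
      if "set es \<subseteq> V \<union> W" for es
      using that t by (induction es) (simp_all add: VW_weight[OF _ t x] power_int_add)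
    have "(\<Sum>p\<leftarrow>js. fst p x * (\<Prod>e\<leftarrow>snd p. snd e x) * t powi wt p) =
        (\<Sum>(h, es)\<leftarrow>js. h (vertex_act i (tor t) x) * (\<Prod>e\<leftarrow>es. snd e (vertex_act i (tor t) x)))"
    proof (intro arg_cong[of _ _ sum_list] map_cong refl)
      fix p assume p: "p \<in> set js"
      obtain h e where he: "p = (h, e)" by (cases p)
      then have "h \<in> B" and e: "set e \<subseteq> V \<union> W" using js p by auto
      then have "h (vertex_act i (tor t) x) = h x" using B_inv[OF _ t x] by blast
      then show "fst p x * (\<Prod>e\<leftarrow>snd p. snd e x) * t powi wt p =
          (case p of (h, es) \<Rightarrow> h (vertex_act i (tor t) x) * (\<Prod>e\<leftarrow>es. snd e (vertex_act i (tor t) x)))"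
        using es[OF e] by (simp add: he wt_def)
    qed
    also have "\<dots> = f x"
      using f_eq[OF tor_mem[OF t x]] f_inv[of "tor t" x] tor[OF t] x by (simp add: n_def)
    finally show "(\<Sum>p\<leftarrow>js. fst p x * (\<Prod>e\<leftarrow>snd p. snd e x) * t powi wt p) = f x" .
  qed
  have pair: "(\<lambda>x\<in>Z. snd v x * snd w x) \<in> B" if vw: "v \<in> V" "w \<in> W" for v w
  proof -
    obtain p k a c where p: "v = (1, \<lambda>x. p x $$ (a, c))" "k \<in> R" "path_fun Q \<beta> i k p" "a < n" "c < \<beta> k"
      using vw(1) by (auto simp: V_def)
    obtain q l r b where q: "w = (- 1, \<lambda>x. q x $$ (r, b))" "l \<in> R" "path_fun Q \<beta> l i q" "r < \<beta> l" "b < n"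
      using vw(2) by (auto simp: W_def)
    \<comment> \<open>The elementary matrix with its 1 at \<open>(c, r)\<close>: entry
      \<open>(a, b)\<close> of \<open>p * C * q\<close> is then entry \<open>(a, c)\<close> of
      \<open>p\<close> times entry \<open>(r, b)\<close> of \<open>q\<close>.\<close>
    define C where "C = mat (\<beta> k) (\<beta> l) (\<lambda>(y, z). if y = c \<and> z = r then 1 else 0 :: complex)"
    have "S.entries_mem (\<beta> k) (\<beta> l) (\<lambda>x. C)"
      using S.const_mem by (auto simp: S.entries_mem_def C_def)
    then have "(\<lambda>x. p x * C * q x) \<in> Mat" unfolding Mat_def using p q by blast
    then have mem: "(\<lambda>x\<in>Z. (p x * C * q x) $$ (a, b)) \<in> B" using p(4) q(5) by (rule EMB)
    have eq: "snd v x * snd w x = (p x * C * q x) $$ (a, b)" if x: "x \<in> Z" for x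
    proof -
      note cc = path_carrier[OF p(3) x, folded n_def] path_carrier[OF q(3) x, folded n_def]
      have C: "C \<in> carrier_mat (\<beta> k) (\<beta> l)" by (simp add: C_def)
      have pC: "(p x * C) $$ (a, z) = (if z = r then p x $$ (a, c) else 0)" if "z < \<beta> l" for z
      proof -
        have "(p x * C) $$ (a, z) = (\<Sum>y<\<beta> k. p x $$ (a, y) * C $$ (y, z))"
          by (rule index_mult_mat_sum[OF cc(1) C p(4) that])
        also have "\<dots> = (\<Sum>y<\<beta> k. if y = c then (if z = r then p x $$ (a, c) else 0) else 0)"
          using that by (intro sum.cong) (auto simp: C_def)
        finally show ?thesis using p(5) by simp
      qed
      have "(p x * C * q x) $$ (a, b) = (\<Sum>z<\<beta> l. (p x * C) $$ (a, z) * q x $$ (z, b))"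
        using cc C p q by (intro index_mult_mat_sum[of _ n "\<beta> l" _ n]) auto
      also have "\<dots> = (\<Sum>z<\<beta> l. if z = r then p x $$ (a, c) * q x $$ (r, b) else 0)"
        by (intro sum.cong) (auto simp: pC)
      finally show ?thesis using p q by simp
    qed
    show ?thesis by (rule iffD2[OF B.mem_cong mem]) (rule eq)
  qed
  have balanced: "(\<lambda>x\<in>Z. \<Prod>e\<leftarrow>es. snd e x) \<in> B" if es: "set es \<subseteq> V \<union> W" "(\<Sum>e\<leftarrow>es. fst e) = 0" for es
  proof -
    let ?vs = "filter (\<lambda>e. fst e = 1) es" and ?ws = "filter (\<lambda>e. fst e \<noteq> 1) es"
    have fst_VW: "fst e = 1 \<longleftrightarrow> e \<in> V" "fst e \<noteq> 1 \<longleftrightarrow> e \<in> W" "e \<in> W \<Longrightarrow> fst e = - 1" if "e \<in> V \<union> W" for e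
      using that by (auto simp: V_def W_def)
    have "(\<Sum>e\<leftarrow>es. fst e) = int (length ?vs) - int (length ?ws)"
    proof -
      have "fst e = 1 \<or> fst e = - 1" if "e \<in> set es" for e
        using fst_VW[of e] es(1) that by auto
      then show ?thesis by (induction es) force+
    qed
    then have len: "length ?vs = length ?ws" using es(2) by simp
    have sub: "set ?vs \<subseteq> V" "set ?ws \<subseteq> W" using es(1) fst_VW(1,2) by auto
    have "(\<lambda>x\<in>Z. (\<Prod>e\<leftarrow>vs. snd e x) * (\<Prod>e\<leftarrow>ws. snd e x)) \<in> B"
      if "length vs = length ws" "set vs \<subseteq> V" "set ws \<subseteq> W" for vs ws
      using that
    proof (induction vs ws rule: list_induct2)
      case Nil
      show ?case by (rule iffD2[OF B.mem_cong B.const_mem[of 1]]) simp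
    next
      case (Cons v vs w ws)
      have "v \<in> V" "w \<in> W" "set vs \<subseteq> V" "set ws \<subseteq> W" using Cons.prems by auto
      note mem = B.mult_mem[OF pair[OF this(1,2)] Cons.IH[OF this(3,4)]]
      show ?case by (rule iffD2[OF B.mem_cong mem]) (simp add: mult_ac)
    qed
    from this[OF len sub] have mem: "(\<lambda>x\<in>Z. (\<Prod>e\<leftarrow>?vs. snd e x) * (\<Prod>e\<leftarrow>?ws. snd e x)) \<in> B" .
    have "(\<Prod>e\<leftarrow>es. snd e x) = (\<Prod>e\<leftarrow>?vs. snd e x) * (\<Prod>e\<leftarrow>?ws. snd e x)" for x
      by (induction es) (auto simp: mult_ac)
    then show ?thesis by (rule iffD2[OF B.mem_cong mem])
  qed
  have mem: "(\<lambda>x\<in>Z. \<Sum>p\<leftarrow>filter (\<lambda>p. wt p = 0) js. fst p x * (\<Prod>e\<leftarrow>snd p. snd e x)) \<in> B"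
  proof (rule B.sum_list_mem)
    fix p assume p: "p \<in> set (filter (\<lambda>p. wt p = 0) js)"
    then have "fst p \<in> B" "set (snd p) \<subseteq> V \<union> W" using js[of "fst p" "snd p"] by auto
    then show "(\<lambda>x\<in>Z. fst p x * (\<Prod>e\<leftarrow>snd p. snd e x)) \<in> B"
      using p by (intro B.mult_mem B.restrict_mem balanced) (auto simp: wt_def)
  qed
  have "restrict f Z \<in> B" by (rule iffD2[OF B.mem_cong mem]) (rule f_eq0)
  then have f_gen: "f \<in> generated_algebra Z (S \<union> EM)" using generated_restrict[OF f] by (simp add: B_def)
  have "f \<in> S"
  proof (rule S.matrix_invariants[of n Mat "vertex_act i" f])
    show "f \<in> generated_algebra Z (S \<union> {\<lambda>x. M x $$ (r, c) | M r c. M \<in> Mat \<and> r < n \<and> c < n})"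
      using f_gen by (simp only: EM_def)
    show "n > 0" using False by (simp add: n_def)
    show "M x \<in> carrier_mat n n" if "M \<in> Mat" "x \<in> Z" for M x
      by (rule Mat_carrier[OF that])
    show "(\<lambda>x. 1\<^sub>m n) \<in> Mat" by (rule one)
    show "(\<lambda>x. M x * N x) \<in> Mat" if "M \<in> Mat" "N \<in> Mat" for M N
      by (rule mult[OF that])
    show "(\<lambda>x\<in>Z. mat_trace (M x)) \<in> S" if "M \<in> Mat" for M
      by (rule trace[OF that])
    show "M (vertex_act i h x) * h = h * M x"
      if "M \<in> Mat" "h \<in> carrier_mat n n" "det h \<noteq> 0" "x \<in> Z" for M h x
      by (rule equivariant[OF that])
    show "g (vertex_act i h x) = g x"
      if "g \<in> S" "h \<in> carrier_mat n n" "det h \<noteq> 0" "x \<in> Z" for g h x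
      by (rule S_inv[OF that])
    fix h :: "complex mat" and x
    assume h: "h \<in> carrier_mat n n" "det h \<noteq> 0" and x: "x \<in> Z"
    show "vertex_act i h x \<in> Z" by (rule vertex_act_mem[OF h[unfolded n_def] x])
    show "f (vertex_act i h x) = f x" by (rule f_inv[OF h[unfolded n_def] x])
  qed
  then show ?thesis by (simp add: S_def)
qed

text \<open>Coordinates are entries of paths of length one, so \<open>f\<close> starts in the
  algebra belonging to all vertices. Each elimination uses invariance under a single factor of the
  group.\<close>

theorem invariants_generated_by_traces:
  assumes f: "f \<in> generated_algebra Z (coordinate_functions Q \<beta>)"
    and f_inv: "\<And>g x. g \<in> carrier (GL_prod Q \<beta>) \<Longrightarrow> x \<in> Z \<Longrightarrow> f (rep_act Q \<beta> g x) = f x"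
  shows "f \<in> generated_algebra Z {\<lambda>x. mat_trace (p x) | p i. path_fun Q \<beta> i i p}"
proof -
  have "f \<in> generated_algebra Z (vertex_gens {})" if "f \<in> generated_algebra Z (vertex_gens R)" "finite R" "R \<subseteq> verts Q" for R
    using that(2,1,3)
  proof (induction R rule: finite_induct)
    case (insert i R)
    have "f \<in> generated_algebra Z (vertex_gens R)"
    proof (rule eliminate_vertex[OF insert.prems(1) insert.hyps(2)])
      show "i \<in> verts Q" using insert.prems(2) by simp
      fix h :: "complex mat" and x
      assume h: "h \<in> carrier_mat (\<beta> i) (\<beta> i)" "det h \<noteq> 0" and x: "x \<in> Z"
      show "f (vertex_act i h x) = f x"
        unfolding vertex_act_def by (rule f_inv[OF vertex_GL_prod[OF h] x])
    qed
    then show ?case using insert.IH insert.prems(2) by simp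
  qed
  moreover have "f \<in> generated_algebra Z (vertex_gens (verts Q))"
  proof -
    interpret G: function_algebra Z "generated_algebra Z (vertex_gens (verts Q))"
      by (rule function_algebra_generated)
    have "coordinate_functions Q \<beta> \<subseteq> vertex_gens (verts Q)"
    proof
      fix g assume "g \<in> coordinate_functions Q \<beta>"
      then obtain a r c where "g = (\<lambda>x. x a $$ (r, c))" "a \<in> arcs Q" "r < \<beta> (head Q a)" "c < \<beta> (tail Q a)"
        by (auto simp: coordinate_functions_def)
      then show "g \<in> vertex_gens (verts Q)"
        using path_fun.arrow[of a Q \<beta>] wf by (auto simp: vertex_gens_def wf_digraph_def)
    qed
    then show ?thesis using G.generated_subset f by (blast intro: generated_algebra.gen)
  qed
  moreover have "vertex_gens {} = {\<lambda>x. mat_trace (p x) | p i. path_fun Q \<beta> i i p}"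
    by (auto simp: vertex_gens_def)
  ultimately show ?thesis using finite_verts by auto
qed

end

section \<open>Words in the framed cyclic quiver\<close>

lemma mat_trace_add:
  "A \<in> carrier_mat n n \<Longrightarrow> B \<in> carrier_mat n n \<Longrightarrow> mat_trace (A + B) = mat_trace A + mat_trace B"
  by (simp add: mat_trace_def sum.distrib)

lemma mat_trace_minus:
  "A \<in> carrier_mat n n \<Longrightarrow> B \<in> carrier_mat n n \<Longrightarrow> mat_trace (A - B) = mat_trace A - mat_trace B"
  by (auto simp: mat_trace_def sum_subtractf[symmetric] intro!: sum.cong)

lemma mat_trace_smult: "A \<in> carrier_mat n n \<Longrightarrow> mat_trace (c \<cdot>\<^sub>m A) = c * mat_trace A"
  by (simp add: mat_trace_def sum_distrib_left)

lemma mat_trace_1: "A \<in> carrier_mat 1 1 \<Longrightarrow> mat_trace A = A $$ (0, 0)"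
  by (simp add: mat_trace_def)

datatype letter = LX | LY

text \<open>Bubble sort with the exchange of adjacent letters as an abstract step. \<open>P\<close>
  depends only on the multiset of letters and so holds at every intermediate word; it will carry the
  length and the closedness that make an exchange available.\<close>

lemma sort_letters:
  fixes R :: "letter list \<Rightarrow> letter list \<Rightarrow> bool"
  assumes refl: "\<And>L. R L L" and trans: "\<And>L L' L''. R L L' \<Longrightarrow> R L' L'' \<Longrightarrow> R L L''"
    and step: "\<And>L1 L2. P (L1 @ [LX, LY] @ L2) \<Longrightarrow> R (L1 @ [LX, LY] @ L2) (L1 @ [LY, LX] @ L2)"
    and P: "\<And>L L'. mset L = mset L' \<Longrightarrow> P L \<Longrightarrow> P L'" and "P L"
  shows "R L (replicate (count_list L LY) LY @ replicate (count_list L LX) LX)"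
proof -
  have push: "R (L0 @ LX # replicate q LY @ L1) (L0 @ replicate q LY @ LX # L1)"
    if "P (L0 @ LX # replicate q LY @ L1)" for L0 q L1
    using that
  proof (induction q arbitrary: L0)
    case (Suc q)
    have "R (L0 @ [LX, LY] @ replicate q LY @ L1) (L0 @ [LY, LX] @ replicate q LY @ L1)"
      using Suc.prems by (intro step) simp
    moreover have "P ((L0 @ [LY]) @ LX # replicate q LY @ L1)"
      by (rule P[OF _ Suc.prems]) simp
    from Suc.IH[OF this] have "R (L0 @ [LY, LX] @ replicate q LY @ L1) (L0 @ replicate (Suc q) LY @ LX # L1)"
      by simp
    ultimately have "R (L0 @ [LX, LY] @ replicate q LY @ L1) (L0 @ replicate (Suc q) LY @ LX # L1)"
      by (rule trans)
    then show ?case by simp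
  qed (simp add: refl)
  \<comment> \<open>The prefix \<open>L0\<close> has to be carried along, since \<open>R\<close> is
    not assumed to be compatible with putting letters in front.\<close>
  have "R (L0 @ L) (L0 @ replicate (count_list L LY) LY @ replicate (count_list L LX) LX)"
    if "P (L0 @ L)" for L0
    using that
  proof (induction L arbitrary: L0)
    case (Cons l L)
    let ?nf = "replicate (count_list L LY) LY @ replicate (count_list L LX) LX"
    have IH: "R (L0 @ l # L) (L0 @ l # ?nf)"
      using Cons.IH[of "L0 @ [l]"] Cons.prems by simp
    show ?case
    proof (cases l)
      case LY
      then show ?thesis using IH by simp
    next
      case LX
      have "mset L = mset ?nf"
      proof (rule multiset_eqI)
        fix x show "count (mset L) x = count (mset ?nf) x"
          by (cases x) (simp_all add: count_mset count_list_eq_length_filter)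
      qed
      then have "P (L0 @ LX # ?nf)" by (intro P[OF _ Cons.prems]) (simp add: LX)
      then have "R (L0 @ LX # ?nf) (L0 @ replicate (count_list L LY) LY @ LX # replicate (count_list L LX) LX)"
        by (rule push)
      from trans[OF IH[unfolded LX] this] show ?thesis by (simp add: LX)
    qed
  qed (simp add: refl)
  from this[of "[]"] show ?thesis using \<open>P L\<close> by simp
qed

locale framed_rep =
  fixes m :: nat and lam :: "nat \<Rightarrow> complex" and \<alpha> :: "nat \<Rightarrow> nat"
  assumes m: "m \<ge> 1"
begin

abbreviation Z :: "point set" where
  "Z \<equiv> Rep_Pi (framed_quiver m) (framed_par m lam \<alpha>) (framed_dim m \<alpha>)"

text \<open>A word is read from right to left, starting at a vertex \<open>b\<close> of the cyclic quiver.\<close>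

definition target :: "letter \<Rightarrow> nat \<Rightarrow> nat" where
  "target l i = (case l of LY \<Rightarrow> (i + 1) mod m | LX \<Rightarrow> (i + (m - 1)) mod m)"

text \<open>\<open>X_map x j\<close> leads from \<open>j + 1\<close> to \<open>j\<close>, so the
  letter \<open>LX\<close> read at \<open>i\<close> is the map with index \<open>i - 1\<close>.
  Adding \<open>m - 1\<close> expresses this predecessor modulo \<open>m\<close> within the natural
  numbers.\<close>

definition lmat :: "letter \<Rightarrow> nat \<Rightarrow> point \<Rightarrow> complex mat" where
  "lmat l i x = (case l of LY \<Rightarrow> Y_map x i | LX \<Rightarrow> X_map x ((i + (m - 1)) mod m))"

fun endpt :: "nat \<Rightarrow> letter list \<Rightarrow> nat" where
  "endpt b [] = b"
| "endpt b (l # L) = target l (endpt b L)"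

fun wmat :: "nat \<Rightarrow> letter list \<Rightarrow> point \<Rightarrow> complex mat" where
  "wmat b [] x = 1\<^sub>m (\<alpha> b)"
| "wmat b (l # L) x = lmat l (endpt b L) x * wmat b L x"

lemma target_less: "target l i < m"
  using m by (cases l) (auto simp: target_def)

lemma endpt_less: "b < m \<Longrightarrow> endpt b L < m"
  by (cases L) (auto simp: target_less)

lemma endpt_append: "endpt b (L1 @ L2) = endpt (endpt b L2) L1"
  by (induction L1) auto

lemma endpt_eq: "b < m \<Longrightarrow> endpt b L = (b + (count_list L LY + (m - 1) * count_list L LX)) mod m"
proof (induction L)
  case (Cons l L)
  let ?k = "b + (count_list L LY + (m - 1) * count_list L LX)"
  have "endpt b (l # L) = target l (?k mod m)" using Cons by simp
  also have "\<dots> = (?k + (case l of LY \<Rightarrow> 1 | LX \<Rightarrow> m - 1)) mod m"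
    by (cases l) (simp_all only: target_def letter.case mod_add_left_eq)
  also have "?k + (case l of LY \<Rightarrow> 1 | LX \<Rightarrow> m - 1) =
      b + (count_list (l # L) LY + (m - 1) * count_list (l # L) LX)"
    by (cases l) simp_all
  finally show ?case .
qed simp

text \<open>Since \<open>m - 1\<close> is -1 modulo \<open>m\<close>, the two letters occur equally
  often modulo \<open>m\<close>. Neither the starting vertex nor the order of the letters enters, so
  the condition survives rotation and sorting.\<close>

definition closed_word :: "letter list \<Rightarrow> bool" where
  "closed_word L \<longleftrightarrow> m dvd count_list L LY + (m - 1) * count_list L LX"

lemma endpt_closed: "b < m \<Longrightarrow> endpt b L = b \<longleftrightarrow> closed_word L"
proof -
  assume b: "b < m"
  let ?k = "count_list L LY + (m - 1) * count_list L LX"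
  have "(b + ?k) mod m = b \<longleftrightarrow> (b + ?k) mod m = (b + 0) mod m" using b by simp
  also have "\<dots> \<longleftrightarrow> m dvd ?k"
    using mod_eq_dvd_iff_nat[of b "b + ?k" m] by simp
  finally show ?thesis using b by (simp add: endpt_eq closed_word_def)
qed

lemma closed_word_mset: "mset L = mset L' \<Longrightarrow> closed_word L = closed_word L'"
  unfolding closed_word_def using count_mset by metis

lemma Z_carrier:
  assumes "x \<in> Z"
  shows "i < m \<Longrightarrow> X_map x i \<in> carrier_mat (\<alpha> i) (\<alpha> ((i + 1) mod m))"
    "i < m \<Longrightarrow> Y_map x i \<in> carrier_mat (\<alpha> ((i + 1) mod m)) (\<alpha> i)"
    "v_map x \<in> carrier_mat (\<alpha> 0) 1" "w_map x \<in> carrier_mat 1 (\<alpha> 0)"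
  using assms unfolding Rep_Pi_framed_iff[OF m] by blast+

lemma succ_pred_mod: "i < m \<Longrightarrow> ((i + (m - 1)) mod m + 1) mod m = i"
  using m by (simp only: mod_add_left_eq) simp

lemma pred_succ_mod: "i < m \<Longrightarrow> ((i + 1) mod m + (m - 1)) mod m = i"
  using m by (simp only: mod_add_left_eq) simp

lemma lmat_carrier:
  assumes x: "x \<in> Z" and i: "i < m"
  shows "lmat l i x \<in> carrier_mat (\<alpha> (target l i)) (\<alpha> i)"
proof (cases l)
  case LX
  have "(i + (m - 1)) mod m < m" using m by simp
  from Z_carrier(1)[OF x this] show ?thesis
    unfolding succ_pred_mod[OF i] by (simp add: LX lmat_def target_def)
next
  case LY
  then show ?thesis using Z_carrier(2)[OF x i] by (simp add: lmat_def target_def)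
qed

lemma wmat_carrier: "x \<in> Z \<Longrightarrow> b < m \<Longrightarrow> wmat b L x \<in> carrier_mat (\<alpha> (endpt b L)) (\<alpha> b)"
proof (induction L)
  case (Cons l L)
  then show ?case
    by (simp add: mult_carrier_mat[OF lmat_carrier[OF Cons.prems(1) endpt_less[OF Cons.prems(2)]]])
qed simp

lemma wmat_append:
  assumes x: "x \<in> Z" and b: "b < m"
  shows "wmat b (L1 @ L2) x = wmat (endpt b L2) L1 x * wmat b L2 x"
proof (induction L1)
  case Nil
  then show ?case using wmat_carrier[OF x b, of L2] by simp
next
  case (Cons l L1)
  let ?c = "endpt b L2"
  have c: "?c < m" using b by (rule endpt_less)
  show ?case
    using Cons assoc_mult_mat[OF lmat_carrier[OF x endpt_less[OF c]] wmat_carrier[OF x c] wmat_carrier[OF x b], of l L1]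
    by (simp add: endpt_append)
qed

lemma relation:
  assumes x: "x \<in> Z" and i: "i < m"
  shows "lmat LX (target LY i) x * lmat LY i x =
    lmat LY (target LX i) x * lmat LX i x + lam i \<cdot>\<^sub>m 1\<^sub>m (\<alpha> i) -
      (if i = 0 then v_map x * w_map x else 0\<^sub>m (\<alpha> i) (\<alpha> i))"
proof -
  have XY: "X_map x i * Y_map x i \<in> carrier_mat (\<alpha> i) (\<alpha> i)"
    using Z_carrier(1,2)[OF x i] by simp
  have pm: "(i + (m - 1)) mod m < m" using m by simp
  have YX: "Y_map x ((i + (m - 1)) mod m) * X_map x ((i + (m - 1)) mod m) \<in> carrier_mat (\<alpha> i) (\<alpha> i)"
    using Z_carrier(1,2)[OF x pm] unfolding succ_pred_mod[OF i] by simp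
  let ?A = "X_map x i * Y_map x i" and ?B = "Y_map x ((i + (m - 1)) mod m) * X_map x ((i + (m - 1)) mod m)"
  have rearrange: "A = B + L - V" if "A - B + V = L"
    and "A \<in> carrier_mat n n" "B \<in> carrier_mat n n" "V \<in> carrier_mat n n"
    for A B V L :: "complex mat" and n
  proof -
    have L: "L \<in> carrier_mat n n" using that by auto
    have e: "(A - B + V) $$ (r, c) = L $$ (r, c)" for r c using that(1) by simp
    show ?thesis
    proof (rule eq_matI)
      fix r c assume "r < dim_row (B + L - V)" "c < dim_col (B + L - V)"
      then have "r < n" "c < n" using that(4) by auto
      then show "A $$ (r, c) = (B + L - V) $$ (r, c)"
        using e[of r c] L that(2-4) by (auto simp: algebra_simps)
    qed (use that(2-4) in auto)
  qed
  have "?A = ?B + lam i \<cdot>\<^sub>m 1\<^sub>m (\<alpha> i) - (if i = 0 then v_map x * w_map x else 0\<^sub>m (\<alpha> i) (\<alpha> i))"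
  proof (rule rearrange[OF _ XY YX])
    show "?A - ?B + (if i = 0 then v_map x * w_map x else 0\<^sub>m (\<alpha> i) (\<alpha> i)) = lam i \<cdot>\<^sub>m 1\<^sub>m (\<alpha> i)"
    proof (cases "i = 0")
      case True
      then have "(i + (m - 1)) mod m = m - 1" using m by simp
      then show ?thesis using x True unfolding Rep_Pi_framed_iff[OF m] by simp
    next
      case False
      have "(i + (m - 1)) mod m = i - 1" using False i m by (simp add: mod_if)
      then have "?A - ?B = lam i \<cdot>\<^sub>m 1\<^sub>m (\<alpha> i)"
        using x False i unfolding Rep_Pi_framed_iff[OF m] by simp
      then show ?thesis using False by (simp only: if_False) (rule right_add_zero_mat, simp)
    qed
    show "(if i = 0 then v_map x * w_map x else 0\<^sub>m (\<alpha> i) (\<alpha> i)) \<in> carrier_mat (\<alpha> i) (\<alpha> i)"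
      using Z_carrier(3,4)[OF x] by auto
  qed
  then show ?thesis
    using pred_succ_mod[OF i] by (simp add: lmat_def target_def)
qed

lemma wmat_swap:
  fixes b L2
  assumes x: "x \<in> Z" and b: "b < m"
  defines "c \<equiv> endpt b L2"
  shows "wmat b (L1 @ [LX, LY] @ L2) x = wmat b (L1 @ [LY, LX] @ L2) x + lam c \<cdot>\<^sub>m wmat b (L1 @ L2) x -
    (if c = 0 then (wmat 0 L1 x * v_map x) * (w_map x * wmat b L2 x) else 0\<^sub>m (\<alpha> (endpt c L1)) (\<alpha> b))"
proof -
  have c: "c < m" unfolding c_def using b by (rule endpt_less)
  let ?P = "wmat c L1 x" and ?R = "wmat b L2 x"
  let ?n = "\<alpha> (endpt c L1)" and ?k = "\<alpha> c" and ?l = "\<alpha> b"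
  let ?XY = "lmat LX (target LY c) x * lmat LY c x"
  let ?YX = "lmat LY (target LX c) x * lmat LX c x"
  let ?E = "if c = 0 then v_map x * w_map x else 0\<^sub>m ?k ?k"
  have P: "?P \<in> carrier_mat ?n ?k" using x c by (rule wmat_carrier)
  have R: "?R \<in> carrier_mat ?k ?l" using wmat_carrier[OF x b, of L2] by (simp add: c_def)
  have cyc: "target LX (target LY c) = c" "target LY (target LX c) = c"
    using pred_succ_mod[OF c] succ_pred_mod[OF c] by (simp_all add: target_def)
  note lc = lmat_carrier[OF x c] lmat_carrier[OF x target_less]
  have XY: "?XY \<in> carrier_mat ?k ?k" and YX: "?YX \<in> carrier_mat ?k ?k"
    using lc(1)[of LX] lc(1)[of LY] lc(2)[of LX LY c] lc(2)[of LY LX c] unfolding cyc by auto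
  have E: "?E \<in> carrier_mat ?k ?k" using Z_carrier(3,4)[OF x] by auto
  have pair: "wmat b (L1 @ [l, l'] @ L2) x = ?P * (lmat l (target l' c) x * lmat l' c x) * ?R"
    if "target l (target l' c) = c" for l l'
  proof -
    have "wmat b (L1 @ [l, l'] @ L2) x = ?P * (wmat c [l, l'] x * ?R)"
      using that unfolding wmat_append[OF x b] c_def by (simp add: endpt_append)
    also have "wmat c [l, l'] x = lmat l (target l' c) x * lmat l' c x"
      using right_mult_one_mat[OF lc(1)[of l']] by simp
    finally show ?thesis
      using that lc(1)[of l'] lc(2)[of l l' c] P R
      by (simp add: assoc_mult_mat[of _ ?n ?k _ ?k _ ?l])
  qed
  have "wmat b (L1 @ [LX, LY] @ L2) x = ?P * (?YX + lam c \<cdot>\<^sub>m 1\<^sub>m ?k - ?E) * ?R"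
    unfolding pair[OF cyc(1)] relation[OF x c] ..
  also have "\<dots> = ?P * ?YX * ?R + lam c \<cdot>\<^sub>m (?P * ?R) - ?P * ?E * ?R"
  proof -
    have "?P * (?YX + lam c \<cdot>\<^sub>m 1\<^sub>m ?k - ?E) = ?P * (?YX + lam c \<cdot>\<^sub>m 1\<^sub>m ?k) - ?P * ?E"
      using P YX E by (intro mult_minus_distrib_mat[of _ ?n ?k _ ?k]) auto
    also have "?P * (?YX + lam c \<cdot>\<^sub>m 1\<^sub>m ?k) = ?P * ?YX + ?P * (lam c \<cdot>\<^sub>m 1\<^sub>m ?k)"
      using P YX by (intro mult_add_distrib_mat[of _ ?n ?k _ ?k]) auto
    also have "?P * (lam c \<cdot>\<^sub>m 1\<^sub>m ?k) = lam c \<cdot>\<^sub>m ?P"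
      using P by (simp add: mult_smult_distrib[of _ ?n ?k _ ?k])
    finally have "?P * (?YX + lam c \<cdot>\<^sub>m 1\<^sub>m ?k - ?E) * ?R = (?P * ?YX + lam c \<cdot>\<^sub>m ?P - ?P * ?E) * ?R"
      by simp
    also have "\<dots> = (?P * ?YX + lam c \<cdot>\<^sub>m ?P) * ?R - ?P * ?E * ?R"
      using P YX E R by (intro minus_mult_distrib_mat[of _ ?n ?k _ _ ?l]) auto
    also have "(?P * ?YX + lam c \<cdot>\<^sub>m ?P) * ?R = ?P * ?YX * ?R + lam c \<cdot>\<^sub>m ?P * ?R"
      using P YX R by (intro add_mult_distrib_mat[of _ ?n ?k _ _ ?l]) auto
    also have "lam c \<cdot>\<^sub>m ?P * ?R = lam c \<cdot>\<^sub>m (?P * ?R)"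
      using P R by (rule mult_smult_assoc_mat)
    finally show ?thesis .
  qed
  also have "?P * ?YX * ?R = wmat b (L1 @ [LY, LX] @ L2) x" unfolding pair[OF cyc(2)] ..
  also have "?P * ?R = wmat b (L1 @ L2) x" unfolding wmat_append[OF x b] c_def ..
  also have "?P * ?E * ?R = (if c = 0 then (wmat 0 L1 x * v_map x) * (w_map x * wmat b L2 x) else 0\<^sub>m ?n ?l)"
  proof (cases "c = 0")
    case True
    have "?P * (v_map x * w_map x) = (?P * v_map x) * w_map x"
      using P True Z_carrier(3,4)[OF x] by (intro assoc_mult_mat[symmetric]) auto
    moreover have "(?P * v_map x) * w_map x * ?R = (?P * v_map x) * (w_map x * ?R)"
      using P R True Z_carrier(3,4)[OF x] by (intro assoc_mult_mat[of _ ?n 1 _ "\<alpha> 0" _ ?l]) auto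
    ultimately show ?thesis using True by simp
  next
    case False
    then show ?thesis using P R by simp
  qed
  finally show ?thesis .
qed

definition T :: "nat \<Rightarrow> letter list \<Rightarrow> point \<Rightarrow> complex" where
  "T b L x = mat_trace (wmat b L x)"

text \<open>A 1 by 1 matrix is read off through its trace. This makes \<open>W L\<close> the trace
  of a cycle through the framing vertex and lets it share the trace lemmas with
  \<open>T\<close>.\<close>

definition W :: "letter list \<Rightarrow> point \<Rightarrow> complex" where
  "W L x = mat_trace (w_map x * wmat 0 L x * v_map x)"

lemma m_pos: "0 < m" using m by simp

lemma T_rotate:
  assumes x: "x \<in> Z" and b: "b < m" and cl: "closed_word (L1 @ L2)"
  shows "T b (L1 @ L2) x = T (endpt b L2) (L2 @ L1) x"
proof -
  let ?c = "endpt b L2"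
  have c: "?c < m" using b by (rule endpt_less)
  have e: "endpt ?c L1 = b" using cl endpt_closed[OF b] by (simp add: endpt_append[symmetric])
  have "wmat ?c L1 x \<in> carrier_mat (\<alpha> b) (\<alpha> ?c)" "wmat b L2 x \<in> carrier_mat (\<alpha> ?c) (\<alpha> b)"
    using wmat_carrier[OF x c, of L1] wmat_carrier[OF x b, of L2] e by simp_all
  then have "mat_trace (wmat ?c L1 x * wmat b L2 x) = mat_trace (wmat b L2 x * wmat ?c L1 x)"
    by (rule mat_trace_mult_commute)
  then show ?thesis
    unfolding T_def wmat_append[OF x b] wmat_append[OF x c] e .
qed

text \<open>At vertex 0 the relation inserts \<open>v w\<close>, which cuts the word open into a
  column times a row. Its trace is the row times the column, that is, the single framed cycle read
  on from the cut.\<close>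

lemma T_swap:
  assumes x: "x \<in> Z" and b: "b < m" and cl: "closed_word (L1 @ L2)"
  shows "T b (L1 @ [LX, LY] @ L2) x = T b (L1 @ [LY, LX] @ L2) x +
    lam (endpt b L2) * T b (L1 @ L2) x - (if endpt b L2 = 0 then W (L2 @ L1) x else 0)"
proof -
  let ?c = "endpt b L2" and ?n = "\<alpha> b"
  have e: "endpt ?c L1 = b" using cl endpt_closed[OF b] by (simp add: endpt_append[symmetric])
  have w: "wmat b L x \<in> carrier_mat ?n ?n" if "closed_word L" for L
    using wmat_carrier[OF x b, of L] unfolding iffD2[OF endpt_closed[OF b] that] .
  have cl': "closed_word (L1 @ [LY, LX] @ L2)"
    using cl m by (simp add: closed_word_def algebra_simps)
  let ?E = "if ?c = 0 then (wmat 0 L1 x * v_map x) * (w_map x * wmat b L2 x) else 0\<^sub>m ?n ?n"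
  have pv: "wmat 0 L1 x * v_map x \<in> carrier_mat ?n 1" and wr: "w_map x * wmat b L2 x \<in> carrier_mat 1 ?n"
    if "?c = 0"
    using that e wmat_carrier[OF x m_pos, of L1] wmat_carrier[OF x b, of L2] Z_carrier(3,4)[OF x] by auto
  have E: "?E \<in> carrier_mat ?n ?n"
    using mult_carrier_mat[OF pv wr] by simp
  have "mat_trace ?E = (if ?c = 0 then W (L2 @ L1) x else 0)"
  proof (cases "?c = 0")
    case True
    have e0: "endpt 0 L1 = b" using True e by simp
    note cc = wmat_carrier[OF x m_pos, of L1, unfolded e0] wmat_carrier[OF x b, of L2, unfolded True] Z_carrier(3,4)[OF x]
    have "mat_trace ?E = mat_trace ((w_map x * wmat b L2 x) * (wmat 0 L1 x * v_map x))"
      using True mat_trace_mult_commute[OF pv wr] by simp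
    also have "(w_map x * wmat b L2 x) * (wmat 0 L1 x * v_map x) = w_map x * (wmat b L2 x * (wmat 0 L1 x * v_map x))"
      using cc by (intro assoc_mult_mat) auto
    also have "wmat b L2 x * (wmat 0 L1 x * v_map x) = wmat b L2 x * wmat 0 L1 x * v_map x"
      using cc by (intro assoc_mult_mat[symmetric]) auto
    also have "wmat b L2 x * wmat 0 L1 x = wmat 0 (L2 @ L1) x"
      unfolding wmat_append[OF x m_pos] e0 ..
    also have "w_map x * (wmat 0 (L2 @ L1) x * v_map x) = w_map x * wmat 0 (L2 @ L1) x * v_map x"
      using cc wmat_carrier[OF x m_pos, of "L2 @ L1"] True
      by (intro assoc_mult_mat[symmetric]) (auto simp: endpt_append e0)
    finally show ?thesis using True by (simp add: W_def)
  next
    case False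
    then show ?thesis by (simp add: mat_trace_def)
  qed
  moreover have "mat_trace (wmat b (L1 @ [LY, LX] @ L2) x + lam ?c \<cdot>\<^sub>m wmat b (L1 @ L2) x - ?E) =
      T b (L1 @ [LY, LX] @ L2) x + lam ?c * T b (L1 @ L2) x - mat_trace ?E"
    using w[OF cl] w[OF cl'] E
    by (simp add: T_def mat_trace_minus[of _ ?n] mat_trace_add[of _ ?n] mat_trace_smult[of _ ?n])
  ultimately show ?thesis
    unfolding T_def[of b "L1 @ [LX, LY] @ L2"] wmat_swap[OF x b] e by simp
qed

text \<open>Between \<open>w\<close> and \<open>v\<close>, an inserted \<open>v w\<close> separates
  two scalars, so the correction is quadratic. This is why words are controlled modulo a subalgebra
  and not modulo a linear span of shorter words.\<close>

lemma W_swap: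
  assumes x: "x \<in> Z" and cl: "closed_word (L1 @ L2)"
  shows "W (L1 @ [LX, LY] @ L2) x = W (L1 @ [LY, LX] @ L2) x +
    lam (endpt 0 L2) * W (L1 @ L2) x - (if endpt 0 L2 = 0 then W L1 x * W L2 x else 0)"
proof -
  let ?c = "endpt 0 L2" and ?n = "\<alpha> 0" and ?v = "v_map x" and ?w = "w_map x"
  have e: "endpt ?c L1 = 0" using cl endpt_closed[OF m_pos] by (simp add: endpt_append[symmetric])
  have wc: "wmat 0 L x \<in> carrier_mat ?n ?n" if "closed_word L" for L
    using wmat_carrier[OF x m_pos, of L] unfolding iffD2[OF endpt_closed[OF m_pos] that] .
  have cl': "closed_word (L1 @ [LY, LX] @ L2)"
    using cl m by (simp add: closed_word_def algebra_simps)
  note vw = Z_carrier(3,4)[OF x]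
  let ?A = "wmat 0 (L1 @ [LY, LX] @ L2) x" and ?B = "wmat 0 (L1 @ L2) x"
  let ?E = "if ?c = 0 then (wmat 0 L1 x * ?v) * (?w * wmat 0 L2 x) else 0\<^sub>m ?n ?n"
  note A = wc[OF cl'] and B = wc[OF cl]
  have L12: "wmat 0 L1 x \<in> carrier_mat ?n ?n" "wmat 0 L2 x \<in> carrier_mat ?n ?n" if "?c = 0"
    using that e wmat_carrier[OF x m_pos, of L1] wmat_carrier[OF x m_pos, of L2] by auto
  have E: "?E \<in> carrier_mat ?n ?n"
    using L12 vw by auto
  have tE: "mat_trace (?w * ?E * ?v) = (if ?c = 0 then W L1 x * W L2 x else 0)"
  proof (cases "?c = 0")
    case True
    note cc = L12[OF True] vw
    let ?a = "?w * wmat 0 L1 x * ?v" and ?b = "?w * wmat 0 L2 x * ?v"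
    have ab: "?a \<in> carrier_mat 1 1" "?b \<in> carrier_mat 1 1" using cc by auto
    have "?w * ((wmat 0 L1 x * ?v) * (?w * wmat 0 L2 x)) = (?w * (wmat 0 L1 x * ?v)) * (?w * wmat 0 L2 x)"
      using cc by (intro assoc_mult_mat[symmetric]) auto
    also have "?w * (wmat 0 L1 x * ?v) = ?a"
      using cc by (intro assoc_mult_mat[symmetric]) auto
    also have "?a * (?w * wmat 0 L2 x) * ?v = ?a * ?b"
      using cc ab by (intro assoc_mult_mat) auto
    finally have "?w * ?E * ?v = ?a * ?b" using True by simp
    moreover have "mat_trace (?a * ?b) = mat_trace ?a * mat_trace ?b"
      using ab index_mult_mat_sum[OF ab, of 0 0]
      by (simp add: mat_trace_1[of "?a * ?b", OF mult_carrier_mat[OF ab]] mat_trace_1[OF ab(1)] mat_trace_1[OF ab(2)]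
          del: index_mult_mat(1))
    ultimately show ?thesis using True by (simp add: W_def)
  next
    case False
    then show ?thesis using vw by (simp add: mat_trace_def)
  qed
  have "?w * (?A + lam ?c \<cdot>\<^sub>m ?B - ?E) * ?v = ?w * ?A * ?v + lam ?c \<cdot>\<^sub>m (?w * ?B * ?v) - ?w * ?E * ?v"
  proof -
    have "?w * (?A + lam ?c \<cdot>\<^sub>m ?B - ?E) = ?w * (?A + lam ?c \<cdot>\<^sub>m ?B) - ?w * ?E"
      using A B E vw by (intro mult_minus_distrib_mat[of _ 1 ?n _ ?n]) auto
    also have "?w * (?A + lam ?c \<cdot>\<^sub>m ?B) = ?w * ?A + ?w * (lam ?c \<cdot>\<^sub>m ?B)"
      using A B vw by (intro mult_add_distrib_mat[of _ 1 ?n _ ?n]) auto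
    also have "?w * (lam ?c \<cdot>\<^sub>m ?B) = lam ?c \<cdot>\<^sub>m (?w * ?B)"
      using B vw by (intro mult_smult_distrib[of _ 1 ?n _ ?n]) auto
    finally have "?w * (?A + lam ?c \<cdot>\<^sub>m ?B - ?E) * ?v = (?w * ?A + lam ?c \<cdot>\<^sub>m (?w * ?B) - ?w * ?E) * ?v"
      by simp
    also have "\<dots> = (?w * ?A + lam ?c \<cdot>\<^sub>m (?w * ?B)) * ?v - ?w * ?E * ?v"
      using A B E vw by (intro minus_mult_distrib_mat[of _ 1 ?n _ _ 1]) auto
    also have "(?w * ?A + lam ?c \<cdot>\<^sub>m (?w * ?B)) * ?v = ?w * ?A * ?v + lam ?c \<cdot>\<^sub>m (?w * ?B) * ?v"
      using A B vw by (intro add_mult_distrib_mat[of _ 1 ?n _ _ 1]) auto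
    also have "lam ?c \<cdot>\<^sub>m (?w * ?B) * ?v = lam ?c \<cdot>\<^sub>m (?w * ?B * ?v)"
      using B vw by (intro mult_smult_assoc_mat[of _ 1 ?n _ 1]) auto
    finally show ?thesis .
  qed
  moreover have "?w * ?A * ?v \<in> carrier_mat 1 1" "?w * ?B * ?v \<in> carrier_mat 1 1" "?w * ?E * ?v \<in> carrier_mat 1 1"
    using A B E vw by auto
  ultimately have "mat_trace (?w * (?A + lam ?c \<cdot>\<^sub>m ?B - ?E) * ?v) =
      W (L1 @ [LY, LX] @ L2) x + lam ?c * W (L1 @ L2) x - mat_trace (?w * ?E * ?v)"
    by (simp add: W_def mat_trace_minus[of _ 1] mat_trace_add[of _ 1] mat_trace_smult[of _ 1])
  then show ?thesis
    unfolding W_def[of "L1 @ [LX, LY] @ L2"] wmat_swap[OF x m_pos] e tE by simp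
qed

end

lemma sum_rotate:
  fixes m k :: nat
  assumes "0 < m"
  shows "(\<Sum>c<m. f ((c + k) mod m)) = (\<Sum>c<m. f c)"
proof -
  have "c = c'" if "c < m" "c' < m" "(c + k) mod m = (c' + k) mod m" "c \<le> c'" for c c'
  proof -
    have "m dvd c' - c" using that mod_eq_dvd_iff_nat[of "c + k" "c' + k" m] by simp
    then show ?thesis using that nat_dvd_not_less[of "c' - c" m] by force
  qed
  then have inj: "inj_on (\<lambda>c. (c + k) mod m) {..<m}"
    by (intro inj_onI) (metis lessThan_iff nat_le_linear)
  then have "(\<lambda>c. (c + k) mod m) ` {..<m} = {..<m}"
    using assms by (intro endo_inj_surj) auto
  then have "bij_betw (\<lambda>c. (c + k) mod m) {..<m} {..<m}" using inj by (simp add: bij_betw_def)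
  then show ?thesis by (rule sum.reindex_bij_betw)
qed

lemma count_list_replicate [simp]: "count_list (replicate n a) b = (if a = b then n else 0)"
  by (induction n) auto

section \<open>Normal forms of closed words\<close>

context framed_rep
begin

abbreviation nf :: "nat \<Rightarrow> nat \<Rightarrow> letter list" where
  "nf q p \<equiv> replicate q LY @ replicate p LX"

lemma closed_nf: "closed_word (nf q p) \<longleftrightarrow> m dvd q + (m - 1) * p"
  by (simp add: closed_word_def count_list_append)

lemma closed_nf_Suc: "closed_word (nf (Suc q) (Suc p)) = closed_word (nf q p)"
proof -
  have "Suc q + (m - 1) * Suc p = (q + (m - 1) * p) + m" using m by simp
  then show ?thesis unfolding closed_nf by (simp only: dvd_add_triv_right_iff)
qed

end

section \<open>Reduction of closed words modulo a subalgebra\<close>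

locale framed_rep_algebra = framed_rep m lam \<alpha> + function_algebra "Rep_Pi (framed_quiver m) (framed_par m lam \<alpha>) (framed_dim m \<alpha>)" S
  for m lam \<alpha> S
begin

text \<open>Congruence modulo the subspace \<open>S\<close>: compatible with sums, not with products
  of arbitrary functions. Quadratic corrections must therefore have both factors in
  \<open>S\<close>.\<close>

definition eqv :: "(point \<Rightarrow> complex) \<Rightarrow> (point \<Rightarrow> complex) \<Rightarrow> bool" where
  "eqv f g \<longleftrightarrow> (\<lambda>x\<in>Z. f x - g x) \<in> S"

lemma eqvI: "(\<lambda>x\<in>Z. h x) \<in> S \<Longrightarrow> (\<And>x. x \<in> Z \<Longrightarrow> f x - g x = h x) \<Longrightarrow> eqv f g"
  unfolding eqv_def by (rule iffD2[OF mem_cong])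

lemma eqv_eq: "(\<And>x. x \<in> Z \<Longrightarrow> f x = g x) \<Longrightarrow> eqv f g"
  by (rule eqvI[OF const_mem[of 0]]) simp

lemma eqv_trans: "eqv f g \<Longrightarrow> eqv g h \<Longrightarrow> eqv f h"
  by (rule eqvI[OF add_mem[of "\<lambda>x. f x - g x" "\<lambda>x. g x - h x"]]) (simp_all add: eqv_def)

lemma eqv_sym: "eqv f g \<Longrightarrow> eqv g f"
  by (rule eqvI[OF cmult_mem[of "\<lambda>x. f x - g x" "-1"]]) (simp_all add: eqv_def)

lemma eqv_mem: "eqv f g \<Longrightarrow> restrict g Z \<in> S \<Longrightarrow> restrict f Z \<in> S"
proof -
  assume "eqv f g" "restrict g Z \<in> S"
  then have "(\<lambda>x\<in>Z. (f x - g x) + g x) \<in> S" unfolding eqv_def by (rule add_mem)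
  then show ?thesis by simp
qed

text \<open>The induction hypothesis on the degree: the corrections of an exchange in a word of
  length \<open>N\<close> come from shorter closed words and thus lie in \<open>S\<close>.\<close>

definition low :: "nat \<Rightarrow> bool" where
  "low N \<longleftrightarrow> (\<forall>L. length L < N \<longrightarrow> closed_word L \<longrightarrow> (\<forall>b<m. restrict (T b L) Z \<in> S) \<and> restrict (W L) Z \<in> S)"

lemma lowD:
  assumes "low N" "length L < N" "closed_word L"
  shows "b < m \<Longrightarrow> restrict (T b L) Z \<in> S" "restrict (W L) Z \<in> S"
  using assms by (auto simp: low_def)

lemma closed_parts:
  assumes "closed_word (L1 @ L2)" "b < m" "endpt b L2 = b"
  shows "closed_word L1" "closed_word L2"
proof -
  show 2: "closed_word L2" using endpt_closed assms(2,3) by blast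
  have "endpt b (L1 @ L2) = b" using endpt_closed assms(1,2) by blast
  then have "endpt b L1 = b" using assms(3) by (simp add: endpt_append)
  then show "closed_word L1" using endpt_closed assms(2) by blast
qed

lemma eqv_sort:
  assumes "\<And>L1 L2. length (L1 @ [LX, LY] @ L2) = length L \<Longrightarrow> closed_word (L1 @ L2) \<Longrightarrow>
      eqv (F (L1 @ [LX, LY] @ L2)) (F (L1 @ [LY, LX] @ L2))"
    and "closed_word L"
  shows "eqv (F L) (F (nf (count_list L LY) (count_list L LX)))"
proof (rule sort_letters[of "\<lambda>L L'. eqv (F L) (F L')" "\<lambda>L'. length L' = length L \<and> closed_word L'"])
  fix L1 L2 assume *: "length (L1 @ [LX, LY] @ L2) = length L \<and> closed_word (L1 @ [LX, LY] @ L2)"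
  then have "closed_word (L1 @ L2)" using m by (simp add: closed_word_def algebra_simps)
  then show "eqv (F (L1 @ [LX, LY] @ L2)) (F (L1 @ [LY, LX] @ L2))" using * assms(1) by blast
next
  fix L' L'' :: "letter list" assume "mset L' = mset L''" "length L' = length L \<and> closed_word L'"
  then show "length L'' = length L \<and> closed_word L''"
    using closed_word_mset mset_eq_length by metis
qed (use assms eqv_eq eqv_trans in blast)+

lemma T_sort:
  assumes low: "low (length L)" and b: "b < m" and cl: "closed_word L"
  shows "eqv (T b L) (T b (nf (count_list L LY) (count_list L LX)))"
proof (rule eqv_sort[OF _ cl])
  fix L1 L2 assume len: "length (L1 @ [LX, LY] @ L2) = length L" and cl': "closed_word (L1 @ L2)"
  have cl'': "closed_word (L2 @ L1)" using closed_word_mset[of "L1 @ L2" "L2 @ L1"] cl' by simp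
  let ?c = "endpt b L2"
  have "restrict (T b (L1 @ L2)) Z \<in> S" "restrict (W (L2 @ L1)) Z \<in> S"
    using lowD(1)[OF low _ cl' b] lowD(2)[OF low _ cl''] len by simp_all
  then have "(\<lambda>x\<in>Z. lam ?c * T b (L1 @ L2) x - (if ?c = 0 then W (L2 @ L1) x else 0)) \<in> S"
    by (cases "?c = 0") (simp_all add: diff_mem cmult_mem)
  then show "eqv (T b (L1 @ [LX, LY] @ L2)) (T b (L1 @ [LY, LX] @ L2))"
    by (rule eqvI) (simp add: T_swap[OF _ b cl', simplified])
qed

lemma W_sort:
  assumes low: "low (length L)" and cl: "closed_word L"
  shows "eqv (W L) (W (nf (count_list L LY) (count_list L LX)))"
proof (rule eqv_sort[OF _ cl])
  fix L1 L2 assume len: "length (L1 @ [LX, LY] @ L2) = length L" and cl': "closed_word (L1 @ L2)"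
  let ?c = "endpt 0 L2"
  have B: "(\<lambda>x\<in>Z. lam ?c * W (L1 @ L2) x) \<in> S"
    using lowD(2)[OF low _ cl'] len by (intro cmult_mem) simp
  have "(\<lambda>x\<in>Z. lam ?c * W (L1 @ L2) x - (if ?c = 0 then W L1 x * W L2 x else 0)) \<in> S"
  proof (cases "?c = 0")
    case True
    have "restrict (W L1) Z \<in> S" "restrict (W L2) Z \<in> S"
      using lowD(2)[OF low] closed_parts[OF cl' m_pos True] len by simp_all
    then have "(\<lambda>x\<in>Z. W L1 x * W L2 x) \<in> S" by (rule mult_mem)
    then show ?thesis using True B by (simp add: diff_mem)
  qed (use B in simp)
  then show "eqv (W (L1 @ [LX, LY] @ L2)) (W (L1 @ [LY, LX] @ L2))"
    by (rule eqvI) (simp add: W_swap[OF _ cl', simplified])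
qed

text \<open>Rotating the last \<open>LX\<close> to the front moves the base vertex from
  \<open>b + 1\<close> to \<open>b\<close>, and sorting brings the letter back. Without any
  \<open>LX\<close> the word is a power of \<open>LY\<close>, which rotation leaves
  unchanged.\<close>

lemma T_nf_base:
  assumes low: "low (q + p)" and b: "b < m" and cl: "closed_word (nf q p)"
  shows "eqv (T b (nf q p)) (T 0 (nf q p))"
  using b
proof (induction b)
  case 0
  then show ?case by (simp add: eqv_eq)
next
  case (Suc b)
  then have b: "b < m" by simp
  have step: "eqv (T (Suc b) (nf q p)) (T b (nf q p))"
  proof (cases p)
    case (Suc p')
    let ?K = "replicate q LY @ replicate p' LX"
    have nf: "nf q p = ?K @ [LX]" using Suc by (simp add: replicate_append_same)
    have "T (Suc b) (nf q p) x = T b ([LX] @ ?K) x" if "x \<in> Z" for x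
    proof -
      have "target LX (Suc b) = b" using Suc.prems pred_succ_mod[OF b] by (simp add: target_def)
      then show ?thesis using T_rotate[OF that Suc.prems, of ?K "[LX]"] cl by (simp add: nf)
    qed
    moreover have "closed_word ([LX] @ ?K)"
      using cl closed_word_mset[of "nf q p" "[LX] @ ?K"] by (simp add: nf)
    then have "eqv (T b ([LX] @ ?K)) (T b (nf q p))"
      using T_sort[of "[LX] @ ?K" b] low b Suc by (simp add: count_list_append)
    ultimately show ?thesis using eqv_eq eqv_trans by blast
  next
    case 0
    show ?thesis
    proof (cases q)
      case 0
      \<comment> \<open>The trace of the empty word is the dimension at its base vertex, which
        varies with the vertex but is constant on \<open>Z\<close>.\<close>
      then have "T c (nf q p) x = of_nat (\<alpha> c)" for c x
        using \<open>p = 0\<close> by (simp add: T_def mat_trace_def)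
      then show ?thesis by (intro eqvI[OF const_mem[of "of_nat (\<alpha> (Suc b)) - of_nat (\<alpha> b)"]]) simp
    next
      case (Suc q')
      have "T b (replicate q' LY @ [LY]) x = T (Suc b) ([LY] @ replicate q' LY) x" if "x \<in> Z" for x
      proof -
        have "target LY b = Suc b" using Suc.prems by (simp add: target_def)
        then show ?thesis
          using T_rotate[OF that b, of "replicate q' LY" "[LY]"] cl Suc 0 by (simp add: replicate_append_same)
      qed
      then show ?thesis using Suc 0 by (intro eqv_eq) (simp add: replicate_append_same)
    qed
  qed
  then show ?case using Suc.IH[OF b] eqv_trans by blast
qed

lemma T_base:
  assumes "low (length L)" "b < m" "closed_word L"
  shows "eqv (T b L) (T 0 (nf (count_list L LY) (count_list L LX)))"
proof -
  let ?nf = "nf (count_list L LY) (count_list L LX)"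
  have "mset L = mset ?nf"
  proof (rule multiset_eqI)
    fix x show "count (mset L) x = count (mset ?nf) x"
      by (cases x) (simp_all add: count_mset count_list_eq_length_filter)
  qed
  then have "length ?nf = length L" "closed_word ?nf"
    using closed_word_mset mset_eq_length assms(3) by metis+
  then have "eqv (T b ?nf) (T 0 ?nf)" using assms by (intro T_nf_base) simp_all
  then show ?thesis using T_sort[OF assms] eqv_trans by blast
qed

text \<open>Rotating \<open>Y\<^sup>q\<^sup>+\<^sup>1X\<^sup>p\<^sup>+\<^sup>1\<close> by one letter and moving that letter back into place changes the trace
  by terms of lower degree. Summed over all starting vertices the traces cancel, and the correction
  terms add up to \<open>q + 1\<close> times the following relation.\<close>

lemma T_W_relation:
  assumes low: "low (q + p)" and cl: "closed_word (nf q p)"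
  shows "eqv (\<lambda>x. (\<Sum>i<m. lam i) * T 0 (nf q p) x) (W (nf q p))"
proof -
  \<comment> \<open>When the rotated \<open>LX\<close> has passed \<open>j\<close> letters
    \<open>LY\<close>, its next exchange takes place at the vertex \<open>d c j\<close>; if that is
    0, the cycle cut open there is \<open>u j\<close>.\<close>
  define u where "u j = replicate (q - j) LY @ replicate p LX @ replicate j LY" for j
  define d where "d c j = endpt c (nf (q - j) p)" for c j
  have move: "T c (LX # nf (Suc q) p) x = T c (replicate s LY @ LX # nf (Suc q - s) p) x +
      (\<Sum>j<s. lam (d c j) * T c (nf q p) x - (if d c j = 0 then W (u j) x else 0))"
    if x: "x \<in> Z" and c: "c < m" and "s \<le> Suc q" for x c s
    using that(3)
  proof (induction s)
    case (Suc s)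
    have q: "replicate s LY @ replicate (q - s) LY = replicate q LY"
      using Suc.prems by (simp flip: replicate_add)
    have cl': "closed_word (replicate s LY @ nf (q - s) p)"
      using cl by (simp add: append_assoc[symmetric] q del: append_assoc)
    have "T c (replicate s LY @ [LX, LY] @ nf (q - s) p) x =
        T c (replicate s LY @ [LY, LX] @ nf (q - s) p) x +
        (lam (d c s) * T c (nf q p) x - (if d c s = 0 then W (u s) x else 0))"
      using T_swap[OF x c cl'] by (simp add: d_def u_def append_assoc[symmetric] q del: append_assoc)
    moreover have "replicate s LY @ [LX, LY] @ nf (q - s) p = replicate s LY @ LX # nf (Suc q - s) p"
      using Suc.prems by (simp add: Suc_diff_le)
    moreover have "replicate s LY @ [LY, LX] @ nf (q - s) p = replicate (Suc s) LY @ LX # nf (Suc q - Suc s) p"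
      by (simp add: replicate_append_same)
    moreover note Suc.IH
    ultimately show ?case using Suc.prems by (simp only: sum.lessThan_Suc Suc_leD add_ac)
  qed simp
  \<comment> \<open>Rotation takes the base vertex from \<open>c + 1\<close> to \<open>c\<close>, so
    summation over \<open>c\<close> cancels the traces of the long word. What is left consists of
    words of length \<open>q + p\<close>.\<close>
  have total: "(\<Sum>c<m. \<Sum>j\<le>q. lam (d c j) * T c (nf q p) x - (if d c j = 0 then W (u j) x else 0)) = 0"
    if x: "x \<in> Z" for x
  proof -
    let ?K = "nf (Suc q) (Suc p)"
    have "T ((c + 1) mod m) ?K x = T c ?K x +
        (\<Sum>j\<le>q. lam (d c j) * T c (nf q p) x - (if d c j = 0 then W (u j) x else 0))" if c: "c < m" for c
    proof -
      have K: "?K = nf (Suc q) p @ [LX]" by (simp add: replicate_append_same)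
      have "target LX ((c + 1) mod m) = c" using pred_succ_mod[OF c] by (simp add: target_def)
      moreover have "closed_word ?K" using cl closed_nf_Suc by blast
      then have "closed_word (nf (Suc q) p @ [LX])" unfolding K .
      ultimately have "T ((c + 1) mod m) ?K x = T c (LX # nf (Suc q) p) x"
        unfolding K using T_rotate[OF x, of "(c + 1) mod m" "nf (Suc q) p" "[LX]"] m_pos by simp
      also have "\<dots> = T c (replicate (Suc q) LY @ LX # nf (Suc q - Suc q) p) x +
          (\<Sum>j<Suc q. lam (d c j) * T c (nf q p) x - (if d c j = 0 then W (u j) x else 0))"
        by (rule move[OF x c order_refl])
      also have "replicate (Suc q) LY @ LX # nf (Suc q - Suc q) p = ?K" by simp
      finally show ?thesis unfolding lessThan_Suc_atMost .
    qed
    then have "(\<Sum>c<m. T ((c + 1) mod m) ?K x) = (\<Sum>c<m. T c ?K x) +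
        (\<Sum>c<m. \<Sum>j\<le>q. lam (d c j) * T c (nf q p) x - (if d c j = 0 then W (u j) x else 0))"
      by (simp add: sum.distrib)
    then show ?thesis
      unfolding sum_rotate[OF m_pos, of "\<lambda>c. T c ?K x" 1] by (simp only: add_cancel_right_right)
  qed
  define k where "k j = q - j + (m - 1) * p" for j
  have d: "d c j = (c + k j) mod m" if "c < m" for c j
    using that by (simp add: d_def k_def endpt_eq count_list_append)
  \<comment> \<open>For fixed \<open>j\<close>, the vertex \<open>d c j\<close> runs through all
    residues as \<open>c\<close> does, so each exchange collects every \<open>lam i\<close> once and
    meets vertex 0 exactly once.\<close>
  have sum_lam: "(\<Sum>c<m. lam (d c j)) = (\<Sum>i<m. lam i)" for j
    using sum_rotate[OF m_pos, of lam "k j"] by (simp add: d)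
  have sum_W: "(\<Sum>c<m. if d c j = 0 then W (u j) x else 0) = W (u j) x" for j x
  proof -
    have "(\<Sum>c<m. if d c j = 0 then W (u j) x else 0) = (\<Sum>c<m. if c = 0 then W (u j) x else 0)"
      using sum_rotate[OF m_pos, of "\<lambda>c. if c = 0 then W (u j) x else 0" "k j"] by (simp add: d)
    then show ?thesis using m_pos by simp
  qed
  have W_u: "eqv (W (u j)) (W (nf q p))" if j: "j \<le> q" for j
  proof -
    have "mset (u j) = mset (nf q p)"
      unfolding u_def using j by (intro multiset_eqI) (auto split: if_splits)
    then have "closed_word (u j)" using cl closed_word_mset by blast
    then show ?thesis
      using W_sort[of "u j"] low j by (simp add: u_def count_list_append)
  qed
  let ?T = "\<lambda>c. T c (nf q p)" and ?h = "\<lambda>x. (\<Sum>j\<le>q. W (u j) x - W (nf q p) x) -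
      (\<Sum>c<m. \<Sum>j\<le>q. lam (d c j) * (T c (nf q p) x - T 0 (nf q p) x))"
  have "restrict ?h Z \<in> S"
  proof (rule diff_mem; rule sum_mem; (rule sum_mem)?; (rule cmult_mem)?)
    show "(\<lambda>x\<in>Z. W (u j) x - W (nf q p) x) \<in> S" if "j \<in> {..q}" for j
      using W_u that by (simp add: eqv_def)
    show "(\<lambda>x\<in>Z. ?T c x - ?T 0 x) \<in> S" if "c \<in> {..<m}" for c
      using T_nf_base[OF low _ cl] that by (simp add: eqv_def)
  qed
  \<comment> \<open>The rotated letter passes \<open>q + 1\<close> letters \<open>LY\<close>, each
    with the same contribution modulo \<open>S\<close>.\<close>
  then have "(\<lambda>x\<in>Z. 1 / of_nat (Suc q) * ?h x) \<in> S" by (rule cmult_mem)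
  then show ?thesis
  proof (rule eqvI)
    fix x assume x: "x \<in> Z"
    have "0 = (\<Sum>c<m. \<Sum>j\<le>q. lam (d c j) * ?T c x) - (\<Sum>c<m. \<Sum>j\<le>q. if d c j = 0 then W (u j) x else 0)"
      using total[OF x] by (simp add: sum_subtractf)
    also have "(\<Sum>c<m. \<Sum>j\<le>q. if d c j = 0 then W (u j) x else 0) = (\<Sum>j\<le>q. W (u j) x)"
      by (subst sum.swap) (simp add: sum_W)
    also have "(\<Sum>c<m. \<Sum>j\<le>q. lam (d c j) * ?T c x) =
        (\<Sum>c<m. \<Sum>j\<le>q. lam (d c j) * (?T c x - ?T 0 x)) + (\<Sum>c<m. \<Sum>j\<le>q. lam (d c j)) * ?T 0 x"
      by (simp add: right_diff_distrib sum_subtractf sum_distrib_right)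
    also have "(\<Sum>c<m. \<Sum>j\<le>q. lam (d c j)) = of_nat (Suc q) * (\<Sum>i<m. lam i)"
      by (subst sum.swap) (simp add: sum_lam)
    finally have "?h x = of_nat (Suc q) * ((\<Sum>i<m. lam i) * ?T 0 x - W (nf q p) x)"
      by (simp add: sum_subtractf algebra_simps)
    then show "(\<Sum>i<m. lam i) * ?T 0 x - W (nf q p) x = 1 / of_nat (Suc q) * ?h x"
      by (simp add: field_simps del: of_nat_Suc)
  qed
qed

text \<open>Induction on the length. In each degree the normal forms of one family are given and
  \<open>T_W_relation\<close> supplies those of the other, with a division by the sum of the
  \<open>lam i\<close> when passing from \<open>W\<close> to \<open>T\<close>. Both kinds are needed
  to continue, since sorting a trace produces \<open>W\<close> terms.\<close>

lemma words_mem: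
  assumes lam: "(\<Sum>i<m. lam i) \<noteq> 0"
    and gens: "(\<forall>q p. closed_word (nf q p) \<longrightarrow> restrict (T 0 (nf q p)) Z \<in> S) \<or>
      (\<forall>q p. closed_word (nf q p) \<longrightarrow> restrict (W (nf q p)) Z \<in> S)"
    and "closed_word L"
  shows "b < m \<Longrightarrow> restrict (T b L) Z \<in> S" "restrict (W L) Z \<in> S"
proof -
  have "low N" for N
  proof (induction N)
    case (Suc N)
    have "(\<forall>b<m. restrict (T b L) Z \<in> S) \<and> restrict (W L) Z \<in> S" if len: "length L = N" and cl: "closed_word L" for L
    proof -
      let ?q = "count_list L LY" and ?p = "count_list L LX"
      have mset: "mset L = mset (nf ?q ?p)"
      proof (rule multiset_eqI)
        fix x show "count (mset L) x = count (mset (nf ?q ?p)) x"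
          by (cases x) (simp_all add: count_mset count_list_eq_length_filter)
      qed
      have qp: "?q + ?p = N" using mset_eq_length[OF mset] len by simp
      have cl': "closed_word (nf ?q ?p)" using closed_word_mset[OF mset] cl by simp
      have low: "low (?q + ?p)" "low (length L)" using Suc qp len by simp_all
      note rel = T_W_relation[OF low(1) cl']
      have "restrict (T 0 (nf ?q ?p)) Z \<in> S \<and> restrict (W (nf ?q ?p)) Z \<in> S"
        using gens
      proof
        assume "\<forall>q p. closed_word (nf q p) \<longrightarrow> restrict (T 0 (nf q p)) Z \<in> S"
        then have T: "restrict (T 0 (nf ?q ?p)) Z \<in> S" using cl' by blast
        then show ?thesis using eqv_mem[OF eqv_sym[OF rel] cmult_mem] by blast
      next
        assume "\<forall>q p. closed_word (nf q p) \<longrightarrow> restrict (W (nf q p)) Z \<in> S"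
        then have W: "restrict (W (nf ?q ?p)) Z \<in> S" using cl' by blast
        then have "(\<lambda>x\<in>Z. (\<Sum>i<m. lam i) * T 0 (nf ?q ?p) x) \<in> S" using eqv_mem[OF rel] by blast
        then have "(\<lambda>x\<in>Z. 1 / (\<Sum>i<m. lam i) * ((\<Sum>i<m. lam i) * T 0 (nf ?q ?p) x)) \<in> S" by (rule cmult_mem)
        then show ?thesis using lam W by simp
      qed
      then show ?thesis
        using eqv_mem[OF T_base[OF low(2) _ cl]] eqv_mem[OF W_sort[OF low(2) cl]] by blast
    qed
    then show ?case using Suc unfolding low_def by (metis less_SucE)
  qed (simp add: low_def)
  then have "low (Suc (length L))" .
  then show "b < m \<Longrightarrow> restrict (T b L) Z \<in> S" "restrict (W L) Z \<in> S"
    using lowD[of "Suc (length L)" L] assms(3) by auto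
qed

end

section \<open>The matrices of the two families as words\<close>

context framed_rep
begin

lemma endpt_replicate:
  assumes "b < m"
  shows "endpt b (replicate j LY) = (b + j) mod m" "endpt b (replicate j LX) = (b + (m - 1) * j) mod m"
  using assms by (simp_all add: endpt_eq)

lemma pred_mult_mod: "1 \<le> j \<Longrightarrow> j \<le> m \<Longrightarrow> ((m - 1) * j) mod m = m - j"
proof -
  assume j: "1 \<le> j" "j \<le> m"
  then obtain k where k: "j = Suc k" by (cases j) auto
  have "(m - 1) * j + j = m * k + (m - j) + j"
    using j m by (simp add: k diff_mult_distrib)
  then have "(m - 1) * j = (m - j) + m * k" by simp
  then have "((m - 1) * j) mod m = (m - j) mod m" by (metis mod_mult_self2)
  then show ?thesis using j m by simp
qed

lemma foldr_Y_map:
  assumes b: "b < m" and L: "endpt b L = c" and cj: "c + j \<le> m"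
  shows "foldr (*) (map (Y_map x) (rev [c..<c + j])) (wmat b L x) = wmat b (replicate j LY @ L) x"
  using cj
proof (induction j)
  case (Suc j)
  have "endpt b (replicate j LY @ L) = c + j"
    using Suc.prems endpt_less[OF b, of L] L by (simp add: endpt_append endpt_replicate)
  then show ?case using Suc by (simp add: lmat_def)
qed simp

lemma mat_product_X_map:
  assumes "k \<le> m"
  shows "mat_product (\<alpha> 0) (map (X_map x) [m - k..<m]) = wmat 0 (replicate k LX) x"
  using assms
proof (induction k)
  case (Suc k)
  have "[m - Suc k..<m] = (m - Suc k) # [m - k..<m]"
    using Suc.prems by (simp add: upt_conv_Cons Suc_diff_Suc)
  moreover have "(endpt 0 (replicate k LX) + (m - 1)) mod m = m - Suc k"
  proof -
    have "(endpt 0 (replicate k LX) + (m - 1)) mod m = ((m - 1) * k + (m - 1)) mod m"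
      using m_pos by (simp only: endpt_replicate add_0 mod_add_left_eq)
    also have "(m - 1) * k + (m - 1) = (m - 1) * Suc k" by simp
    finally show ?thesis using pred_mult_mod[of "Suc k"] Suc.prems by simp
  qed
  ultimately show ?case
    using Suc by (simp add: mat_product_def lmat_def)
qed (simp add: mat_product_def)

lemma A_mat_wmat: "A_mat m \<alpha> x = wmat 0 (replicate m LY) x"
  using foldr_Y_map[OF m_pos, of "[]" 0 m x] by (simp add: A_mat_def mat_product_def)

lemma B_mat_wmat: "B_mat m \<alpha> x = wmat 0 (replicate m LX) x"
  using mat_product_X_map[of m x] by (simp add: B_mat_def)

lemma C_mat_wmat:
  assumes "k < m"
  shows "C_mat m \<alpha> k x = wmat 0 (nf k k) x"
proof -
  have X: "foldr (*) (map (X_map x) [m - k..<m]) (1\<^sub>m (\<alpha> 0)) = wmat 0 (replicate k LX) x"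
    using mat_product_X_map[of k x] assms by (simp add: mat_product_def)
  show ?thesis
  proof (cases "k = 0")
    case True
    then show ?thesis by (simp add: C_mat_def mat_product_def)
  next
    case False
    have "endpt 0 (replicate k LX) = m - k"
      using pred_mult_mod[of k] False assms m_pos by (simp add: endpt_replicate)
    from foldr_Y_map[OF m_pos this, of k x] show ?thesis
      using assms by (simp add: C_mat_def mat_product_def X)
  qed
qed

lemma pow_wmat:
  assumes x: "x \<in> Z"
  shows "wmat 0 (replicate m l) x ^\<^sub>m i = wmat 0 (replicate (m * i) l) x"
proof (induction i)
  case 0
  have "endpt 0 (replicate m l) = 0" using m_pos by (cases l) (simp_all add: endpt_replicate)
  then show ?case using wmat_carrier[OF x m_pos, of "replicate m l"] by simp
next
  case (Suc i)
  have "endpt 0 (replicate m l) = 0" using m_pos by (cases l) (simp_all add: endpt_replicate)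
  then have "wmat 0 (replicate (m * i) l) x * wmat 0 (replicate m l) x = wmat 0 (replicate (m * i) l @ replicate m l) x"
    using wmat_append[OF x m_pos, of "replicate (m * i) l" "replicate m l"] by simp
  then show ?case using Suc by (simp add: replicate_add[symmetric] add.commute)
qed

lemma ACB_wmat:
  assumes x: "x \<in> Z" and k: "k < m"
  shows "A_mat m \<alpha> x ^\<^sub>m i * C_mat m \<alpha> k x * B_mat m \<alpha> x ^\<^sub>m j = wmat 0 (nf (m * i + k) (k + m * j)) x"
proof -
  have e: "endpt 0 (replicate (m * j) LX) = 0" using m_pos by (simp add: endpt_replicate)
  have "endpt 0 (nf k k) = 0"
  proof -
    have "k + (m - 1) * k = m * k" using m by (cases m) auto
    then have "m dvd k + (m - 1) * k" by simp
    then show ?thesis using endpt_closed[OF m_pos] closed_nf by blast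
  qed
  then have "A_mat m \<alpha> x ^\<^sub>m i * C_mat m \<alpha> k x = wmat 0 (replicate (m * i) LY @ nf k k) x"
    using wmat_append[OF x m_pos, of "replicate (m * i) LY" "nf k k"]
    by (simp add: A_mat_wmat C_mat_wmat[OF k] pow_wmat[OF x])
  then show ?thesis
    using wmat_append[OF x m_pos, of "replicate (m * i) LY @ nf k k" "replicate (m * j) LX"] e
    by (simp add: B_mat_wmat pow_wmat[OF x] replicate_add)
qed

lemma G_fun_T: "x \<in> Z \<Longrightarrow> k < m \<Longrightarrow> G_fun m \<alpha> k i j x = T 0 (nf (m * i + k) (k + m * j)) x"
  by (simp add: G_fun_def T_def ACB_wmat)

lemma H_fun_W: "x \<in> Z \<Longrightarrow> k < m \<Longrightarrow> H_fun m \<alpha> k i j x = W (nf (m * i + k) (k + m * j)) x"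
  using Z_carrier(4)[of x] by (simp add: H_fun_def W_def ACB_wmat mat_trace_def)

text \<open>Closedness means that \<open>q\<close> and \<open>p\<close> agree modulo
  \<open>m\<close>, and \<open>k\<close> is the common residue. With \<open>ACB_wmat\<close>, every
  closed normal form at vertex 0 therefore occurs in the given families; \<open>C_k\<close> accounts
  for the letters that do not fill a full turn.\<close>

lemma closed_nf_decompose:
  assumes "closed_word (nf q p)"
  obtains i j k where "k < m" "q = m * i + k" "p = k + m * j"
proof
  have "(q + (m - 1) * p + p) mod m = p mod m"
    using assms by (metis closed_nf dvd_eq_mod_eq_0 mod_add_left_eq add_0)
  moreover have "q + (m - 1) * p + p = q + m * p" using m by (cases m) auto
  ultimately have "q mod m = p mod m" by (metis mod_mult_self2)
  then show "q = m * (q div m) + p mod m" by (metis mult_div_mod_eq)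
  show "p mod m < m" "p = p mod m + m * (p div m)" using m_pos by auto
qed

section \<open>The group action on the solution set\<close>

abbreviation "dquiver \<equiv> double_quiver (framed_quiver m)"
abbreviation "dims \<equiv> framed_dim m \<alpha>"

lemma dquiver_arcs: "arcs dquiver = Inl ` insert Arr_infty (Arr ` {..<m}) \<union> Inr ` insert Arr_infty (Arr ` {..<m})"
  by (auto simp: double_quiver_def framed_quiver_def)

lemma dquiver_verts: "verts dquiver = insert Infty (Vert ` {..<m})"
  by (simp add: double_quiver_def framed_quiver_def)

lemma dquiver_ends [simp]:
  "head dquiver (Inl Arr_infty) = Vert 0" "tail dquiver (Inl Arr_infty) = Infty"
  "head dquiver (Inr Arr_infty) = Infty" "tail dquiver (Inr Arr_infty) = Vert 0"
  "head dquiver (Inl (Arr i)) = Vert i" "tail dquiver (Inl (Arr i)) = Vert ((i + 1) mod m)"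
  "head dquiver (Inr (Arr i)) = Vert ((i + 1) mod m)" "tail dquiver (Inr (Arr i)) = Vert i"
  by (simp_all add: double_quiver_def framed_quiver_def)

lemma wf_dquiver: "wf_digraph dquiver"
  using m_pos by (auto simp: wf_digraph_def dquiver_arcs dquiver_verts)

lemma rep_act_rep_space:
  assumes g: "g \<in> carrier (GL_prod dquiver dims)" and x: "x \<in> rep_space dquiver dims"
  shows "rep_act dquiver dims g x \<in> rep_space dquiver dims"
  unfolding rep_space_def rep_act_def
proof (rule restrict_PiE_iff[THEN iffD2], rule ballI)
  fix a assume a: "a \<in> arcs dquiver"
  then have v: "tail dquiver a \<in> verts dquiver" "head dquiver a \<in> verts dquiver" using wf_dquiver by (auto simp: wf_digraph_def)
  have "x a \<in> carrier_mat (dims (head dquiver a)) (dims (tail dquiver a))" using x a by (auto simp: rep_space_def)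
  then show "g (head dquiver a) * x a * inv\<^bsub>GL (dims (tail dquiver a))\<^esub> g (tail dquiver a)
      \<in> carrier_mat (dims (head dquiver a)) (dims (tail dquiver a))"
    using inv_GL(1)[OF GL_prod_component[OF g v(2)]] inv_GL(2)[OF GL_prod_component[OF g v(1)]] by simp
qed

text \<open>At each vertex the left-hand side of the relation is a combination of closed paths and
  is conjugated by \<open>g i\<close>, while a scalar matrix is fixed by conjugation. The
  computation runs in entries because \<open>commutator_sum\<close> is defined entrywise.\<close>

lemma Z_stable:
  assumes g: "g \<in> carrier (GL_prod dquiver dims)" and x: "x \<in> Z"
  shows "rep_act dquiver dims g x \<in> Z"
proof -
  let ?C = "commutator_sum (framed_quiver m) dims"
  let ?y = "rep_act dquiver dims g x"
  have xr: "x \<in> rep_space dquiver dims" using x by (simp add: Rep_Pi_def)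
  have yr: "?y \<in> rep_space dquiver dims" by (rule rep_act_rep_space[OF g xr])
  have arc: "path_fun dquiver dims (head dquiver a) (tail dquiver a) (\<lambda>x. x a)" if "a \<in> arcs dquiver" for a
    using that by (rule path_fun.arrow)
  have cancel: "M' = c \<cdot>\<^sub>m 1\<^sub>m (dims i)"
    if eq: "M' * g i = g i * (c \<cdot>\<^sub>m 1\<^sub>m (dims i))" and i: "i \<in> verts dquiver" and M': "M' \<in> carrier_mat (dims i) (dims i)"
    for M' c i
  proof -
    note gi = inv_GL[OF GL_prod_component[OF g i]]
    let ?h = "inv\<^bsub>GL (dims i)\<^esub> g i"
    have "M' = M' * g i * ?h"
      using gi M' by (simp add: assoc_mult_mat[of _ "dims i" "dims i" _ "dims i" _ "dims i"])
    also have "\<dots> = (c \<cdot>\<^sub>m g i) * ?h"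
      unfolding eq using gi by (simp add: mult_smult_distrib[of _ "dims i" "dims i" _ "dims i"])
    also have "\<dots> = c \<cdot>\<^sub>m 1\<^sub>m (dims i)"
      using gi by (simp add: mult_smult_assoc_mat[of _ "dims i" "dims i" _ "dims i"])
    finally show ?thesis .
  qed
  have comm: "?C ?y i * g i = g i * ?C x i"
    if i: "i \<in> verts (framed_quiver m)" for i
  proof -
    have i2: "i \<in> verts dquiver" using i by (simp add: double_quiver_def)
    note gi = inv_GL(1)[OF GL_prod_component[OF g i2]]
    let ?in = "{a \<in> arcs (framed_quiver m). head (framed_quiver m) a = i}"
    let ?out = "{a \<in> arcs (framed_quiver m). tail (framed_quiver m) a = i}"
    have fin: "finite ?in" "finite ?out" by (simp_all add: framed_quiver_def)
    have pin: "path_fun dquiver dims i i (\<lambda>x. x (Inl a) * x (Inr a))" if "a \<in> ?in" for a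
      using path_fun.comp[OF path_fun.arrow[of "Inl a" dquiver dims], of "tail dquiver (Inr a)" "\<lambda>x. x (Inr a)"]
        path_fun.arrow[of "Inr a" dquiver dims] that by (auto simp: double_quiver_def)
    have pout: "path_fun dquiver dims i i (\<lambda>x. x (Inr a) * x (Inl a))" if "a \<in> ?out" for a
      using path_fun.comp[OF path_fun.arrow[of "Inr a" dquiver dims], of "tail dquiver (Inl a)" "\<lambda>x. x (Inl a)"]
        path_fun.arrow[of "Inl a" dquiver dims] that by (auto simp: double_quiver_def)
    have right: "(\<Sum>k<dims i. p ?y $$ (r, k) * g i $$ (k, c)) = (\<Sum>k<dims i. g i $$ (r, k) * p x $$ (k, c))"
      if "path_fun dquiver dims i i p" "r < dims i" "c < dims i" for p r c
      using path_fun_equivariant[OF that(1) wf_dquiver g xr yr]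
        index_mult_mat_sum[OF path_fun_carrier[OF that(1) yr] gi that(2,3)]
        index_mult_mat_sum[OF gi path_fun_carrier[OF that(1) xr] that(2,3)] by simp
    show ?thesis
    proof (rule eq_matI)
      fix r c assume "r < dim_row (g i * ?C x i)"
        "c < dim_col (g i * ?C x i)"
      then have rc: "r < dims i" "c < dims i" using gi by (auto simp: commutator_sum_def)
      have cs: "?C z i \<in> carrier_mat (dims i) (dims i)" for z
        by (simp add: commutator_sum_def)
      have "(?C ?y i * g i) $$ (r, c) =
          (\<Sum>k<dims i. ((\<Sum>a\<in>?in. (?y (Inl a) * ?y (Inr a)) $$ (r, k)) - (\<Sum>a\<in>?out. (?y (Inr a) * ?y (Inl a)) $$ (r, k))) * g i $$ (k, c))"
        unfolding index_mult_mat_sum[OF cs gi rc] using rc by (simp add: commutator_sum_def del: index_mult_mat(1))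
      also have "\<dots> = (\<Sum>a\<in>?in. \<Sum>k<dims i. (?y (Inl a) * ?y (Inr a)) $$ (r, k) * g i $$ (k, c)) -
          (\<Sum>a\<in>?out. \<Sum>k<dims i. (?y (Inr a) * ?y (Inl a)) $$ (r, k) * g i $$ (k, c))"
        unfolding left_diff_distrib sum_subtractf sum_distrib_right
        by (intro arg_cong2[of _ _ _ _ "(-)"] sum.swap)
      also have "\<dots> = (\<Sum>a\<in>?in. \<Sum>k<dims i. g i $$ (r, k) * (x (Inl a) * x (Inr a)) $$ (k, c)) -
          (\<Sum>a\<in>?out. \<Sum>k<dims i. g i $$ (r, k) * (x (Inr a) * x (Inl a)) $$ (k, c))"
        by (intro arg_cong2[of _ _ _ _ "(-)"] sum.cong refl right[OF pin rc] right[OF pout rc])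
      also have "\<dots> = (\<Sum>k<dims i. g i $$ (r, k) * ((\<Sum>a\<in>?in. (x (Inl a) * x (Inr a)) $$ (k, c)) - (\<Sum>a\<in>?out. (x (Inr a) * x (Inl a)) $$ (k, c))))"
        unfolding right_diff_distrib sum_subtractf sum_distrib_left
        by (intro arg_cong2[of _ _ _ _ "(-)"] sum.swap)
      also have "\<dots> = (g i * ?C x i) $$ (r, c)"
        unfolding index_mult_mat_sum[OF gi cs rc] using rc by (simp add: commutator_sum_def del: index_mult_mat(1))
      finally show "(?C ?y i * g i) $$ (r, c) =
          (g i * ?C x i) $$ (r, c)" .
    qed (use gi in \<open>auto simp: commutator_sum_def\<close>)
  qed
  show ?thesis
    unfolding Rep_Pi_def
  proof (intro CollectI conjI yr ballI)
    fix i assume i: "i \<in> verts (framed_quiver m)"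
    show "?C ?y i = framed_par m lam \<alpha> i \<cdot>\<^sub>m 1\<^sub>m (dims i)"
    proof (rule cancel)
      show "?C ?y i * g i = g i * (framed_par m lam \<alpha> i \<cdot>\<^sub>m 1\<^sub>m (dims i))"
        using comm[OF i] x i by (simp add: Rep_Pi_def)
      show "i \<in> verts dquiver" using i by (simp add: double_quiver_def)
      show "?C ?y i \<in> carrier_mat (dims i) (dims i)"
        by (simp add: commutator_sum_def)
    qed
  qed
qed

sublocale stable_rep dquiver dims Z
proof (rule stable_rep.intro)
  show "Z \<subseteq> rep_space dquiver dims" by (auto simp: Rep_Pi_def)
qed (simp_all add: wf_dquiver dquiver_verts Z_stable)

end

section \<open>Cycles in the framed cyclic quiver\<close>

context framed_rep_algebra
begin

text \<open>Since the vertex \<open>\<infinity>\<close> has dimension one, a path through it splits there into a column times a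
  row, and everything between two passages is a scalar.\<close>

definition left_piece :: "vertex \<Rightarrow> (point \<Rightarrow> complex mat) \<Rightarrow> bool" where
  "left_piece i u \<longleftrightarrow> (case i of
     Vert a \<Rightarrow> \<exists>L. endpt 0 L = a \<and> (\<forall>x\<in>Z. u x = wmat 0 L x * v_map x)
   | Infty \<Rightarrow> \<forall>x\<in>Z. u x = 1\<^sub>m 1)"

definition right_piece :: "vertex \<Rightarrow> (point \<Rightarrow> complex mat) \<Rightarrow> bool" where
  "right_piece i r \<longleftrightarrow> (case i of
     Vert b \<Rightarrow> b < m \<and> (\<exists>L. endpt b L = 0 \<and> (\<forall>x\<in>Z. r x = w_map x * wmat b L x))
   | Infty \<Rightarrow> \<forall>x\<in>Z. r x = 1\<^sub>m 1)"

definition word_path :: "vertex \<Rightarrow> vertex \<Rightarrow> (point \<Rightarrow> complex mat) \<Rightarrow> bool" where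
  "word_path i j p \<longleftrightarrow> (\<exists>a b L. i = Vert a \<and> j = Vert b \<and> b < m \<and> endpt b L = a \<and> (\<forall>x\<in>Z. p x = wmat b L x))"

text \<open>\<open>u\<close> is the part of the path after its last visit to the framing vertex,
  \<open>r\<close> the part before its first visit, and \<open>h\<close> collects the scalars of the
  excursions in between.\<close>

definition split_path :: "vertex \<Rightarrow> vertex \<Rightarrow> (point \<Rightarrow> complex mat) \<Rightarrow> bool" where
  "split_path i j p \<longleftrightarrow> (\<exists>h u r. restrict h Z \<in> S \<and> left_piece i u \<and> right_piece j r \<and>
     (\<forall>x\<in>Z. p x = h x \<cdot>\<^sub>m (u x * r x)))"

lemma left_piece_carrier:
  assumes "left_piece i u" "x \<in> Z"
  shows "u x \<in> carrier_mat (dims i) 1"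
proof (cases i)
  case (Vert a)
  then obtain L where L: "endpt 0 L = a" "u x = wmat 0 L x * v_map x"
    using assms by (auto simp: left_piece_def)
  then have "a < m" using endpt_less[OF m_pos] by blast
  then show ?thesis
    using mult_carrier_mat[OF wmat_carrier[OF assms(2) m_pos, of L] Z_carrier(3)[OF assms(2)]] L Vert by simp
qed (use assms in \<open>auto simp: left_piece_def\<close>)

lemma right_piece_carrier:
  assumes "right_piece i r" "x \<in> Z"
  shows "r x \<in> carrier_mat 1 (dims i)"
proof (cases i)
  case (Vert b)
  then obtain L where L: "b < m" "endpt b L = 0" "r x = w_map x * wmat b L x"
    using assms by (auto simp: right_piece_def)
  then show ?thesis
    using mult_carrier_mat[OF Z_carrier(4)[OF assms(2)], of "wmat b L x" "\<alpha> b"] wmat_carrier[OF assms(2) L(1), of L] Vert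
    by simp
qed (use assms in \<open>auto simp: right_piece_def\<close>)

lemma word_path_carrier:
  assumes "word_path i j p" "x \<in> Z"
  shows "p x \<in> carrier_mat (dims i) (dims j)"
  using assms wmat_carrier[OF assms(2)] endpt_less by (auto simp: word_path_def)

lemma word_left_piece:
  assumes p: "word_path i j p" and u: "left_piece j u"
  shows "left_piece i (\<lambda>x. p x * u x)"
proof -
  obtain a b L where L: "i = Vert a" "j = Vert b" "b < m" "endpt b L = a" "\<And>x. x \<in> Z \<Longrightarrow> p x = wmat b L x"
    using p by (auto simp: word_path_def)
  obtain L' where L': "endpt 0 L' = b" "\<And>x. x \<in> Z \<Longrightarrow> u x = wmat 0 L' x * v_map x"
    using u L(2) by (auto simp: left_piece_def)
  have "p x * u x = wmat 0 (L @ L') x * v_map x" if x: "x \<in> Z" for x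
    using assoc_mult_mat[OF wmat_carrier[OF x L(3), of L] _ Z_carrier(3)[OF x], of "wmat 0 L' x"]
      wmat_carrier[OF x m_pos, of L'] by (simp add: L(5)[OF x] L'(2)[OF x] wmat_append[OF x m_pos] L'(1))
  then show ?thesis using L L' by (auto simp: left_piece_def endpt_append intro!: exI[of _ "L @ L'"])
qed

lemma right_word_piece:
  assumes r: "right_piece i r" and p: "word_path i j p"
  shows "right_piece j (\<lambda>x. r x * p x)"
proof -
  obtain a b L where L: "i = Vert a" "j = Vert b" "b < m" "endpt b L = a" "\<And>x. x \<in> Z \<Longrightarrow> p x = wmat b L x"
    using p by (auto simp: word_path_def)
  obtain L' where L': "a < m" "endpt a L' = 0" "\<And>x. x \<in> Z \<Longrightarrow> r x = w_map x * wmat a L' x"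
    using r L(1) by (auto simp: right_piece_def)
  have "r x * p x = w_map x * wmat b (L' @ L) x" if x: "x \<in> Z" for x
    using assoc_mult_mat[OF Z_carrier(4)[OF x], of "wmat a L' x" "\<alpha> a" "wmat b L x" "\<alpha> b"]
      wmat_carrier[OF x L'(1), of L'] wmat_carrier[OF x L(3), of L]
    by (simp add: L(5)[OF x] L'(3)[OF x] wmat_append[OF x L(3)] L(4) L'(2))
  then show ?thesis using L L' by (auto simp: right_piece_def endpt_append intro!: exI[of _ "L' @ L"])
qed

lemma word_word_path:
  assumes p: "word_path i j p" and q: "word_path j k q"
  shows "word_path i k (\<lambda>x. p x * q x)"
proof -
  obtain a b L where L: "i = Vert a" "j = Vert b" "b < m" "endpt b L = a" "\<And>x. x \<in> Z \<Longrightarrow> p x = wmat b L x"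
    using p by (auto simp: word_path_def)
  obtain c L' where L': "k = Vert c" "c < m" "endpt c L' = b" "\<And>x. x \<in> Z \<Longrightarrow> q x = wmat c L' x"
    using q L(2) by (auto simp: word_path_def)
  have "p x * q x = wmat c (L @ L') x" if x: "x \<in> Z" for x
    using wmat_append[OF x L'(2), of L L'] by (simp add: L(5)[OF x] L'(4)[OF x] L'(3))
  then show ?thesis using L L' by (auto simp: word_path_def endpt_append intro!: exI[of _ "L @ L'"])
qed

lemma smult_carrier_1: "(M :: complex mat) \<in> carrier_mat 1 1 \<Longrightarrow> M = (M $$ (0, 0)) \<cdot>\<^sub>m 1\<^sub>m 1"
  by (intro eq_matI) auto

context
  assumes W_mem: "\<And>L. closed_word L \<Longrightarrow> restrict (W L) Z \<in> S"
    and T_mem: "\<And>b L. closed_word L \<Longrightarrow> b < m \<Longrightarrow> restrict (T b L) Z \<in> S"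
begin

lemma pieces_mem:
  assumes r: "right_piece i r" and u: "left_piece i u"
  shows "(\<lambda>x\<in>Z. (r x * u x) $$ (0, 0)) \<in> S"
proof (cases i)
  case Infty
  then have eq: "(r x * u x) $$ (0, 0) = 1" if "x \<in> Z" for x
    using that assms by (simp add: right_piece_def left_piece_def)
  show ?thesis by (rule iffD2[OF mem_cong const_mem[of 1]]) (rule eq)
next
  case (Vert a)
  obtain L where L: "a < m" "endpt a L = 0" "\<And>x. x \<in> Z \<Longrightarrow> r x = w_map x * wmat a L x"
    using r Vert by (auto simp: right_piece_def)
  obtain L' where L': "endpt 0 L' = a" "\<And>x. x \<in> Z \<Longrightarrow> u x = wmat 0 L' x * v_map x"
    using u Vert by (auto simp: left_piece_def)
  have "endpt 0 (L @ L') = 0" using L(2) L'(1) by (simp add: endpt_append)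
  then have cl: "closed_word (L @ L')" using endpt_closed[OF m_pos] by blast
  have eq: "(r x * u x) $$ (0, 0) = W (L @ L') x" if x: "x \<in> Z" for x
  proof -
    note c = Z_carrier(3,4)[OF x] wmat_carrier[OF x L(1), of L, unfolded L(2)] wmat_carrier[OF x m_pos, of L', unfolded L'(1)]
    have "r x * u x = w_map x * (wmat a L x * (wmat 0 L' x * v_map x))"
      unfolding L(3)[OF x] L'(2)[OF x] using c by (intro assoc_mult_mat[of _ 1 "\<alpha> 0" _ "\<alpha> a" _ 1]) auto
    also have "wmat a L x * (wmat 0 L' x * v_map x) = wmat a L x * wmat 0 L' x * v_map x"
      using c by (intro assoc_mult_mat[symmetric]) auto
    also have "w_map x * (wmat a L x * wmat 0 L' x * v_map x) = w_map x * (wmat a L x * wmat 0 L' x) * v_map x"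
      using c by (intro assoc_mult_mat[symmetric, of _ 1 "\<alpha> 0" _ "\<alpha> 0" _ 1]) auto
    also have "wmat a L x * wmat 0 L' x = wmat 0 (L @ L') x" using wmat_append[OF x m_pos, of L L'] L'(1) by simp
    finally show ?thesis using c by (simp add: W_def mat_trace_def)
  qed
  show ?thesis by (rule iffD2[OF mem_cong W_mem[OF cl]]) (rule eq)
qed

lemma path_fun_cases: "path_fun dquiver dims i j p \<Longrightarrow> word_path i j p \<or> split_path i j p"
proof (induction rule: path_fun.induct)
  case (empty i)
  then consider "i = Infty" | a where "i = Vert a" "a < m" by (auto simp: dquiver_verts)
  then show ?case
  proof cases
    case 1
    have "1\<^sub>m (dims Infty) = 1 \<cdot>\<^sub>m (1\<^sub>m 1 * 1\<^sub>m 1 :: complex mat)" by auto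
    then have "split_path Infty Infty (\<lambda>x. 1\<^sub>m (dims Infty))"
      unfolding split_path_def using const_mem[of 1]
      by (intro exI[of _ "\<lambda>x. 1"] exI[of _ "\<lambda>x. 1\<^sub>m 1"]) (simp add: left_piece_def right_piece_def)
    then show ?thesis using 1 by blast
  next
    case 2
    then have "word_path i i (\<lambda>x. 1\<^sub>m (dims i))"
      unfolding word_path_def by (intro exI[of _ a] exI[of _ "[]"]) simp
    then show ?thesis by blast
  qed
next
  case (arrow a)
  then consider "a = Inl Arr_infty" | "a = Inr Arr_infty" | i where "a = Inl (Arr i)" "i < m"
    | i where "a = Inr (Arr i)" "i < m" by (auto simp: dquiver_arcs)
  then show ?case
  proof cases
    case 1
    have eq: "v_map x = 1 \<cdot>\<^sub>m ((wmat 0 [] x * v_map x) * 1\<^sub>m 1)" if "x \<in> Z" for x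
      using Z_carrier(3)[OF that] by auto
    have "left_piece (Vert 0) (\<lambda>x. wmat 0 [] x * v_map x)" "right_piece Infty (\<lambda>x. 1\<^sub>m 1)"
      by (auto simp: left_piece_def right_piece_def simp del: wmat.simps intro!: exI[of _ "[]"])
    then have "split_path (Vert 0) Infty v_map"
      unfolding split_path_def using const_mem[of 1] eq by blast
    then show ?thesis using 1 by simp
  next
    case 2
    have eq: "w_map x = 1 \<cdot>\<^sub>m (1\<^sub>m 1 * (w_map x * wmat 0 [] x))" if "x \<in> Z" for x
      using Z_carrier(4)[OF that] by auto
    have "left_piece Infty (\<lambda>x. 1\<^sub>m 1)" "right_piece (Vert 0) (\<lambda>x. w_map x * wmat 0 [] x)"
      using m_pos by (auto simp: left_piece_def right_piece_def simp del: wmat.simps intro!: exI[of _ "[]"])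
    then have "split_path Infty (Vert 0) w_map"
      unfolding split_path_def using const_mem[of 1] eq by blast
    then show ?thesis using 2 by simp
  next
    case 3
    have "endpt ((i + 1) mod m) [LX] = i" using pred_succ_mod[OF 3(2)] by (simp add: target_def)
    moreover have "X_map x i = wmat ((i + 1) mod m) [LX] x" if "x \<in> Z" for x
      using pred_succ_mod[OF 3(2)] Z_carrier(1)[OF that 3(2)] by (simp add: lmat_def)
    ultimately have "word_path (Vert i) (Vert ((i + 1) mod m)) (\<lambda>x. X_map x i)"
      unfolding word_path_def using m_pos by (auto simp del: wmat.simps endpt.simps)
    then show ?thesis using 3 by simp
  next
    case 4
    have "Y_map x i = wmat i [LY] x" if "x \<in> Z" for x
      using Z_carrier(2)[OF that 4(2)] by (simp add: lmat_def)
    moreover have "endpt i [LY] = (i + 1) mod m" by (simp add: target_def)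
    ultimately have "word_path (Vert ((i + 1) mod m)) (Vert i) (\<lambda>x. Y_map x i)"
      unfolding word_path_def using 4(2) by (auto simp del: wmat.simps endpt.simps)
    then show ?thesis using 4 by simp
  qed
next
  case (comp i j p k q)
  from comp.IH show ?case
  proof (elim disjE)
    assume "word_path i j p" "word_path j k q"
    then show ?thesis using word_word_path by blast
  next
    assume p: "word_path i j p" and "split_path j k q"
    then obtain h u r where q: "restrict h Z \<in> S" "left_piece j u" "right_piece k r"
      "\<And>x. x \<in> Z \<Longrightarrow> q x = h x \<cdot>\<^sub>m (u x * r x)" by (auto simp: split_path_def)
    have "p x * q x = h x \<cdot>\<^sub>m (p x * u x * r x)" if x: "x \<in> Z" for x
    proof -
      note c = word_path_carrier[OF p x] left_piece_carrier[OF q(2) x] right_piece_carrier[OF q(3) x]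
      show ?thesis
        using c by (simp add: q(4)[OF x] mult_smult_distrib[of _ "dims i" "dims j" _ "dims k"]
            assoc_mult_mat[of _ "dims i" "dims j" _ 1 _ "dims k"])
    qed
    then have "split_path i k (\<lambda>x. p x * q x)"
      unfolding split_path_def using q(1,3) word_left_piece[OF p q(2)] by blast
    then show ?thesis by blast
  next
    assume "split_path i j p" and q: "word_path j k q"
    then obtain h u r where p: "restrict h Z \<in> S" "left_piece i u" "right_piece j r"
      "\<And>x. x \<in> Z \<Longrightarrow> p x = h x \<cdot>\<^sub>m (u x * r x)" by (auto simp: split_path_def)
    have "p x * q x = h x \<cdot>\<^sub>m (u x * (r x * q x))" if x: "x \<in> Z" for x
    proof -
      note c = word_path_carrier[OF q x] left_piece_carrier[OF p(2) x] right_piece_carrier[OF p(3) x]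
      have "p x * q x = h x \<cdot>\<^sub>m (u x * r x * q x)"
        unfolding p(4)[OF x] using c by (intro mult_smult_assoc_mat[of _ "dims i" "dims j" _ "dims k"]) auto
      then show ?thesis using assoc_mult_mat[OF c(2,3,1)] by simp
    qed
    then have "split_path i k (\<lambda>x. p x * q x)"
      unfolding split_path_def using p(1,2) right_word_piece[OF p(3) q] by blast
    then show ?thesis by blast
  next
    assume "split_path i j p" "split_path j k q"
    then obtain h u r h' u' r' where p: "restrict h Z \<in> S" "left_piece i u" "right_piece j r"
        "\<And>x. x \<in> Z \<Longrightarrow> p x = h x \<cdot>\<^sub>m (u x * r x)"
      and q: "restrict h' Z \<in> S" "left_piece j u'" "right_piece k r'"
        "\<And>x. x \<in> Z \<Longrightarrow> q x = h' x \<cdot>\<^sub>m (u' x * r' x)"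
      by (fastforce simp: split_path_def)
    \<comment> \<open>Where two split paths meet, a row times a column is a 1 by 1 matrix. Its entry
      is a value of \<open>W\<close> or 1, and it moves into the scalar factor.\<close>
    let ?s = "\<lambda>x. (r x * u' x) $$ (0, 0)"
    have "p x * q x = (h x * h' x * ?s x) \<cdot>\<^sub>m (u x * r' x)" if x: "x \<in> Z" for x
    proof -
      note c = left_piece_carrier[OF p(2) x] right_piece_carrier[OF p(3) x]
        left_piece_carrier[OF q(2) x] right_piece_carrier[OF q(3) x]
      have s: "r x * u' x = ?s x \<cdot>\<^sub>m 1\<^sub>m 1"
        by (rule smult_carrier_1) (use c in auto)
      have "(u x * r x) * (u' x * r' x) = u x * (r x * (u' x * r' x))"
        using c by (intro assoc_mult_mat[of _ "dims i" 1 _ "dims j" _ "dims k"]) auto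
      also have "r x * (u' x * r' x) = (r x * u' x) * r' x"
        using c by (intro assoc_mult_mat[symmetric]) auto
      also have "\<dots> = (?s x \<cdot>\<^sub>m 1\<^sub>m 1) * r' x"
        by (rule arg_cong[OF s])
      also have "\<dots> = ?s x \<cdot>\<^sub>m r' x"
        using c by (subst mult_smult_assoc_mat[of _ 1 1 _ "dims k"]) auto
      also have "u x * (?s x \<cdot>\<^sub>m r' x) = ?s x \<cdot>\<^sub>m (u x * r' x)"
        using c by (intro mult_smult_distrib) auto
      finally have "(u x * r x) * (u' x * r' x) = ?s x \<cdot>\<^sub>m (u x * r' x)" .
      moreover have "p x * q x = h x \<cdot>\<^sub>m (h' x \<cdot>\<^sub>m ((u x * r x) * (u' x * r' x)))"
        unfolding p(4)[OF x] q(4)[OF x] using c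
        by (subst mult_smult_assoc_mat[of _ "dims i" "dims j" _ "dims k"], (auto)[2],
            subst mult_smult_distrib[of _ "dims i" "dims j" _ "dims k"]) auto
      moreover have "a \<cdot>\<^sub>m (b \<cdot>\<^sub>m M) = (a * b) \<cdot>\<^sub>m M" for a b and M :: "complex mat"
        by (intro eq_matI) auto
      ultimately show ?thesis by (simp add: mult.assoc)
    qed
    moreover have "(\<lambda>x\<in>Z. h x * h' x * ?s x) \<in> S"
      by (intro mult_mem p(1) q(1) pieces_mem[OF p(3) q(2)])
    ultimately have "split_path i k (\<lambda>x. p x * q x)"
      unfolding split_path_def using p(2) q(3) by blast
    then show ?thesis by blast
  qed
qed

text \<open>A cycle that avoids the framing vertex is a closed word, with trace \<open>T\<close>.
  For a cycle through it, cyclicity of the trace turns column times row into a scalar covered by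
  \<open>pieces_mem\<close>.\<close>

lemma path_trace_mem:
  assumes "path_fun dquiver dims i i p"
  shows "(\<lambda>x\<in>Z. mat_trace (p x)) \<in> S"
  using path_fun_cases[OF assms]
proof
  assume "word_path i i p"
  then obtain b L where L: "b < m" "endpt b L = b" "\<And>x. x \<in> Z \<Longrightarrow> p x = wmat b L x"
    by (auto simp: word_path_def)
  then have cl: "closed_word L" using endpt_closed by blast
  show ?thesis
    by (rule iffD2[OF mem_cong T_mem[OF cl L(1)]]) (simp add: L(3) T_def)
next
  assume "split_path i i p"
  then obtain h u r where p: "restrict h Z \<in> S" "left_piece i u" "right_piece i r"
    "\<And>x. x \<in> Z \<Longrightarrow> p x = h x \<cdot>\<^sub>m (u x * r x)" by (auto simp: split_path_def)
  have eq: "mat_trace (p x) = h x * (r x * u x) $$ (0, 0)" if x: "x \<in> Z" for x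
  proof -
    note c = left_piece_carrier[OF p(2) x] right_piece_carrier[OF p(3) x]
    have "mat_trace (p x) = h x * mat_trace (u x * r x)"
      unfolding p(4)[OF x] by (rule mat_trace_smult[OF mult_carrier_mat[OF c]])
    also have "mat_trace (u x * r x) = mat_trace (r x * u x)" by (rule mat_trace_mult_commute[OF c])
    also have "\<dots> = (r x * u x) $$ (0, 0)" by (rule mat_trace_1[OF mult_carrier_mat[OF c(2,1)]])
    finally show ?thesis .
  qed
  show ?thesis
    by (rule iffD2[OF mem_cong mult_mem[OF p(1) pieces_mem[OF p(3,2)]]]) (rule eq)
qed

end

end

context stable_rep
begin

lemma path_trace_regular:
  assumes "path_fun Q \<beta> i i p"
  shows "(\<lambda>x\<in>Z. mat_trace (p x)) \<in> generated_algebra Z (coordinate_functions Q \<beta>)"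
proof -
  interpret G: function_algebra Z "generated_algebra Z (coordinate_functions Q \<beta>)"
    by (rule function_algebra_generated)
  have "G.entries_mem (\<beta> i) (\<beta> j) p" if "path_fun Q \<beta> i j p" for i j p
    using that
  proof induction
    case (empty i)
    show ?case unfolding G.entries_mem_def
    proof (intro conjI ballI allI impI)
      fix r c assume "r < \<beta> i" "c < \<beta> i"
      then show "(\<lambda>x\<in>Z. 1\<^sub>m (\<beta> i) $$ (r, c)) \<in> generated_algebra Z (coordinate_functions Q \<beta>)"
        by (intro G.const_mem)
    qed simp
  next
    case (arrow a)
    have "(\<lambda>x. x a $$ (r, c)) \<in> coordinate_functions Q \<beta>" if "r < \<beta> (head Q a)" "c < \<beta> (tail Q a)" for r c
      unfolding coordinate_functions_def using arrow that by blast
    then show ?case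
      unfolding G.entries_mem_def using path_carrier[OF path_fun.arrow[OF arrow]]
      by (blast intro: generated_algebra.gen)
  next
    case (comp i j p k q)
    then show ?case using G.entries_mult by blast
  qed
  then show ?thesis using G.entries_trace assms by blast
qed

end

section \<open>The invariant ring and its generation by either family\<close>

context framed_rep
begin

abbreviation "OM \<equiv> O_M (framed_quiver m) (framed_par m lam \<alpha>) dims"

lemma GL_prod_dquiver: "GL_prod dquiver dims = GL_prod (framed_quiver m) dims"
  by (simp add: GL_prod_def double_quiver_def)

abbreviation "gauge_group \<equiv> GL_prod (framed_quiver m) dims"
abbreviation "scalar_group \<equiv> scalars (framed_quiver m) dims"
abbreviation "quotient_group \<equiv> G_group (framed_quiver m) dims"

lemma group_GL_prod: "group gauge_group"
  unfolding GL_prod_def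
  by (rule product_group) (rule monoid.units_group[OF ring.is_monoid[OF ring_mat]])

lemma scalars_carrier: "scalar_group \<subseteq> carrier gauge_group"
  by (auto simp: scalars_def GL_prod_def scalar_in_GL)

text \<open>\<open>O_M\<close> tests invariance on all representatives of all cosets of the scalars.
  As the cosets exhaust the group, this is invariance under \<open>GL_prod\<close>, the form in
  which the theorem on traces is stated.\<close>

lemma Union_G_group:
  "\<Union> (carrier quotient_group) = carrier gauge_group"
proof -
  interpret group "gauge_group" by (rule group_GL_prod)
  have one: "\<one>\<^bsub>gauge_group\<^esub> \<in> scalar_group"
  proof -
    have "\<one>\<^bsub>GL n\<^esub> = 1 \<cdot>\<^sub>m 1\<^sub>m n" for n
      by (auto simp: units_of_def ring_mat_def)
    then show ?thesis
      unfolding scalars_def GL_prod_def by (auto intro!: exI[of _ 1])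
  qed
  have "carrier quotient_group = rcosets\<^bsub>gauge_group\<^esub> scalar_group"
    by (simp add: G_group_def FactGroup_def)
  then have K: "\<Union> (carrier quotient_group) = (\<Union>g\<in>carrier gauge_group.
      scalar_group #>\<^bsub>gauge_group\<^esub> g)"
    by (auto simp: RCOSETS_def)
  have 1: "g \<in> scalar_group #>\<^bsub>gauge_group\<^esub> g"
    if "g \<in> carrier gauge_group" for g
    using one that unfolding r_coset_def by force
  have 2: "scalar_group #>\<^bsub>gauge_group\<^esub> g \<subseteq> carrier gauge_group"
    if "g \<in> carrier gauge_group" for g
    by (rule r_coset_subset_G[OF scalars_carrier that])
  show ?thesis
    unfolding K
  proof (intro equalityI subsetI)
    fix h assume "h \<in> (\<Union>g\<in>carrier gauge_group.
      scalar_group #>\<^bsub>gauge_group\<^esub> g)"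
    then obtain g where g: "g \<in> carrier gauge_group"
      "h \<in> scalar_group #>\<^bsub>gauge_group\<^esub> g" by (rule UN_E)
    show "h \<in> carrier gauge_group" by (rule subsetD[OF 2[OF g(1)] g(2)])
  next
    fix g assume g: "g \<in> carrier gauge_group"
    show "g \<in> (\<Union>g\<in>carrier gauge_group.
      scalar_group #>\<^bsub>gauge_group\<^esub> g)"
      using 1[OF g] g by (intro UnionI[OF imageI])
  qed
qed

lemma OM_iff: "f \<in> OM \<longleftrightarrow> f \<in> generated_algebra Z (coordinate_functions dquiver dims) \<and>
    (\<forall>g\<in>carrier (GL_prod dquiver dims). \<forall>x\<in>Z. f (rep_act dquiver dims g x) = f x)"
proof -
  have "(\<forall>K\<in>C. \<forall>g\<in>K. P g) \<longleftrightarrow> (\<forall>g\<in>\<Union>C. P g)" for C and P :: "(vertex \<Rightarrow> complex mat) \<Rightarrow> bool"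
    by blast
  then show ?thesis
    unfolding O_M_def O_Rep_Pi_def GL_prod_dquiver Union_G_group[symmetric] by simp
qed

lemma function_algebra_OM: "function_algebra Z OM"
proof
  show "(\<lambda>x\<in>Z. c) \<in> OM" for c
    using Z_stable generated_algebra.const by (simp add: OM_iff)
  fix f g assume "f \<in> OM" "g \<in> OM"
  note fg = this[unfolded OM_iff]
  show "(\<lambda>x\<in>Z. f x + g x) \<in> OM" "(\<lambda>x\<in>Z. f x * g x) \<in> OM"
    using Z_stable fg generated_algebra.add[OF fg[THEN conjunct1]] generated_algebra.mult[OF fg[THEN conjunct1]]
    by (simp_all add: OM_iff)
qed

lemma path_trace_OM:
  assumes "path_fun dquiver dims i i p"
  shows "(\<lambda>x\<in>Z. mat_trace (p x)) \<in> OM"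
proof -
  have "mat_trace (p (rep_act dquiver dims g x)) = mat_trace (p x)"
    if "g \<in> carrier (GL_prod dquiver dims)" "x \<in> Z" for g x
    using path_fun_trace_invariant[OF assms wf_dquiver that(1)] that Z_stable Z_rep by blast
  then show ?thesis using path_trace_regular[OF assms] Z_stable by (simp add: OM_iff)
qed

lemma wmat_path_fun: "b < m \<Longrightarrow> path_fun dquiver dims (Vert (endpt b L)) (Vert b) (wmat b L)"
proof (induction L)
  case Nil
  have "path_fun dquiver dims (Vert b) (Vert b) (\<lambda>x. 1\<^sub>m (dims (Vert b)))"
    using Nil by (intro path_fun.empty) (simp add: dquiver_verts)
  then show ?case using Nil by (simp add: wmat.simps[abs_def])
next
  case (Cons l L)
  let ?i = "endpt b L"
  have i: "?i < m" using Cons.prems by (rule endpt_less)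
  have "path_fun dquiver dims (Vert (target l ?i)) (Vert ?i) (lmat l ?i)"
  proof (cases l)
    case LX
    have "(?i + (m - 1)) mod m < m" using m_pos by simp
    then have "Inl (Arr ((?i + (m - 1)) mod m)) \<in> arcs dquiver" by (auto simp: dquiver_arcs)
    from path_fun.arrow[OF this, of dims] show ?thesis
      unfolding dquiver_ends succ_pred_mod[OF i] by (simp add: LX target_def lmat_def[abs_def])
  next
    case LY
    have "Inr (Arr ?i) \<in> arcs dquiver" using i by (auto simp: dquiver_arcs)
    from path_fun.arrow[OF this, of dims] show ?thesis
      by (simp add: LY target_def lmat_def[abs_def])
  qed
  from path_fun.comp[OF this Cons.IH[OF Cons.prems]] show ?case by (simp add: wmat.simps[abs_def])
qed

lemma words_OM:
  assumes "closed_word L"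
  shows "restrict (T 0 L) Z \<in> OM" "restrict (W L) Z \<in> OM"
proof -
  have e: "endpt 0 L = 0" using endpt_closed[OF m_pos] assms by blast
  have wmat: "path_fun dquiver dims (Vert 0) (Vert 0) (wmat 0 L)"
    using wmat_path_fun[OF m_pos, of L] unfolding e .
  show "restrict (T 0 L) Z \<in> OM"
    using path_trace_OM[OF wmat] by (simp add: T_def[abs_def])
  have v: "path_fun dquiver dims (Vert 0) Infty v_map" and w: "path_fun dquiver dims Infty (Vert 0) w_map"
    using path_fun.arrow[of "Inl Arr_infty" dquiver dims] path_fun.arrow[of "Inr Arr_infty" dquiver dims]
    by (auto simp: dquiver_arcs)
  show "restrict (W L) Z \<in> OM"
    using path_trace_OM[OF path_fun.comp[OF path_fun.comp[OF w wmat] v]] by (simp add: W_def[abs_def])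
qed

text \<open>\<open>F\<close> stands for either family. One inclusion holds because both families
  consist of traces of cycles in the double quiver. For the other, invariants reduce to traces of
  cycles, these to closed words, and \<open>words_mem\<close> obtains all closed words from the
  family at hand.\<close>

lemma generated_eq_OM:
  assumes lam: "(\<Sum>i<m. lam i) \<noteq> 0"
    and gens: "(\<forall>x\<in>Z. \<forall>i j k. k < m \<longrightarrow> F k i j x = T 0 (nf (m * i + k) (k + m * j)) x) \<or>
      (\<forall>x\<in>Z. \<forall>i j k. k < m \<longrightarrow> F k i j x = W (nf (m * i + k) (k + m * j)) x)" (is "?tr \<or> ?mo")
  shows "generated_algebra Z {F k i j | i j k. k < m} = OM"
proof
  interpret OM: function_algebra Z OM by (rule function_algebra_OM)
  have cl: "closed_word (nf (m * i + k) (k + m * j))" for i j k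
  proof -
    have "(m * i + k) + (m - 1) * (k + m * j) = m * (i + k + (m - 1) * j)"
      using m by (cases m) (auto simp: algebra_simps)
    then show ?thesis unfolding closed_nf by simp
  qed
  show "generated_algebra Z {F k i j | i j k. k < m} \<subseteq> OM"
  proof (rule OM.generated_subset)
    fix f assume "f \<in> {F k i j | i j k. k < m}"
    then obtain i j k where f: "f = F k i j" "k < m" by blast
    from gens show "restrict f Z \<in> OM"
    proof
      assume "?tr"
      then show ?thesis using f by (intro iffD2[OF OM.mem_cong words_OM(1)[OF cl]]) auto
    next
      assume "?mo"
      then show ?thesis using f by (intro iffD2[OF OM.mem_cong words_OM(2)[OF cl]]) auto
    qed
  qed
  define S where "S = generated_algebra Z {F k i j | i j k. k < m}"
  interpret framed_rep_algebra m lam \<alpha> S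
    unfolding framed_rep_algebra_def S_def using framed_rep_axioms function_algebra_generated by blast
  have F: "restrict (F k i j) Z \<in> S" if "k < m" for i j k
    unfolding S_def using that by (intro generated_algebra.gen) blast
  have "(\<forall>q p. closed_word (nf q p) \<longrightarrow> restrict (T 0 (nf q p)) Z \<in> S) \<or>
      (\<forall>q p. closed_word (nf q p) \<longrightarrow> restrict (W (nf q p)) Z \<in> S)"
    using gens
  proof
    assume *: "?tr"
    have "restrict (T 0 (nf q p)) Z \<in> S" if cl': "closed_word (nf q p)" for q p
    proof -
      obtain i j k where d: "k < m" "q = m * i + k" "p = k + m * j" using closed_nf_decompose[OF cl'] .
      show ?thesis by (rule iffD2[OF mem_cong F[OF d(1)]]) (use * d in auto)
    qed
    then show ?thesis by blast
  next
    assume *: "?mo"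
    have "restrict (W (nf q p)) Z \<in> S" if cl': "closed_word (nf q p)" for q p
    proof -
      obtain i j k where d: "k < m" "q = m * i + k" "p = k + m * j" using closed_nf_decompose[OF cl'] .
      show ?thesis by (rule iffD2[OF mem_cong F[OF d(1)]]) (use * d in auto)
    qed
    then show ?thesis by blast
  qed
  note words = words_mem[OF lam this]
  have traces: "generated_algebra Z {\<lambda>x. mat_trace (p x) | p i. path_fun dquiver dims i i p} \<subseteq> S"
    by (rule generated_subset) (auto intro!: path_trace_mem words)
  show "OM \<subseteq> generated_algebra Z {F k i j | i j k. k < m}"
  proof
    fix f assume "f \<in> OM"
    then have "f \<in> generated_algebra Z {\<lambda>x. mat_trace (p x) | p i. path_fun dquiver dims i i p}"
      unfolding OM_iff by (intro invariants_generated_by_traces) auto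
    then show "f \<in> generated_algebra Z {F k i j | i j k. k < m}"
      using traces unfolding S_def by blast
  qed
qed

end

text \<open>Each vertex of the cycle has one incoming and one outgoing arrow, so the vector \<delta>
  pairs to 0 with all coordinate vectors. As its support is connected, it lies in the fundamental
  region and is an imaginary root. For \<open>m = 1\<close> the arrow is a loop, and the same count
  applies.\<close>

lemma delta_root:
  assumes m: "m \<ge> 1"
  shows "(\<lambda>v. if v \<in> Vert ` {..<m} then 1 else 0) \<in> roots (cyclic_quiver m)" (is "?\<delta> \<in> _")
proof -
  let ?Q = "cyclic_quiver m"
  have sym: "sym_form ?Q ?\<delta> (coord_vec v) = 0" if v: "v \<in> verts ?Q" for v
  proof -
    obtain i where i: "v = Vert i" "i < m" using v by (auto simp: cyclic_quiver_def)
    have V: "(\<Sum>u\<in>Vert ` {..<m}. coord_vec v u) = 1"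
      using i by (simp add: sum.reindex inj_on_def coord_vec_def)
    have h: "(\<Sum>a\<in>Arr ` {..<m}. coord_vec v (arrow_head m a)) = 1"
      using i by (simp add: sum.reindex inj_on_def coord_vec_def)
    have t: "(\<Sum>a\<in>Arr ` {..<m}. coord_vec v (arrow_tail m a)) = 1"
    proof -
      have "(\<Sum>a\<in>Arr ` {..<m}. coord_vec v (arrow_tail m a)) = (\<Sum>k<m. coord_vec v (Vert ((k + 1) mod m)))"
        by (simp add: sum.reindex inj_on_def)
      also have "\<dots> = (\<Sum>k<m. coord_vec v (Vert k))"
        using sum_rotate[of m "\<lambda>k. coord_vec v (Vert k)" 1] m by simp
      also have "\<dots> = 1" using i by (simp add: coord_vec_def)
      finally show ?thesis .
    qed
    have "(\<Sum>u\<in>Vert ` {..<m}. ?\<delta> u * coord_vec v u) = 1" "(\<Sum>u\<in>Vert ` {..<m}. coord_vec v u * ?\<delta> u) = 1"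
      using V by simp_all
    moreover have "(\<Sum>a\<in>Arr ` {..<m}. ?\<delta> (arrow_tail m a) * coord_vec v (arrow_head m a)) = 1"
      using h m by (subst sum.cong[of _ "Arr ` {..<m}" _ "\<lambda>a. coord_vec v (arrow_head m a)"]) auto
    moreover have "(\<Sum>a\<in>Arr ` {..<m}. coord_vec v (arrow_tail m a) * ?\<delta> (arrow_head m a)) = 1"
      using t m by (subst sum.cong[of _ "Arr ` {..<m}" _ "\<lambda>a. coord_vec v (arrow_tail m a)"]) auto
    ultimately show ?thesis
      by (simp add: sym_form_def ringel_form_def cyclic_quiver_def)
  qed
  have supp: "{v. ?\<delta> v \<noteq> 0} = Vert ` {..<m}" by auto
  define G where "G = ?Q \<restriction> {v. ?\<delta> v \<noteq> 0}"
  have G: "verts G = Vert ` {..<m}" "arcs G = Arr ` {..<m}" "tail G = arrow_tail m" "head G = arrow_head m"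
    unfolding G_def supp using m by (auto simp: induce_subgraph_def cyclic_quiver_def)
  have verts: "Vert i \<in> pverts (mk_symmetric G)" if "i < m" for i
    using that by (simp add: mk_symmetric_def G)
  have edge: "(Vert i, Vert (Suc i)) \<in> parcs (mk_symmetric G)" "(Vert (Suc i), Vert i) \<in> parcs (mk_symmetric G)"
    if "Suc i < m" for i
  proof -
    have a: "Arr i \<in> arcs G" and ends: "tail G (Arr i) = Vert (Suc i)" "head G (Arr i) = Vert i"
      using that by (simp_all add: G)
    show "(Vert i, Vert (Suc i)) \<in> parcs (mk_symmetric G)" "(Vert (Suc i), Vert i) \<in> parcs (mk_symmetric G)"
      unfolding parcs_mk_symmetric by (rule UN_I[OF a], simp add: ends)+
  qed
  let ?R = "rtrancl_on (pverts (mk_symmetric G)) (parcs (mk_symmetric G))"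
  \<comment> \<open>All vertices are joined to \<open>Vert 0\<close> along the arrows that do not
    wrap around, so that no residues modulo \<open>m\<close> occur.\<close>
  have reach: "(Vert 0, Vert i) \<in> ?R \<and> (Vert i, Vert 0) \<in> ?R" if "i < m" for i
    using that
  proof (induction i)
    case 0
    then show ?case using verts by (auto intro: rtrancl_on_refl)
  next
    case (Suc i)
    then have "Vert i \<in> pverts (mk_symmetric G)" "Vert (Suc i) \<in> pverts (mk_symmetric G)" using verts by auto
    then have "(Vert i, Vert (Suc i)) \<in> ?R" "(Vert (Suc i), Vert i) \<in> ?R"
      using edge[OF Suc.prems] by (meson rtrancl_on_into_rtrancl_on rtrancl_on_refl)+
    moreover have "(Vert 0, Vert i) \<in> ?R" "(Vert i, Vert 0) \<in> ?R" using Suc by auto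
    ultimately show ?case by (blast intro: rtrancl_on_trans)
  qed
  have "connected G"
    unfolding connected_def strongly_connected_def
  proof (intro conjI ballI)
    show "verts (mk_symmetric G) \<noteq> {}" using verts[of 0] m by auto
    fix u v assume "u \<in> verts (mk_symmetric G)" "v \<in> verts (mk_symmetric G)"
    then obtain i j where ij: "u = Vert i" "i < m" "v = Vert j" "j < m"
      by (auto simp: mk_symmetric_def G)
    then have "(u, v) \<in> ?R" using reach[OF ij(2)] reach[OF ij(4)] rtrancl_on_trans by metis
    then show "u \<rightarrow>\<^sup>*\<^bsub>mk_symmetric G\<^esub> v"
      unfolding reachable_def by simp
  qed
  then have "connected (?Q \<restriction> {v. ?\<delta> v \<noteq> 0})" by (simp only: G_def)
  moreover have "?\<delta> \<noteq> (\<lambda>_. 0)"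
  proof
    assume "?\<delta> = (\<lambda>_. 0)"
    from fun_cong[OF this, of "Vert 0"] show False using m by auto
  qed
  ultimately have "?\<delta> \<in> fundamental_region ?Q"
    using sym by (auto simp: fundamental_region_def cyclic_quiver_def)
  then show ?thesis by (simp add: roots_def imaginary_roots.fund)
qed

theorem theorem8:
  fixes m :: nat and lam :: "nat \<Rightarrow> complex" and \<alpha> :: "nat \<Rightarrow> nat"
  assumes "m \<ge> 1"
    and "generic m lam"
    and "(\<lambda>i. int (framed_dim m \<alpha> i)) \<in> Sigma_set (framed_quiver m) (framed_par m lam \<alpha>)"
  shows "generated_algebra (Rep_Pi (framed_quiver m) (framed_par m lam \<alpha>) (framed_dim m \<alpha>))
           {G_fun m \<alpha> k i j | i j k. k < m}
         = O_M (framed_quiver m) (framed_par m lam \<alpha>) (framed_dim m \<alpha>)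
       \<and> generated_algebra (Rep_Pi (framed_quiver m) (framed_par m lam \<alpha>) (framed_dim m \<alpha>))
           {H_fun m \<alpha> k i j | i j k. k < m}
         = O_M (framed_quiver m) (framed_par m lam \<alpha>) (framed_dim m \<alpha>)"
proof -
  interpret framed_rep m lam \<alpha> by unfold_locales (rule assms(1))
  \<comment> \<open>Genericity is applied to the imaginary root \<delta>; it makes invertible the
    number that relates the two families.\<close>
  have "(\<Sum>i<m. lam i * of_int (if Vert i \<in> Vert ` {..<m} then 1 else 0)) \<noteq> 0"
    using bspec[OF assms(2)[unfolded generic_def] delta_root[OF assms(1)]] .
  moreover have "(\<Sum>i<m. lam i * of_int (if Vert i \<in> Vert ` {..<m} then 1 else 0)) = (\<Sum>i<m. lam i)"
    by (intro sum.cong) auto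
  ultimately have lam: "(\<Sum>i<m. lam i) \<noteq> 0" by simp
  show ?thesis
    by (intro conjI generated_eq_OM[OF lam]) (simp_all add: G_fun_T H_fun_W)
qed

end
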